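(* Let $(X_t)_{t\ge0}$ be an ergodic, time-homogeneous Markov process on $\mathbb{R}^d$ with invariant probability measure $\mu$, and let $\mathcal L$ with domain $\mathscr D(\mathcal L)$ be the infinitesimal generator of its transition semigroup on $L^2(\mu)$. Assume $L^2(\mu)$-coercivity: there exists $\lambda_{\mathrm C}>0$ such that $\langle-\mathcal Lf,f\rangle_{L^2(\mu)}\ge\lambda_{\mathrm C}\|f\|_{L^2(\mu)}^2$ for all $f\in\mathscr D(\mathcal L)$ with $\mu(f)=0$. Let $p>0$ and assume $\mu(|\cdot|^q)<\infty$ for some $q>p$. Define $\gamma_2:=\max\{\frac12,1-\frac pd\}\in(0,1)$. Then there exists $C>0$ such that for all $T\ge2$, $$\mathbb{E}^\mu\big[\mathcal{T}_p(\mu_T,\mu)\big]\le C\,T^{-\left(1-\max\{\gamma_2,\frac pq\}\right)}\Big(\mathbf 1_{\{\gamma_2q=p\}}\log T+\mathbf 1_{\{\gamma_2q\ne p\}}\Big)\Big(\mathbf 1_{\{p=\frac12d\}}\log T+\mathbf 1_{\{p\ne\frac12 d\}}\Big).$$ In particular, if $q>2p$, then $\mathbb{E}^\mu[\mathcal{T}_p(\mu_T,\mu)]\le CT^{-1/2}$ if $p>\frac d2$, $\le CT^{-1/2}\log T$ if $p=\frac d2$, and $\le CT^{-p/d}$ if $p<\frac d2$.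
   Context: For probability measures $\nu_0,\nu_1$ on $\mathbb{R}^d$ and $p\in(0,\infty)$, $\mathcal{T}_p(\nu_0,\nu_1):=\inf_{\pi}\int|x-y|^p\,\pi(\mathrm dx,\mathrm dy)$, the infimum over all couplings $\pi$ of $\nu_0,\nu_1$. The empirical measure is $\mu_T:=\frac1T\int_0^T\delta_{X_t}\,\mathrm dt$. $\mathbb{E}^\mu$ denotes expectation when $X_0\sim\mu$. $\mu(f)=\int f\,\mathrm d\mu$, $\mu(|\cdot|^q)=\int|x|^q\,\mu(\mathrm dx)$, and $\langle\cdot,\cdot\rangle_{L^2(\mu)}$ is the inner product of $L^2(\mu)$. $\mathbf 1_{\{\cdot\}}$ equals $1$ if the stated condition holds and $0$ otherwise. *)

theory Defs
  imports "HOL-Probability.Probability"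
begin

definition couplings :: "'a::euclidean_space measure \<Rightarrow> 'a measure \<Rightarrow> ('a \<times> 'a) measure set" where
  "couplings \<nu>0 \<nu>1 = {\<pi>. sets \<pi> = sets (borel \<Otimes>\<^sub>M borel) \<and>
      distr \<pi> borel fst = \<nu>0 \<and> distr \<pi> borel snd = \<nu>1}"

definition transport_cost :: "real \<Rightarrow> 'a::euclidean_space measure \<Rightarrow> 'a measure \<Rightarrow> ennreal" where
  "transport_cost p \<nu>0 \<nu>1 =
     (INF \<pi>\<in>couplings \<nu>0 \<nu>1. \<integral>\<^sup>+ z. ennreal (norm (fst z - snd z) powr p) \<partial>\<pi>)"

text \<open>Empirical measure mu_T = (1/T) int_0^T delta_{X_t} dt: push-forward of the
  normalised Lebesgue measure on [0,T] along the path t -> X t omega.\<close>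
definition empirical_measure :: "(real \<Rightarrow> 'b \<Rightarrow> 'a::euclidean_space) \<Rightarrow> real \<Rightarrow> 'b \<Rightarrow> 'a measure" where
  "empirical_measure X T \<omega> =
     distr (uniform_measure (restrict_space lborel {0..}) {0..T}) borel (\<lambda>t. X t \<omega>)"

definition semigroup_op :: "(real \<Rightarrow> 'a \<Rightarrow> 'a measure) \<Rightarrow> real \<Rightarrow> ('a \<Rightarrow> real) \<Rightarrow> 'a \<Rightarrow> real" where
  "semigroup_op K t f x = (\<integral>y. f y \<partial>(K t x))"

definition L2_fun :: "'a measure \<Rightarrow> ('a \<Rightarrow> real) \<Rightarrow> bool" where
  "L2_fun \<mu> f \<longleftrightarrow> f \<in> borel_measurable \<mu> \<and> integrable \<mu> (\<lambda>x. (f x)\<^sup>2)"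

definition generator_rel :: "(real \<Rightarrow> 'a \<Rightarrow> 'a measure) \<Rightarrow> 'a measure \<Rightarrow> ('a \<Rightarrow> real) \<Rightarrow> ('a \<Rightarrow> real) \<Rightarrow> bool" where
  "generator_rel K \<mu> f g \<longleftrightarrow> L2_fun \<mu> f \<and> L2_fun \<mu> g \<and>
     ((\<lambda>t. \<integral>\<^sup>+ x. ennreal (((semigroup_op K t f x - f x) / t - g x)\<^sup>2) \<partial>\<mu>) \<longlongrightarrow> 0) (at_right 0)"

definition markov_process :: "'b measure \<Rightarrow> (real \<Rightarrow> 'b \<Rightarrow> 'a::euclidean_space) \<Rightarrow> (real \<Rightarrow> 'a \<Rightarrow> 'a measure) \<Rightarrow> bool" where
  "markov_process M X K \<longleftrightarrow>
     (\<lambda>(t, \<omega>). X t \<omega>) \<in> (restrict_space lborel {0..} \<Otimes>\<^sub>M M) \<rightarrow>\<^sub>M borel \<and>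
     (\<forall>t\<ge>0. K t \<in> borel \<rightarrow>\<^sub>M prob_algebra borel) \<and>
     (\<forall>s\<ge>0. \<forall>t\<ge>0.
        \<forall>A\<in>sigma_sets (space M) {X r -` B \<inter> space M | r B. 0 \<le> r \<and> r \<le> s \<and> B \<in> sets borel}.
        \<forall>B\<in>sets borel.
          measure M (A \<inter> (X (s + t) -` B \<inter> space M)) =
          (\<integral>\<omega>. indicator A \<omega> * measure (K t (X s \<omega>)) B \<partial>M))"

definition invariant_measure :: "(real \<Rightarrow> 'a::euclidean_space \<Rightarrow> 'a measure) \<Rightarrow> 'a measure \<Rightarrow> bool" where
  "invariant_measure K \<mu> \<longleftrightarrow> sets \<mu> = sets borel \<and> prob_space \<mu> \<and>
     (\<forall>t\<ge>0. \<forall>B\<in>sets borel. (\<integral>\<^sup>+ x. emeasure (K t x) B \<partial>\<mu>) = emeasure \<mu> B)"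

definition ergodic :: "(real \<Rightarrow> 'a::euclidean_space \<Rightarrow> 'a measure) \<Rightarrow> 'a measure \<Rightarrow> bool" where
  "ergodic K \<mu> \<longleftrightarrow> (\<forall>A\<in>sets borel.
     (\<forall>t\<ge>0. AE x in \<mu>. measure (K t x) A = indicator A x) \<longrightarrow>
     measure \<mu> A = 0 \<or> measure \<mu> A = 1)"

definition coercive :: "(real \<Rightarrow> 'a \<Rightarrow> 'a measure) \<Rightarrow> 'a measure \<Rightarrow> real \<Rightarrow> bool" where
  "coercive K \<mu> c \<longleftrightarrow> (\<forall>f g. generator_rel K \<mu> f g \<and> (\<integral>x. f x \<partial>\<mu>) = 0 \<longrightarrow>
     - (\<integral>x. g x * f x \<partial>\<mu>) \<ge> c * (\<integral>x. (f x)\<^sup>2 \<partial>\<mu>))"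

end

theory Submission
  imports Defs
begin

text \<open>
  Transport side: partition space into the dyadic rings \<open>2\<^sup>n\<^sup>-\<^sup>1 \<le> |x| < 2\<^sup>n\<close> and each ring into
  \<open>2\<^sup>d\<^sup>i\<close> cubes. Two measures are coupled from the finest level upwards: inside every cell as much mass
  as possible is matched, and the excess is passed on to the coarser partition. The mass that has to be
  matched at a given level is the total discrepancy of the cells one level finer, so the cost is at most
  a weighted sum of the discrepancies \<open>|\<nu>(Q) - \<mu>(Q)|\<close>. A finite depth of order \<open>log T\<close> suffices.

  Probability side: for bounded \<open>f\<close> with \<open>\<mu>(f) = 0\<close> the function \<open>G\<^sub>t = \<integral>\<^sub>0\<^sup>t P\<^sub>r f dr\<close> lies in the domain of
  the generator and \<open>L G\<^sub>t = P\<^sub>t f - f\<close>, so coercivity gives \<open>\<parallel>G\<^sub>t\<parallel> \<le> 2 \<parallel>f\<parallel> / \<lambda>\<close> and therefore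
  \<open>Var (\<integral>\<^sub>0\<^sup>T f(X\<^sub>r) dr) \<le> 4 T \<parallel>f\<parallel>\<^sup>2 / \<lambda>\<close>. With \<open>f = 1\<^sub>Q - \<mu>(Q)\<close> this yields
  \<open>E |\<mu>\<^sub>T(Q) - \<mu>(Q)| \<le> min (2 \<mu>(Q), 2 (\<mu>(Q) / (\<lambda> T))\<^sup>1\<^sup>/\<^sup>2)\<close>. Summing over cubes by Cauchy-Schwarz and over
  rings by the moment bound \<open>\<mu>(ring n) \<lesssim> 2\<^sup>-\<^sup>q\<^sup>n\<close> gives the rate.
\<close>

section \<open>Multi-scale couplings\<close>

text \<open>The definition of the process gives no measurability or continuity of \<open>K t\<close>
  in \<open>t\<close>. Every time integral is therefore taken along the paths, where joint
  measurability of \<open>X\<close> suffices, and the Markov property at single times carries the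
  result back to \<open>K\<close>. Even the domain membership of \<open>G_t\<close>, usually a
  consequence of strong continuity, is obtained so: stationarity allows an increment at time
  \<open>0\<close> to be averaged over its starting time, and then continuity of translations in
  mean square is enough. The difference quotient of the generator is controlled by testing its error
  against itself. On the transport side the depth is cut off: mass still unmatched at depth
  \<open>L\<close> is charged by the diameter factor \<open>2^(-p L)\<close> times a moment, which
  for \<open>L\<close> near \<open>log T / p\<close> has order \<open>1 / T\<close>, smaller than
  every rate claimed. The price is that the number of levels is visible when
  \<open>p = d / 2\<close>, where all levels weigh the same; this is the second logarithm. The first
  one counts rings, in the balanced case \<open>\<gamma>2 q = p\<close>.\<close>

lemma nn_integral_by_cells:
  fixes k :: "'a \<Rightarrow> 'k::countable"
  assumes [measurable]: "k \<in> N \<rightarrow>\<^sub>M count_space UNIV" "g \<in> borel_measurable N"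
  shows "(\<integral>\<^sup>+x. \<phi> (k x) * g x \<partial>N) =
    (\<integral>\<^sup>+j. \<phi> j * (\<integral>\<^sup>+x. g x * indicator (k -` {j}) x \<partial>N) \<partial>count_space UNIV)"
proof -
  have [measurable]: "(\<lambda>x. indicator (k -` {j}) x :: ennreal) \<in> borel_measurable N" for j
  proof -
    have "(\<lambda>x. indicator {j} (k x) :: ennreal) \<in> borel_measurable N"
      by measurable
    then show ?thesis by (simp add: indicator_def vimage_def)
  qed
  have *: "\<phi> (k x) * g x = (\<integral>\<^sup>+j. \<phi> j * (g x * indicator (k -` {j}) x) \<partial>count_space UNIV)" for x
  proof -
    have "(\<integral>\<^sup>+j. \<phi> j * (g x * indicator (k -` {j}) x) \<partial>count_space UNIV)
        = (\<integral>\<^sup>+j. (\<phi> j * g x) * indicator {k x} j \<partial>count_space UNIV)"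
      by (intro nn_integral_cong) (auto simp: indicator_def)
    also have "\<dots> = \<phi> (k x) * g x"
      by (subst nn_integral_indicator_singleton) auto
    finally show ?thesis ..
  qed
  have "(\<integral>\<^sup>+x. \<phi> (k x) * g x \<partial>N) =
      (\<integral>\<^sup>+j. (\<integral>\<^sup>+x. \<phi> j * (g x * indicator (k -` {j}) x) \<partial>N) \<partial>count_space UNIV)"
    unfolding * by (intro nn_integral_count_space_nn_integral) auto
  also have "\<dots> = (\<integral>\<^sup>+j. \<phi> j * (\<integral>\<^sup>+x. g x * indicator (k -` {j}) x \<partial>N) \<partial>count_space UNIV)"
    by (intro nn_integral_cong nn_integral_cmult) auto
  finally show ?thesis .
qed

text \<open>Matching within the cells of \<open>k\<close>: relative to \<open>\<nu> \<Otimes> \<mu>\<close> the matched part has density \<open>cell_kernel\<close>, and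
  \<open>cell_excess\<close> is the fraction of \<open>\<nu>\<close> left over. Division by zero occurs only on cells that are null
  for both measures.\<close>
definition cell_weight :: "'a measure \<Rightarrow> 'a measure \<Rightarrow> ('a \<Rightarrow> 'k) \<Rightarrow> 'k \<Rightarrow> real" where
  "cell_weight \<nu> \<mu> k j = 1 / max (measure \<nu> (k -` {j})) (measure \<mu> (k -` {j}))"

definition cell_kernel :: "'a measure \<Rightarrow> 'a measure \<Rightarrow> ('a \<Rightarrow> 'k) \<Rightarrow> 'a \<times> 'a \<Rightarrow> ennreal" where
  "cell_kernel \<nu> \<mu> k z = (if k (fst z) = k (snd z) then ennreal (cell_weight \<nu> \<mu> k (k (fst z))) else 0)"

definition cell_excess :: "'a measure \<Rightarrow> 'a measure \<Rightarrow> ('a \<Rightarrow> 'k) \<Rightarrow> 'k \<Rightarrow> real" where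
  "cell_excess \<nu> \<mu> k j = 1 - cell_weight \<nu> \<mu> k j * measure \<mu> (k -` {j})"

lemma cell_weight_commute: "cell_weight \<nu> \<mu> k j = cell_weight \<mu> \<nu> k j"
  by (simp add: cell_weight_def max.commute)

lemma cell_weight_nonneg [simp]: "0 \<le> cell_weight \<nu> \<mu> k j"
  by (auto simp: cell_weight_def le_max_iff_disj)

lemma cell_kernel_commute: "cell_kernel \<nu> \<mu> k (x, y) = cell_kernel \<mu> \<nu> k (y, x)"
  by (auto simp: cell_kernel_def cell_weight_commute)

lemma cell_excess_nonneg [simp]: "0 \<le> cell_excess \<nu> \<mu> k j"
proof -
  let ?a = "measure \<nu> (k -` {j})" and ?b = "measure \<mu> (k -` {j})"
  have "?b \<le> max ?a ?b" "0 \<le> ?b" "0 \<le> max ?a ?b" by (auto simp: le_max_iff_disj)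
  then have "?b / max ?a ?b \<le> 1"
    by (metis divide_le_eq_1 order_le_less)
  then show ?thesis by (simp add: cell_excess_def cell_weight_def)
qed

text \<open>Matching uses up the smaller of the two cell masses, so each side keeps the positive
  part of its surplus. The two surpluses of a cell add up to the absolute discrepancy, which is how
  the absolute values in the final bound arise.\<close>

lemma cell_excess_mult: "cell_excess \<nu> \<mu> k j * measure \<nu> (k -` {j}) =
    max 0 (measure \<nu> (k -` {j}) - measure \<mu> (k -` {j}))"
proof -
  have "(1 - 1 / max a b * b) * a = max 0 (a - b)" if "0 \<le> a" "0 \<le> b" for a b :: real
    using that by (cases "a = 0"; cases "b = 0"; cases "a \<le> b") (auto simp: max_def field_simps)
  then show ?thesis
    unfolding cell_excess_def cell_weight_def by simp
qed

lemma cell_kernel_measurable [measurable]: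
  fixes k :: "'a::euclidean_space \<Rightarrow> 'k::countable"
  assumes [measurable]: "k \<in> borel \<rightarrow>\<^sub>M count_space UNIV"
  shows "cell_kernel \<nu> \<mu> k \<in> borel_measurable (borel \<Otimes>\<^sub>M borel)"
proof -
  have "(\<lambda>z. (\<lambda>j z. if j = k (snd z) then ennreal (cell_weight \<nu> \<mu> k j) else 0) (k (fst z)) z)
      \<in> borel_measurable (borel \<Otimes>\<^sub>M (borel :: 'a measure))"
    by (rule measurable_compose_countable[where g="\<lambda>z. k (fst z)"]) measurable
  then show ?thesis
    unfolding cell_kernel_def[abs_def] by simp
qed

text \<open>Finite measures rather than probabilities, because the recursion over the levels is
  applied to the excess measures.\<close>

locale cell_pair =
  fixes \<nu> \<mu> :: "'a::euclidean_space measure" and k :: "'a \<Rightarrow> 'k::countable"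
  assumes finite_nu: "finite_measure \<nu>" and finite_mu: "finite_measure \<mu>"
    and sets_nu [measurable_cong]: "sets \<nu> = sets borel"
    and sets_mu [measurable_cong]: "sets \<mu> = sets borel"
    and k_measurable [measurable]: "k \<in> borel \<rightarrow>\<^sub>M count_space UNIV"
begin

interpretation nu: finite_measure \<nu> by (rule finite_nu)
interpretation mu: finite_measure \<mu> by (rule finite_mu)

lemma cell_sets [measurable]: "k -` {j} \<in> sets borel"
  using measurable_sets[OF k_measurable, of "{j}"] by simp

lemma swap: "cell_pair \<mu> \<nu> k"
  using finite_nu finite_mu sets_nu sets_mu k_measurable by (intro cell_pair.intro)

text \<open>Holds at every point: on a cell that is null for both measures the weight is
  \<open>0\<close> by the division convention, so the kernel contributes nothing and the excess is
  the full \<open>1\<close>.\<close>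

lemma kernel_marginal:
  "(\<integral>\<^sup>+y. cell_kernel \<nu> \<mu> k (x, y) \<partial>\<mu>) + ennreal (cell_excess \<nu> \<mu> k (k x)) = 1"
proof -
  have "(\<integral>\<^sup>+y. cell_kernel \<nu> \<mu> k (x, y) \<partial>\<mu>)
      = (\<integral>\<^sup>+y. ennreal (cell_weight \<nu> \<mu> k (k x)) * indicator (k -` {k x}) y \<partial>\<mu>)"
    by (intro nn_integral_cong) (auto simp: cell_kernel_def indicator_def)
  also have "\<dots> = ennreal (cell_weight \<nu> \<mu> k (k x)) * emeasure \<mu> (k -` {k x})"
    by (intro nn_integral_cmult_indicator) (simp add: sets_mu)
  also have "\<dots> = ennreal (cell_weight \<nu> \<mu> k (k x) * measure \<mu> (k -` {k x}))"
    by (simp add: mu.emeasure_eq_measure ennreal_mult)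
  finally show ?thesis
    using ennreal_plus[OF _ cell_excess_nonneg, of "cell_weight \<nu> \<mu> k (k x) * measure \<mu> (k -` {k x})" \<nu> \<mu> k "k x"]
    by (simp add: cell_excess_def del: ennreal_plus)
qed

lemma excess_integral:
  "(\<integral>\<^sup>+x. \<phi> (k x) * ennreal (cell_excess \<nu> \<mu> k (k x)) \<partial>\<nu>) =
   (\<integral>\<^sup>+j. \<phi> j * ennreal (max 0 (measure \<nu> (k -` {j}) - measure \<mu> (k -` {j}))) \<partial>count_space UNIV)"
proof -
  have "(\<integral>\<^sup>+x. (\<phi> (k x) * ennreal (cell_excess \<nu> \<mu> k (k x))) * 1 \<partial>\<nu>) =
    (\<integral>\<^sup>+j. (\<phi> j * ennreal (cell_excess \<nu> \<mu> k j)) * (\<integral>\<^sup>+x. 1 * indicator (k -` {j}) x \<partial>\<nu>) \<partial>count_space UNIV)"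
    by (rule nn_integral_by_cells) measurable
  also have "\<dots> = (\<integral>\<^sup>+j. \<phi> j * ennreal (max 0 (measure \<nu> (k -` {j}) - measure \<mu> (k -` {j}))) \<partial>count_space UNIV)"
    by (intro nn_integral_cong)
      (simp add: nu.emeasure_eq_measure sets_nu mult.assoc cell_excess_mult flip: ennreal_mult)
  finally show ?thesis by simp
qed

end

lemma nn_integral_two_densities:
  fixes \<nu> \<mu> :: "'a::euclidean_space measure"
  assumes "finite_measure \<mu>" and [measurable_cong]: "sets \<nu> = sets borel" "sets \<mu> = sets borel"
    and [measurable]: "u \<in> borel_measurable borel" "v \<in> borel_measurable borel"
      "F \<in> borel_measurable (borel \<Otimes>\<^sub>M borel)"
  shows "(\<integral>\<^sup>+x. \<integral>\<^sup>+y. F (x, y) \<partial>density \<mu> v \<partial>density \<nu> u) = (\<integral>\<^sup>+x. \<integral>\<^sup>+y. u x * v y * F (x, y) \<partial>\<mu> \<partial>\<nu>)"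
proof -
  interpret mu: finite_measure \<mu> by fact
  have "(\<integral>\<^sup>+x. \<integral>\<^sup>+y. F (x, y) \<partial>density \<mu> v \<partial>density \<nu> u)
      = (\<integral>\<^sup>+x. (\<integral>\<^sup>+y. v y * F (x, y) \<partial>\<mu>) \<partial>density \<nu> u)"
    by (intro nn_integral_cong nn_integral_density) measurable
  also have "\<dots> = (\<integral>\<^sup>+x. u x * (\<integral>\<^sup>+y. v y * F (x, y) \<partial>\<mu>) \<partial>\<nu>)"
    by (intro nn_integral_density) measurable
  also have "\<dots> = (\<integral>\<^sup>+x. \<integral>\<^sup>+y. u x * v y * F (x, y) \<partial>\<mu> \<partial>\<nu>)"
    by (intro nn_integral_cong) (subst nn_integral_cmult[symmetric], auto simp: mult.assoc)
  finally show ?thesis .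
qed


context cell_pair
begin

lemma mass_split:
  assumes [measurable]: "Q \<in> sets borel"
  shows "emeasure \<nu> Q = (\<integral>\<^sup>+x. \<integral>\<^sup>+y. cell_kernel \<nu> \<mu> k (x, y) * indicator Q x \<partial>\<mu> \<partial>\<nu>)
    + emeasure (density \<nu> (\<lambda>x. ennreal (cell_excess \<nu> \<mu> k (k x)))) Q"
proof -
  interpret mu: finite_measure \<mu> by (rule finite_mu)
  have "emeasure \<nu> Q = (\<integral>\<^sup>+x. indicator Q x \<partial>\<nu>)" by (simp add: sets_nu)
  also have "\<dots> = (\<integral>\<^sup>+x. (\<integral>\<^sup>+y. cell_kernel \<nu> \<mu> k (x, y) * indicator Q x \<partial>\<mu>)
        + ennreal (cell_excess \<nu> \<mu> k (k x)) * indicator Q x \<partial>\<nu>)"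
  proof (intro nn_integral_cong)
    fix x
    have "(indicator Q x :: ennreal) = ((\<integral>\<^sup>+y. cell_kernel \<nu> \<mu> k (x, y) \<partial>\<mu>)
        + ennreal (cell_excess \<nu> \<mu> k (k x))) * indicator Q x"
      by (simp add: kernel_marginal)
    then show "(indicator Q x :: ennreal) = (\<integral>\<^sup>+y. cell_kernel \<nu> \<mu> k (x, y) * indicator Q x \<partial>\<mu>)
        + ennreal (cell_excess \<nu> \<mu> k (k x)) * indicator Q x"
      by (simp add: nn_integral_multc distrib_right)
  qed
  finally show ?thesis
    by (subst (asm) nn_integral_add) (auto simp: emeasure_density sets_nu)
qed

text \<open>This is why the coarser levels only see the original discrepancies.\<close>
lemma excess_balance:
  assumes Q [measurable]: "Q \<in> sets borel" and sat: "\<And>x y. k x = k y \<Longrightarrow> x \<in> Q \<longleftrightarrow> y \<in> Q"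
  defines "\<nu>' \<equiv> density \<nu> (\<lambda>x. ennreal (cell_excess \<nu> \<mu> k (k x)))"
    and "\<mu>' \<equiv> density \<mu> (\<lambda>y. ennreal (cell_excess \<mu> \<nu> k (k y)))"
  shows "\<exists>H. emeasure \<nu> Q = H + emeasure \<nu>' Q \<and> emeasure \<mu> Q = H + emeasure \<mu>' Q"
proof -
  interpret nu: finite_measure \<nu> by (rule finite_nu)
  interpret mu: finite_measure \<mu> by (rule finite_mu)
  interpret P: pair_sigma_finite \<nu> \<mu> ..
  \<comment> \<open>The kernel vanishes unless both points lie in the same cell, and
    \<open>Q\<close> is a union of cells, so membership in \<open>Q\<close> may be tested on either
    point. The matched mass \<open>H\<close> is therefore the same seen from both sides.\<close>
  have "(\<integral>\<^sup>+y. \<integral>\<^sup>+x. cell_kernel \<mu> \<nu> k (y, x) * indicator Q y \<partial>\<nu> \<partial>\<mu>)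
      = (\<integral>\<^sup>+y. \<integral>\<^sup>+x. cell_kernel \<nu> \<mu> k (x, y) * indicator Q x \<partial>\<nu> \<partial>\<mu>)"
  proof (intro nn_integral_cong)
    fix x y
    show "cell_kernel \<mu> \<nu> k (y, x) * indicator Q y = cell_kernel \<nu> \<mu> k (x, y) * indicator Q x"
      using sat[of x y] by (auto simp: cell_kernel_def cell_weight_commute indicator_def)
  qed
  also have "\<dots> = (\<integral>\<^sup>+x. \<integral>\<^sup>+y. cell_kernel \<nu> \<mu> k (x, y) * indicator Q x \<partial>\<mu> \<partial>\<nu>)"
    using P.Fubini[of "\<lambda>z. cell_kernel \<nu> \<mu> k z * indicator Q (fst z)"] by simp
  finally show ?thesis
    using mass_split[OF Q] cell_pair.mass_split[OF swap Q] unfolding \<nu>'_def \<mu>'_def by auto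
qed

text \<open>The factor \<open>u x * v y\<close> rewrites \<open>h\<close> relative to the original
  measures. Its marginal is then exactly \<open>u x\<close>, the fraction that the cell kernel
  leaves open. Where \<open>u x = 0\<close> the added term vanishes, so an almost-sure statement for
  \<open>density \<nu> u\<close> is enough.\<close>

lemma refined_marginal:
  assumes [measurable]: "v \<in> borel_measurable borel" "h \<in> borel_measurable (borel \<Otimes>\<^sub>M borel)"
  defines "u \<equiv> \<lambda>x. ennreal (cell_excess \<nu> \<mu> k (k x))"
  assumes "AE x in density \<nu> u. (\<integral>\<^sup>+y. h (x, y) \<partial>density \<mu> v) = 1"
  shows "AE x in \<nu>. (\<integral>\<^sup>+y. cell_kernel \<nu> \<mu> k (x, y) + u x * v y * h (x, y) \<partial>\<mu>) = 1"
proof -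
  have [measurable]: "u \<in> borel_measurable borel" unfolding u_def by measurable
  have "AE x in \<nu>. 0 < u x \<longrightarrow> (\<integral>\<^sup>+y. h (x, y) \<partial>density \<mu> v) = 1"
    using assms(4) by (subst (asm) AE_density) auto
  then show ?thesis
  proof (rule AE_mp, intro AE_I2 impI)
    fix x assume x: "0 < u x \<longrightarrow> (\<integral>\<^sup>+y. h (x, y) \<partial>density \<mu> v) = 1"
    have "(\<integral>\<^sup>+y. cell_kernel \<nu> \<mu> k (x, y) + u x * v y * h (x, y) \<partial>\<mu>)
        = (\<integral>\<^sup>+y. cell_kernel \<nu> \<mu> k (x, y) \<partial>\<mu>) + (\<integral>\<^sup>+y. u x * (v y * h (x, y)) \<partial>\<mu>)"
      by (simp add: nn_integral_add mult.assoc)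
    also have "(\<integral>\<^sup>+y. u x * (v y * h (x, y)) \<partial>\<mu>) = u x * (\<integral>\<^sup>+y. h (x, y) \<partial>density \<mu> v)"
      by (simp add: nn_integral_density nn_integral_cmult)
    also have "\<dots> = u x"
      using x by (cases "u x = 0") (auto simp: zero_less_iff_neq_zero)
    finally show "(\<integral>\<^sup>+y. cell_kernel \<nu> \<mu> k (x, y) + u x * v y * h (x, y) \<partial>\<mu>) = 1"
      using kernel_marginal[of x] by (simp add: u_def)
  qed
qed

lemma finite_excess: "finite_measure (density \<nu> (\<lambda>x. ennreal (cell_excess \<nu> \<mu> k (k x))))"
proof
  interpret nu: finite_measure \<nu> by (rule finite_nu)
  have "emeasure (density \<nu> (\<lambda>x. ennreal (cell_excess \<nu> \<mu> k (k x)))) UNIV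
      \<le> emeasure \<nu> UNIV"
    using excess_balance[of UNIV] by auto
  also have "\<dots> < \<infinity>"
    by (simp add: nu.emeasure_eq_measure)
  finally show "emeasure (density \<nu> (\<lambda>x. ennreal (cell_excess \<nu> \<mu> k (k x))))
      (space (density \<nu> (\<lambda>x. ennreal (cell_excess \<nu> \<mu> k (k x))))) \<noteq> \<infinity>"
    using sets_eq_imp_space_eq[OF sets_nu] by simp
qed

lemma measure_diff_excess:
  assumes "Q \<in> sets borel" and "\<And>x y. k x = k y \<Longrightarrow> x \<in> Q \<longleftrightarrow> y \<in> Q"
  defines "\<nu>' \<equiv> density \<nu> (\<lambda>x. ennreal (cell_excess \<nu> \<mu> k (k x)))"
    and "\<mu>' \<equiv> density \<mu> (\<lambda>y. ennreal (cell_excess \<mu> \<nu> k (k y)))"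
  shows "measure \<nu>' Q - measure \<mu>' Q = measure \<nu> Q - measure \<mu> Q"
proof -
  interpret nu: finite_measure \<nu> by (rule finite_nu)
  interpret mu: finite_measure \<mu> by (rule finite_mu)
  interpret nu': finite_measure \<nu>' unfolding \<nu>'_def by (rule finite_excess)
  interpret mu': finite_measure \<mu>' unfolding \<mu>'_def by (rule cell_pair.finite_excess[OF swap])
  obtain H where H: "emeasure \<nu> Q = H + emeasure \<nu>' Q" "emeasure \<mu> Q = H + emeasure \<mu>' Q"
    using excess_balance[OF assms(1,2)] unfolding \<nu>'_def \<mu>'_def by blast
  have "H \<le> emeasure \<nu> Q" using H by simp
  also have "\<dots> < \<infinity>" by (simp add: nu.emeasure_eq_measure)
  finally obtain r where r: "H = ennreal r" "0 \<le> r" by (cases H) auto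
  have "measure \<nu> Q = r + measure \<nu>' Q" "measure \<mu> Q = r + measure \<mu>' Q"
    using H r by (simp_all add: nu.emeasure_eq_measure mu.emeasure_eq_measure
      nu'.emeasure_eq_measure mu'.emeasure_eq_measure flip: ennreal_plus)
  then show ?thesis by simp
qed


lemma kernel_le_1: "(\<integral>\<^sup>+y. cell_kernel \<nu> \<mu> k (x, y) \<partial>\<mu>) \<le> 1"
  unfolding kernel_marginal[of x, symmetric] by simp

text \<open>The kernel lives on pairs in a common cell, where \<open>c\<close> is bounded by
  \<open>W x + W y\<close>. Each summand depends on one point only and is integrated against one
  marginal of the kernel, which is at most \<open>1\<close>.\<close>

lemma kernel_cost:
  assumes c: "\<And>x y. k x = k y \<Longrightarrow> c (x, y) \<le> W x + W y"
    and [measurable]: "W \<in> borel_measurable borel"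
  shows "(\<integral>\<^sup>+x. \<integral>\<^sup>+y. c (x, y) * cell_kernel \<nu> \<mu> k (x, y) \<partial>\<mu> \<partial>\<nu>) \<le> (\<integral>\<^sup>+x. W x \<partial>\<nu>) + (\<integral>\<^sup>+y. W y \<partial>\<mu>)"
proof -
  interpret nu: finite_measure \<nu> by (rule finite_nu)
  interpret mu: finite_measure \<mu> by (rule finite_mu)
  interpret P: pair_sigma_finite \<nu> \<mu> ..
  have "(\<integral>\<^sup>+x. \<integral>\<^sup>+y. c (x, y) * cell_kernel \<nu> \<mu> k (x, y) \<partial>\<mu> \<partial>\<nu>)
      \<le> (\<integral>\<^sup>+x. \<integral>\<^sup>+y. (W x * cell_kernel \<nu> \<mu> k (x, y) + W y * cell_kernel \<nu> \<mu> k (x, y)) \<partial>\<mu> \<partial>\<nu>)"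
  proof (intro nn_integral_mono)
    fix x y
    show "c (x, y) * cell_kernel \<nu> \<mu> k (x, y) \<le> W x * cell_kernel \<nu> \<mu> k (x, y) + W y * cell_kernel \<nu> \<mu> k (x, y)"
      using c[of x y] mult_right_mono[of "c (x, y)" "W x + W y"]
      by (cases "k x = k y") (auto simp: cell_kernel_def distrib_right)
  qed
  also have "\<dots> = (\<integral>\<^sup>+x. W x * (\<integral>\<^sup>+y. cell_kernel \<nu> \<mu> k (x, y) \<partial>\<mu>)
      + (\<integral>\<^sup>+y. W y * cell_kernel \<nu> \<mu> k (x, y) \<partial>\<mu>) \<partial>\<nu>)"
    by (intro nn_integral_cong) (simp add: nn_integral_add nn_integral_cmult)
  also have "\<dots> = (\<integral>\<^sup>+x. W x * (\<integral>\<^sup>+y. cell_kernel \<nu> \<mu> k (x, y) \<partial>\<mu>) \<partial>\<nu>)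
      + (\<integral>\<^sup>+x. \<integral>\<^sup>+y. W y * cell_kernel \<nu> \<mu> k (x, y) \<partial>\<mu> \<partial>\<nu>)"
    by (rule nn_integral_add) measurable
  also have "(\<integral>\<^sup>+x. \<integral>\<^sup>+y. W y * cell_kernel \<nu> \<mu> k (x, y) \<partial>\<mu> \<partial>\<nu>)
      = (\<integral>\<^sup>+y. \<integral>\<^sup>+x. W y * cell_kernel \<nu> \<mu> k (x, y) \<partial>\<nu> \<partial>\<mu>)"
    using P.Fubini[of "\<lambda>z. W (snd z) * cell_kernel \<nu> \<mu> k z"] by simp
  also have "\<dots> = (\<integral>\<^sup>+y. W y * (\<integral>\<^sup>+x. cell_kernel \<mu> \<nu> k (y, x) \<partial>\<nu>) \<partial>\<mu>)"
    by (intro nn_integral_cong) (simp add: nn_integral_cmult cell_kernel_commute[of \<nu>])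
  also have "(\<integral>\<^sup>+x. W x * (\<integral>\<^sup>+y. cell_kernel \<nu> \<mu> k (x, y) \<partial>\<mu>) \<partial>\<nu>) + \<dots>
      \<le> (\<integral>\<^sup>+x. W x * 1 \<partial>\<nu>) + (\<integral>\<^sup>+y. W y * 1 \<partial>\<mu>)"
    by (intro add_mono nn_integral_mono mult_left_mono kernel_le_1 cell_pair.kernel_le_1[OF swap]) auto
  finally show ?thesis by simp
qed

end

text \<open>Induction from the finest level, with the measures generalised so that the hypothesis
  applies to the two excess measures. The index shift in \<open>c_le\<close> matters: a pair matched
  at level \<open>l\<close> is charged through its keys of level \<open>Suc l\<close>. Once level
  \<open>Suc L\<close> has done its matching, both the excess fraction and the charge
  \<open>w L\<close> are constant on the cells of \<open>k (Suc L)\<close>, so that the charge of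
  the excess is a weighted sum of discrepancies of these cells.\<close>

lemma multiscale_kernel:
  fixes k :: "nat \<Rightarrow> 'a::euclidean_space \<Rightarrow> 'k::countable" and w :: "nat \<Rightarrow> 'k \<Rightarrow> ennreal"
    and c :: "'a \<times> 'a \<Rightarrow> ennreal"
  assumes k_meas [measurable]: "\<And>l. k l \<in> borel \<rightarrow>\<^sub>M count_space UNIV"
    and refine: "\<And>l x y. k (Suc l) x = k (Suc l) y \<Longrightarrow> k l x = k l y"
    and trivial: "\<And>x y. k 0 x = k 0 y"
    and c_meas [measurable]: "c \<in> borel_measurable (borel \<Otimes>\<^sub>M borel)"
    and c_le: "\<And>l x y. k l x = k l y \<Longrightarrow> c (x, y) \<le> w l (k (Suc l) x) + w l (k (Suc l) y)"
    and "finite_measure \<nu>" "finite_measure \<mu>" "sets \<nu> = sets borel" "sets \<mu> = sets borel"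
    and "measure \<nu> UNIV = measure \<mu> UNIV"
  shows "\<exists>h\<in>borel_measurable (borel \<Otimes>\<^sub>M borel).
      (AE x in \<nu>. (\<integral>\<^sup>+y. h (x, y) \<partial>\<mu>) = 1) \<and> (AE y in \<mu>. (\<integral>\<^sup>+x. h (x, y) \<partial>\<nu>) = 1) \<and>
      (\<integral>\<^sup>+x. \<integral>\<^sup>+y. c (x, y) * h (x, y) \<partial>\<mu> \<partial>\<nu>)
        \<le> (\<integral>\<^sup>+x. w L (k (Suc L) x) \<partial>\<nu>) + (\<integral>\<^sup>+y. w L (k (Suc L) y) \<partial>\<mu>)
          + (\<Sum>i<L. \<integral>\<^sup>+j. w i j * ennreal \<bar>measure \<nu> (k (Suc i) -` {j}) - measure \<mu> (k (Suc i) -` {j})\<bar>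
              \<partial>count_space UNIV)"
  using assms(6-10)
proof (induction L arbitrary: \<nu> \<mu>)
  case 0
  interpret cell_pair \<nu> \<mu> "k 0" using 0 k_meas by (intro cell_pair.intro) auto
  interpret S: cell_pair \<mu> \<nu> "k 0" by (rule swap)
  interpret nu: finite_measure \<nu> by (rule finite_nu)
  interpret mu: finite_measure \<mu> by (rule finite_mu)
  have cell: "k 0 -` {k 0 x} = UNIV" for x using trivial by auto
  \<comment> \<open>Equal total masses make the single cell of level \<open>0\<close> match
    completely. If the masses vanish, the kernel is \<open>0\<close> and the marginal conditions
    hold because the whole space is null.\<close>
  have null: "AE x in N. P x" if "finite_measure N" "measure N UNIV = 0" "sets N = sets borel" for N :: "'a measure" and P
  proof -
    interpret N: finite_measure N by fact
    have "emeasure N (space N) = 0"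
      using that sets_eq_imp_space_eq[OF that(3)] by (simp add: N.emeasure_eq_measure)
    then show ?thesis by (rule emeasure_0_AE)
  qed
  have 1: "AE x in \<nu>. (\<integral>\<^sup>+y. cell_kernel \<nu> \<mu> (k 0) (x, y) \<partial>\<mu>) = 1"
  proof (cases "measure \<nu> UNIV = 0")
    case False
    then show ?thesis
      using kernel_marginal 0 by (simp add: cell_excess_def cell_weight_def cell)
  qed (use null[of \<nu>] 0 in auto)
  have 2: "AE y in \<mu>. (\<integral>\<^sup>+x. cell_kernel \<mu> \<nu> (k 0) (y, x) \<partial>\<nu>) = 1"
  proof (cases "measure \<mu> UNIV = 0")
    case False
    then show ?thesis
      using S.kernel_marginal 0 by (simp add: cell_excess_def cell_weight_def cell)
  qed (use null[of \<mu>] 0 in auto)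
  show ?case
    using 1 2 kernel_cost[of c "\<lambda>x. w 0 (k 1 x)"] c_le[of 0]
    by (intro bexI[of _ "cell_kernel \<nu> \<mu> (k 0)"]) (auto simp: cell_kernel_commute[of \<nu>])
next
  case (Suc L)
  let ?K = "k (Suc L)"
  interpret cell_pair \<nu> \<mu> ?K using Suc.prems k_meas by (intro cell_pair.intro) auto
  interpret S: cell_pair \<mu> \<nu> ?K by (rule swap)
  interpret nu: finite_measure \<nu> by (rule finite_nu)
  interpret mu: finite_measure \<mu> by (rule finite_mu)
  interpret P: pair_sigma_finite \<nu> \<mu> ..
  define u where "u x = ennreal (cell_excess \<nu> \<mu> ?K (?K x))" for x
  define v where "v y = ennreal (cell_excess \<mu> \<nu> ?K (?K y))" for y
  have [measurable]: "u \<in> borel_measurable borel" "v \<in> borel_measurable borel"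
    unfolding u_def v_def by measurable
  define \<nu>' where "\<nu>' = density \<nu> u"
  define \<mu>' where "\<mu>' = density \<mu> v"
  have [measurable_cong]: "sets \<nu>' = sets borel" "sets \<mu>' = sets borel"
    by (simp_all add: \<nu>'_def \<mu>'_def Suc.prems)
  have fin: "finite_measure \<nu>'" "finite_measure \<mu>'"
    using finite_excess S.finite_excess by (simp_all add: \<nu>'_def \<mu>'_def u_def[abs_def] v_def[abs_def])
  interpret nu': finite_measure \<nu>' by (rule fin)
  interpret mu': finite_measure \<mu>' by (rule fin)
  have diff: "measure \<nu>' Q - measure \<mu>' Q = measure \<nu> Q - measure \<mu> Q"
    if "Q \<in> sets borel" "\<And>x y. ?K x = ?K y \<Longrightarrow> x \<in> Q \<longleftrightarrow> y \<in> Q" for Q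
    using measure_diff_excess[OF that] by (simp add: \<nu>'_def \<mu>'_def u_def[abs_def] v_def[abs_def])
  have "measure \<nu>' UNIV = measure \<mu>' UNIV"
    using diff[of UNIV] Suc.prems by simp
  from Suc.IH[OF fin \<open>sets \<nu>' = sets borel\<close> \<open>sets \<mu>' = sets borel\<close> this]
  obtain h' where h'[measurable]: "h' \<in> borel_measurable (borel \<Otimes>\<^sub>M borel)"
    and m1: "AE x in \<nu>'. (\<integral>\<^sup>+y. h' (x, y) \<partial>\<mu>') = 1" and m2: "AE y in \<mu>'. (\<integral>\<^sup>+x. h' (x, y) \<partial>\<nu>') = 1"
    and cost': "(\<integral>\<^sup>+x. \<integral>\<^sup>+y. c (x, y) * h' (x, y) \<partial>\<mu>' \<partial>\<nu>')
        \<le> (\<integral>\<^sup>+x. w L (?K x) \<partial>\<nu>') + (\<integral>\<^sup>+y. w L (?K y) \<partial>\<mu>')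
          + (\<Sum>i<L. \<integral>\<^sup>+j. w i j * ennreal \<bar>measure \<nu>' (k (Suc i) -` {j}) - measure \<mu>' (k (Suc i) -` {j})\<bar>
              \<partial>count_space UNIV)" by blast
  define h where "h z = cell_kernel \<nu> \<mu> ?K z + u (fst z) * v (snd z) * h' z" for z
  have [measurable]: "h \<in> borel_measurable (borel \<Otimes>\<^sub>M borel)"
    unfolding h_def[abs_def] by measurable
  have 1: "AE x in \<nu>. (\<integral>\<^sup>+y. h (x, y) \<partial>\<mu>) = 1"
    using refined_marginal[of v h'] m1 unfolding \<nu>'_def \<mu>'_def h_def u_def[abs_def] by simp
  have 2: "AE y in \<mu>. (\<integral>\<^sup>+x. h (x, y) \<partial>\<nu>) = 1"
    using S.refined_marginal[of u "\<lambda>z. h' (snd z, fst z)"] m2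
    unfolding \<nu>'_def \<mu>'_def h_def v_def[abs_def] by (simp add: cell_kernel_commute[of \<nu>] mult.commute[of "u _"])
  let ?d = "\<lambda>i j. measure \<nu> (k (Suc i) -` {j}) - measure \<mu> (k (Suc i) -` {j})"
  have "(\<integral>\<^sup>+x. \<integral>\<^sup>+y. c (x, y) * h (x, y) \<partial>\<mu> \<partial>\<nu>)
      = (\<integral>\<^sup>+x. \<integral>\<^sup>+y. c (x, y) * cell_kernel \<nu> \<mu> ?K (x, y) \<partial>\<mu> \<partial>\<nu>)
        + (\<integral>\<^sup>+x. \<integral>\<^sup>+y. c (x, y) * (u x * v y * h' (x, y)) \<partial>\<mu> \<partial>\<nu>)"
    unfolding h_def by (simp add: nn_integral_add distrib_left)
  also have "(\<integral>\<^sup>+x. \<integral>\<^sup>+y. c (x, y) * (u x * v y * h' (x, y)) \<partial>\<mu> \<partial>\<nu>)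
      = (\<integral>\<^sup>+x. \<integral>\<^sup>+y. c (x, y) * h' (x, y) \<partial>\<mu>' \<partial>\<nu>')"
    unfolding \<nu>'_def \<mu>'_def
    by (subst nn_integral_two_densities[where F="\<lambda>z. c z * h' z"]) (auto simp: Suc.prems mult_ac)
  also have "\<dots> \<le> (\<Sum>i<Suc L. \<integral>\<^sup>+j. w i j * ennreal \<bar>?d i j\<bar> \<partial>count_space UNIV)"
  proof -
    \<comment> \<open>The charge of the excess measures becomes the new summand
      \<open>i = L\<close>: the positive parts of \<open>?d L j\<close> and \<open>- ?d L j\<close>
      add up to its absolute value.\<close>
    have "(\<integral>\<^sup>+x. w L (?K x) \<partial>\<nu>') + (\<integral>\<^sup>+y. w L (?K y) \<partial>\<mu>')
        = (\<integral>\<^sup>+j. w L j * ennreal (max 0 (?d L j)) \<partial>count_space UNIV)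
          + (\<integral>\<^sup>+j. w L j * ennreal (max 0 (- ?d L j)) \<partial>count_space UNIV)"
      using excess_integral[of "w L"] S.excess_integral[of "w L"]
      by (simp add: \<nu>'_def \<mu>'_def nn_integral_density u_def v_def mult.commute)
    also have "\<dots> = (\<integral>\<^sup>+j. w L j * ennreal \<bar>?d L j\<bar> \<partial>count_space UNIV)"
      by (subst nn_integral_add[symmetric])
        (auto intro!: nn_integral_cong simp: distrib_left[symmetric] max_def simp flip: ennreal_plus)
    finally have top: "(\<integral>\<^sup>+x. w L (?K x) \<partial>\<nu>') + (\<integral>\<^sup>+y. w L (?K y) \<partial>\<mu>') = \<dots>" .
    have coarse: "k i x = k i y" if "k (i + n) x = k (i + n) y" for i n x y
      using that by (induction n) (auto dest: refine)
    have "measure \<nu>' (k (Suc i) -` {j}) - measure \<mu>' (k (Suc i) -` {j}) = ?d i j" if "i < L" for i j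
    proof (rule diff)
      show "k (Suc i) -` {j} \<in> sets borel"
        using measurable_sets[OF k_meas, of "{j}"] by simp
      show "x \<in> k (Suc i) -` {j} \<longleftrightarrow> y \<in> k (Suc i) -` {j}" if "?K x = ?K y" for x y
        using coarse[of "Suc i" "L - i" x y] that \<open>i < L\<close> by simp
    qed
    then show ?thesis
      using cost' unfolding top by (simp add: add.commute)
  qed
  finally show ?case
    using 1 2 kernel_cost[of c "\<lambda>x. w (Suc L) (k (Suc (Suc L)) x)"] c_le[of "Suc L"]
    by (intro bexI[of _ h]) (auto intro: order_trans add_mono)
qed

text \<open>The infimum is tested with the measure of density \<open>h\<close> relative to the
  product; the two almost-sure conditions on \<open>h\<close> are exactly its marginal
  conditions.\<close>

lemma transport_cost_multiscale:
  fixes k :: "nat \<Rightarrow> 'a::euclidean_space \<Rightarrow> 'k::countable" and w :: "nat \<Rightarrow> 'k \<Rightarrow> ennreal"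
  assumes k_meas: "\<And>l. k l \<in> borel \<rightarrow>\<^sub>M count_space UNIV"
    and refine: "\<And>l x y. k (Suc l) x = k (Suc l) y \<Longrightarrow> k l x = k l y"
    and trivial: "\<And>x y. k 0 x = k 0 y"
    and c_le: "\<And>l x y. k l x = k l y \<Longrightarrow>
      ennreal (norm (x - y) powr p) \<le> w l (k (Suc l) x) + w l (k (Suc l) y)"
    and "prob_space \<nu>" "prob_space \<mu>" and sets [measurable_cong]: "sets \<nu> = sets borel" "sets \<mu> = sets borel"
  shows "transport_cost p \<nu> \<mu>
        \<le> (\<integral>\<^sup>+x. w L (k (Suc L) x) \<partial>\<nu>) + (\<integral>\<^sup>+y. w L (k (Suc L) y) \<partial>\<mu>)
          + (\<Sum>i<L. \<integral>\<^sup>+j. w i j * ennreal \<bar>measure \<nu> (k (Suc i) -` {j}) - measure \<mu> (k (Suc i) -` {j})\<bar>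
              \<partial>count_space UNIV)" (is "_ \<le> ?R")
proof -
  interpret nu: prob_space \<nu> by fact
  interpret mu: prob_space \<mu> by fact
  interpret P: pair_sigma_finite \<nu> \<mu> ..
  let ?c = "\<lambda>z::'a \<times> 'a. ennreal (norm (fst z - snd z) powr p)"
  have UNIV: "measure \<nu> UNIV = measure \<mu> UNIV"
    using nu.prob_space mu.prob_space sets_eq_imp_space_eq[OF sets(1)] sets_eq_imp_space_eq[OF sets(2)] by simp
  have "?c \<in> borel_measurable (borel \<Otimes>\<^sub>M borel)" by measurable
  moreover have "?c (x, y) \<le> w l (k (Suc l) x) + w l (k (Suc l) y)" if "k l x = k l y" for l x y
    using c_le[OF that] by simp
  ultimately obtain h where [measurable]: "h \<in> borel_measurable (borel \<Otimes>\<^sub>M borel)"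
    and m1: "AE x in \<nu>. (\<integral>\<^sup>+y. h (x, y) \<partial>\<mu>) = 1" and m2: "AE y in \<mu>. (\<integral>\<^sup>+x. h (x, y) \<partial>\<nu>) = 1"
    and cost: "(\<integral>\<^sup>+x. \<integral>\<^sup>+y. ?c (x, y) * h (x, y) \<partial>\<mu> \<partial>\<nu>) \<le> ?R" 
    using multiscale_kernel[where k=k and w=w and c="?c" and L=L, OF k_meas refine trivial _ _
      nu.finite_measure_axioms mu.finite_measure_axioms sets UNIV] by auto
  define \<pi> where "\<pi> = density (\<nu> \<Otimes>\<^sub>M \<mu>) h"
  have sets_pi [measurable_cong]: "sets \<pi> = sets (borel \<Otimes>\<^sub>M borel)"
    unfolding \<pi>_def sets_density by (rule sets_pair_measure_cong[OF sets])
  have pi_integral: "(\<integral>\<^sup>+z. g z \<partial>\<pi>) = (\<integral>\<^sup>+z. h z * g z \<partial>(\<nu> \<Otimes>\<^sub>M \<mu>))"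
    if "g \<in> borel_measurable (borel \<Otimes>\<^sub>M borel)" for g
    unfolding \<pi>_def using that by (intro nn_integral_density) measurable
  have "distr \<pi> borel fst = \<nu>"
  proof (rule measure_eqI)
    fix A assume "A \<in> sets (distr \<pi> borel fst)"
    then have [measurable]: "A \<in> sets borel" by simp
    have "emeasure (distr \<pi> borel fst) A = (\<integral>\<^sup>+z. indicator A (fst z) \<partial>\<pi>)"
      using nn_integral_distr[of fst \<pi> borel "indicator A"] by simp
    also have "\<dots> = (\<integral>\<^sup>+x. \<integral>\<^sup>+y. h (x, y) * indicator A x \<partial>\<mu> \<partial>\<nu>)"
      using mu.nn_integral_fst[of "\<lambda>z. h z * indicator A (fst z)" \<nu>] by (simp add: pi_integral)
    also have "\<dots> = (\<integral>\<^sup>+x. indicator A x \<partial>\<nu>)"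
      by (rule nn_integral_cong_AE, rule AE_mp[OF m1]) (auto simp: nn_integral_multc)
    finally show "emeasure (distr \<pi> borel fst) A = emeasure \<nu> A" by simp
  qed (simp add: sets)
  moreover have "distr \<pi> borel snd = \<mu>"
  proof (rule measure_eqI)
    fix A assume "A \<in> sets (distr \<pi> borel snd)"
    then have [measurable]: "A \<in> sets borel" by simp
    have "emeasure (distr \<pi> borel snd) A = (\<integral>\<^sup>+z. indicator A (snd z) \<partial>\<pi>)"
      using nn_integral_distr[of snd \<pi> borel "indicator A"] by simp
    also have "\<dots> = (\<integral>\<^sup>+y. \<integral>\<^sup>+x. h (x, y) * indicator A y \<partial>\<nu> \<partial>\<mu>)"
      using P.nn_integral_snd[of "\<lambda>z. h z * indicator A (snd z)"] by (simp add: pi_integral)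
    also have "\<dots> = (\<integral>\<^sup>+x. indicator A x \<partial>\<mu>)"
      by (rule nn_integral_cong_AE, rule AE_mp[OF m2]) (auto simp: nn_integral_multc)
    finally show "emeasure (distr \<pi> borel snd) A = emeasure \<mu> A" by simp
  qed (simp add: sets)
  ultimately have "\<pi> \<in> couplings \<nu> \<mu>"
    using sets_pi by (simp add: couplings_def)
  then have "transport_cost p \<nu> \<mu> \<le> (\<integral>\<^sup>+z. ?c z \<partial>\<pi>)"
    unfolding transport_cost_def by (rule INF_lower)
  also have "\<dots> = (\<integral>\<^sup>+x. \<integral>\<^sup>+y. ?c (x, y) * h (x, y) \<partial>\<mu> \<partial>\<nu>)"
    using mu.nn_integral_fst[of "\<lambda>z. h z * ?c z" \<nu>] by (simp add: pi_integral mult.commute)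
  also have "\<dots> \<le> ?R" by (rule cost)
  finally show ?thesis .
qed

section \<open>Dyadic rings and cubes\<close>

definition ring_index :: "'a::real_normed_vector \<Rightarrow> nat" where
  "ring_index x = (LEAST n. norm x < 2 ^ n)"

text \<open>A fixed enumeration of the basis turns keys into lists of integers, a countable type
  whatever \<open>'a\<close> is.\<close>

definition basis_list :: "'a::euclidean_space list" where
  "basis_list = (SOME xs. set xs = Basis \<and> distinct xs)"

text \<open>Level \<open>0\<close> is the trivial partition; level \<open>i + 1\<close> cuts the cube \<open>[-2\<^sup>n, 2\<^sup>n)\<^sup>d\<close> around ring \<open>n\<close> into
  \<open>2\<^sup>d\<^sup>i\<close> cubes, so level \<open>1\<close> consists of the rings.\<close>
definition dyadic_key :: "nat \<Rightarrow> 'a::euclidean_space \<Rightarrow> nat \<times> int list" where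
  "dyadic_key l x = (case l of 0 \<Rightarrow> (0, [])
     | Suc i \<Rightarrow> (ring_index x, map (\<lambda>b. \<lfloor>2 ^ i * (((x \<bullet> b) / 2 ^ ring_index x + 1) / 2)\<rfloor>) basis_list))"

text \<open>The \<open>p\<close>-th power of \<open>4 d 2^(n - l)\<close>. For
  \<open>l = i + 1\<close> the cubes of ring \<open>n\<close> have side
  \<open>2^(n + 1) / 2^i = 4 * 2^(n - l)\<close>, and adding the \<open>d\<close> coordinates bounds
  the diameter. For \<open>l = 0\<close> the same expression dominates twice the radius of ring
  \<open>n\<close>.\<close>

definition dyadic_cost :: "nat \<Rightarrow> real \<Rightarrow> nat \<Rightarrow> nat \<Rightarrow> real" where
  "dyadic_cost d p l n = (4 * real d) powr p * 2 powr (p * (real n - real l))"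

lemma basis_list: "set (basis_list :: 'a list) = (Basis :: 'a::euclidean_space set)"
  "distinct (basis_list :: 'a list)" "length (basis_list :: 'a list) = DIM('a)"
proof -
  have "\<exists>xs. set xs = (Basis :: 'a set) \<and> distinct xs"
    using finite_distinct_list[OF finite_Basis] by blast
  then have *: "set (basis_list :: 'a list) = (Basis :: 'a set) \<and> distinct (basis_list :: 'a list)"
    unfolding basis_list_def by (rule someI_ex)
  then show "set (basis_list :: 'a list) = (Basis :: 'a set)" "distinct (basis_list :: 'a list)"
    "length (basis_list :: 'a list) = DIM('a)"
    using distinct_card[of "basis_list :: 'a list"] by auto
qed

lemma norm_less_ring: "norm x < 2 ^ ring_index x"
  unfolding ring_index_def by (rule LeastI_ex) (rule real_arch_pow, simp)

lemma ring_le_norm: "ring_index x \<noteq> 0 \<Longrightarrow> 2 ^ ring_index x \<le> 2 * norm x"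
  using not_less_Least[of "ring_index x - 1" "\<lambda>n. norm x < 2 ^ n"]
  by (cases "ring_index x") (auto simp: ring_index_def[symmetric])

lemma ring_measurable [measurable]: "ring_index \<in> borel \<rightarrow>\<^sub>M count_space UNIV"
  unfolding ring_index_def[abs_def] by measurable

lemma measurable_map_list:
  fixes f :: "'b \<Rightarrow> 'a \<Rightarrow> 'c::countable"
  assumes "\<And>b. f b \<in> N \<rightarrow>\<^sub>M count_space UNIV"
  shows "(\<lambda>x. map (\<lambda>b. f b x) bs) \<in> N \<rightarrow>\<^sub>M count_space UNIV"
proof (induction bs)
  case (Cons b bs)
  have "(\<lambda>x. (\<lambda>c x. c # map (\<lambda>b. f b x) bs) (f b x) x) \<in> N \<rightarrow>\<^sub>M count_space UNIV"
    by (rule measurable_compose_countable[OF _ assms])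
      (rule measurable_compose[OF Cons.IH], simp)
  then show ?case by simp
qed simp

lemma dyadic_key_measurable: "dyadic_key l \<in> borel \<rightarrow>\<^sub>M count_space UNIV"
proof (cases l)
  case (Suc i)
  \<comment> \<open>The ring index also occurs inside the floor; it is first frozen to a constant
    \<open>n\<close>, which is harmless because it takes countably many values.\<close>
  have "(\<lambda>x. (\<lambda>n x. (n, map (\<lambda>b. \<lfloor>2 ^ i * (((x \<bullet> b) / 2 ^ n + 1) / 2)\<rfloor>) basis_list)) (ring_index x) x)
      \<in> borel \<rightarrow>\<^sub>M count_space UNIV"
    by (rule measurable_compose_countable[OF _ ring_measurable])
      (rule measurable_compose[OF measurable_map_list], measurable)
  then show ?thesis using Suc by (simp add: dyadic_key_def[abs_def])
qed (simp add: dyadic_key_def[abs_def])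

lemma dyadic_key_0: "dyadic_key 0 x = dyadic_key 0 (y :: 'a::euclidean_space)"
  by (simp add: dyadic_key_def)

lemma dyadic_key_Suc_eq:
  fixes x y :: "'a::euclidean_space"
  shows "dyadic_key (Suc i) x = dyadic_key (Suc i) y \<longleftrightarrow>
    ring_index x = ring_index y \<and> (\<forall>b\<in>Basis. \<lfloor>2 ^ i * (((x \<bullet> b) / 2 ^ ring_index x + 1) / 2)\<rfloor> = \<lfloor>2 ^ i * (((y \<bullet> b) / 2 ^ ring_index y + 1) / 2)\<rfloor>)"
  by (auto simp: dyadic_key_def basis_list)

lemma dyadic_key_refine:
  fixes x y :: "'a::euclidean_space"
  shows "dyadic_key (Suc l) x = dyadic_key (Suc l) y \<Longrightarrow> dyadic_key l x = dyadic_key l y"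
proof (cases l)
  case (Suc i)
  have *: "\<lfloor>2 ^ i * t\<rfloor> = \<lfloor>2 ^ Suc i * t\<rfloor> div 2" for t :: real
    using floor_divide_real_eq_div[of 2 "2 ^ Suc i * t"] by simp
  then have fl: "\<lfloor>2 ^ i * s\<rfloor> = \<lfloor>2 ^ i * t\<rfloor>" if "\<lfloor>2 ^ Suc i * s\<rfloor> = \<lfloor>2 ^ Suc i * t\<rfloor>" for s t :: real
    using that by metis
  assume eq: "dyadic_key (Suc l) x = dyadic_key (Suc l) y"
  show "dyadic_key l x = dyadic_key l y"
    unfolding Suc dyadic_key_Suc_eq
    using eq[unfolded Suc dyadic_key_Suc_eq] by (intro conjI ballI fl) blast+
qed (simp add: dyadic_key_def)

text \<open>At level \<open>0\<close> the points may lie in different rings and the larger ring has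
  to pay, hence a sum of two charges. From level \<open>1\<close> on the rings agree and a single
  charge is enough.\<close>

lemma dyadic_key_diam:
  fixes x y :: "'a::euclidean_space"
  assumes p: "p > 0" and eq: "dyadic_key l x = dyadic_key l y"
  shows "norm (x - y) powr p \<le> dyadic_cost DIM('a) p l (ring_index x) + dyadic_cost DIM('a) p l (ring_index y)"
proof (cases l)
  case 0
  have "norm (x - y) \<le> norm x + norm y" by (rule norm_triangle_ineq4)
  also have "\<dots> \<le> 2 ^ ring_index x + 2 ^ ring_index y"
    using norm_less_ring[of x] norm_less_ring[of y] by simp
  also have "\<dots> \<le> 2 * 2 ^ max (ring_index x) (ring_index y)"
    by (cases "ring_index x \<le> ring_index y") (auto simp: max_def intro: power_increasing)
  also have "\<dots> \<le> (4 * real DIM('a)) * 2 ^ max (ring_index x) (ring_index y)"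
  proof (intro mult_right_mono)
    have "1 \<le> real DIM('a)" by (simp add: Suc_le_eq)
    then show "2 \<le> 4 * real DIM('a)" by linarith
  qed simp
  finally have "norm (x - y) powr p \<le> ((4 * real DIM('a)) * 2 ^ max (ring_index x) (ring_index y)) powr p"
    using p by (intro powr_mono2) auto
  also have "\<dots> = dyadic_cost DIM('a) p l (max (ring_index x) (ring_index y))"
    by (simp add: dyadic_cost_def 0 powr_mult powr_powr mult.commute flip: powr_realpow)
  also have "\<dots> \<le> dyadic_cost DIM('a) p l (ring_index x) + dyadic_cost DIM('a) p l (ring_index y)"
    by (cases "ring_index x \<le> ring_index y") (auto simp: dyadic_cost_def max_def)
  finally show ?thesis .
next
  case (Suc i)
  let ?n = "ring_index x"
  have r: "ring_index y = ?n" and fl: "\<And>b. b \<in> Basis \<Longrightarrow>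
      \<lfloor>2 ^ i * (((x \<bullet> b) / 2 ^ ?n + 1) / 2)\<rfloor> = \<lfloor>2 ^ i * (((y \<bullet> b) / 2 ^ ?n + 1) / 2)\<rfloor>"
    using eq unfolding Suc dyadic_key_Suc_eq by auto
  have "\<bar>(x - y) \<bullet> b\<bar> \<le> 2 * (2 ^ ?n / 2 ^ i)" if "b \<in> Basis" for b
  proof -
    have "\<bar>s - t\<bar> < 1" if "\<lfloor>s\<rfloor> = \<lfloor>t\<rfloor>" for s t :: real using that by linarith
    note this[OF fl[OF that]]
    moreover have "2 ^ i * ((s / N + 1) / 2) - 2 ^ i * ((t / N + 1) / 2) = (2 ^ i / (2 * N)) * (s - t)"
      if "N > 0" for s t N :: real
      using that by (simp add: field_simps)
    ultimately have "\<bar>(2 ^ i / (2 * 2 ^ ?n)) * ((x - y) \<bullet> b)\<bar> < 1"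
      by (simp add: inner_diff_left)
    then show ?thesis
      by (simp add: abs_mult field_simps)
  qed
  then have S: "(\<Sum>b\<in>Basis. \<bar>(x - y) \<bullet> b\<bar>) \<le> (\<Sum>b\<in>(Basis::'a set). 2 * (2 ^ ?n / 2 ^ i))"
    by (rule sum_mono)
  then have "norm (x - y) \<le> (4 * real DIM('a)) * 2 powr (real ?n - real l)"
    using order_trans[OF norm_le_l1 S] by (simp add: Suc powr_diff powr_add powr_realpow mult_ac)
  then have "norm (x - y) powr p \<le> ((4 * real DIM('a)) * 2 powr (real ?n - real l)) powr p"
    using p by (intro powr_mono2) auto
  also have "\<dots> = dyadic_cost DIM('a) p l (ring_index x)"
    by (simp add: dyadic_cost_def powr_mult powr_powr mult.commute)
  also have "\<dots> \<le> dyadic_cost DIM('a) p l (ring_index x) + dyadic_cost DIM('a) p l (ring_index y)"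
    by (simp add: dyadic_cost_def)
  finally show ?thesis .
qed

definition dyadic_indices :: "nat \<Rightarrow> nat \<Rightarrow> int list set" where
  "dyadic_indices d i = {xs. set xs \<subseteq> {0..<2 ^ i} \<and> length xs = d}"

lemma dyadic_indices: "finite (dyadic_indices d i)" "card (dyadic_indices d i) = 2 ^ (i * d)"
  unfolding dyadic_indices_def
  using finite_lists_length_eq[of "{0..<2 ^ i :: int}" d] card_lists_length_eq[of "{0..<2 ^ i :: int}" d]
  by (simp_all add: power_mult nat_power_eq)

text \<open>Limits the keys of one ring to \<open>2^(i d)\<close> many, the count that enters the
  Cauchy-Schwarz inequality over the cubes of a ring.\<close>

lemma dyadic_key_in_indices: "dyadic_key (Suc i) (x :: 'a::euclidean_space) \<in> {ring_index x} \<times> dyadic_indices DIM('a) i"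
proof -
  have "\<lfloor>2 ^ i * (((x \<bullet> b) / 2 ^ ring_index x + 1) / 2)\<rfloor> \<in> {0..<2 ^ i}" if "b \<in> Basis" for b
  proof -
    have "\<bar>x \<bullet> b\<bar> < 2 ^ ring_index x"
      using Basis_le_norm[OF that, of x] norm_less_ring[of x] by simp
    then have "\<bar>(x \<bullet> b) / 2 ^ ring_index x\<bar> < 1" by simp
    moreover have "0 < (a + 1) / 2 \<and> (a + 1) / 2 < 1" if "\<bar>a\<bar> < 1" for a :: real
      using that by auto
    ultimately have "0 < ((x \<bullet> b) / 2 ^ ring_index x + 1) / 2 \<and> ((x \<bullet> b) / 2 ^ ring_index x + 1) / 2 < 1" by blast
    then have "0 \<le> 2 ^ i * (((x \<bullet> b) / 2 ^ ring_index x + 1) / 2)" "2 ^ i * (((x \<bullet> b) / 2 ^ ring_index x + 1) / 2) < 2 ^ i"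
      by simp_all
    then show ?thesis by (simp add: floor_less_iff)
  qed
  then show ?thesis by (auto simp: dyadic_key_def dyadic_indices_def basis_list)
qed

text \<open>The charge uses only the ring component of a key. Keys of level \<open>Suc l\<close>
  have it even for \<open>l = 0\<close>, whereas the trivial key of level \<open>0\<close> has lost
  it; this is why charges are read off one level finer.\<close>

lemma transport_cost_dyadic:
  fixes \<nu> \<mu> :: "'a::euclidean_space measure"
  assumes "p > 0" and "prob_space \<nu>" "prob_space \<mu>" "sets \<nu> = sets borel" "sets \<mu> = sets borel"
  shows "transport_cost p \<nu> \<mu>
        \<le> (\<integral>\<^sup>+x. ennreal (dyadic_cost DIM('a) p L (ring_index x)) \<partial>\<nu>) + (\<integral>\<^sup>+x. ennreal (dyadic_cost DIM('a) p L (ring_index x)) \<partial>\<mu>)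
          + (\<Sum>i<L. \<integral>\<^sup>+j. ennreal (dyadic_cost DIM('a) p i (fst j)) *
              ennreal \<bar>measure \<nu> (dyadic_key (Suc i) -` {j}) - measure \<mu> (dyadic_key (Suc i) -` {j})\<bar> \<partial>count_space UNIV)"
proof -
  have fst_key: "fst (dyadic_key (Suc l) x) = ring_index x" for l and x :: 'a by (simp add: dyadic_key_def)
  have nn: "0 \<le> dyadic_cost d p l n" for d l n by (simp add: dyadic_cost_def)
  have "ennreal (norm (x - y) powr p) \<le> ennreal (dyadic_cost DIM('a) p l (fst (dyadic_key (Suc l) x)))
      + ennreal (dyadic_cost DIM('a) p l (fst (dyadic_key (Suc l) y)))" if "dyadic_key l x = dyadic_key l y" for l and x y :: 'a
    using dyadic_key_diam[OF assms(1) that] by (simp add: fst_key nn flip: ennreal_plus)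
  from transport_cost_multiscale[where k=dyadic_key and w="\<lambda>l j. ennreal (dyadic_cost DIM('a) p l (fst j))",
      OF dyadic_key_measurable dyadic_key_refine dyadic_key_0 this assms(2-5), of L]
  show ?thesis by (simp add: fst_key)
qed

section \<open>Empirical averages of stationary Markov processes\<close>

text \<open>Meant for a bounded function along a path, about which only measurability is known. The
  definition of \<open>measurable_on\<close> supplies continuous functions converging to
  \<open>y\<close> off a negligible set. Truncation to \<open>[-c, c]\<close> keeps them continuous
  and convergent, and makes dominated convergence available both for the approximation and for the
  shift of each approximant.\<close>

lemma tendsto_L2_translation:
  fixes y :: "real \<Rightarrow> real"
  assumes y [measurable]: "y \<in> borel_measurable borel" and bound: "\<And>x. \<bar>y x\<bar> \<le> c"
    and S: "S \<longlonglongrightarrow> 0" "\<And>n. 0 < S n" "\<And>n. S n < 1"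
  shows "(\<lambda>n. \<integral>x. indicator {0..1} x * (y (x + S n) - y x)\<^sup>2 \<partial>lborel) \<longlonglongrightarrow> 0"
proof -
  have c: "0 \<le> c" using bound[of 0] by linarith
  have "y measurable_on UNIV"
    by (rule lebesgue_measurable_imp_measurable_on) (simp_all add: measurable_completion)
  then obtain N g0 where N: "negligible N" and g0: "\<And>n::nat. continuous_on UNIV (g0 n)"
    and lim0: "\<And>x. x \<notin> N \<Longrightarrow> (\<lambda>n. g0 n x) \<longlonglongrightarrow> y x"
    unfolding measurable_on_def by auto
  define g where "g n x = max (-c) (min c (g0 n x))" for n x
  have g_cont: "continuous_on UNIV (g n)" for n
    unfolding g_def[abs_def] using g0 by (intro continuous_intros)
  then have [measurable]: "g n \<in> borel_measurable borel" for n
    by (rule borel_measurable_continuous_onI)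
  have g_bound: "\<bar>g n x\<bar> \<le> c" for n x
    using c by (auto simp: g_def)
  have g_lim: "(\<lambda>n. g n x) \<longlonglongrightarrow> y x" if "x \<notin> N" for x
  proof -
    have "(\<lambda>n. g n x) \<longlonglongrightarrow> max (-c) (min c (y x))"
      unfolding g_def using lim0[OF that] by (intro tendsto_intros)
    moreover have "max (-c) (min c (y x)) = y x" using bound[of x] by auto
    ultimately show ?thesis by simp
  qed
  have sq: "(a - b)\<^sup>2 \<le> (2 * c)\<^sup>2" if "\<bar>a\<bar> \<le> c" "\<bar>b\<bar> \<le> c" for a b
    using that by (intro power2_le_iff_abs_le[THEN iffD2]) (use c in linarith)+
  have ind: "integrable lborel (indicator {a..b} :: real \<Rightarrow> real)" for a b :: real
    by (intro integrable_real_indicator) (simp_all add: emeasure_lborel_Icc_eq)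
  have int: "integrable lborel (\<lambda>x. indicator {a..b} x * (F x)\<^sup>2)"
    if [measurable]: "F \<in> borel_measurable borel" and "\<And>x. (F x)\<^sup>2 \<le> (2 * c)\<^sup>2" for F and a b :: real
  proof (rule Bochner_Integration.integrable_bound)
    show "integrable lborel (\<lambda>x. indicator {a..b} x * (2 * c)\<^sup>2)"
      by (intro integrable_mult_left ind)
    show "AE x in lborel. norm (indicator {a..b} x * (F x)\<^sup>2) \<le> norm (indicator {a..b} x * (2 * c)\<^sup>2)"
      using that by (auto simp: indicator_def)
  qed measurable
  \<comment> \<open>For \<open>x\<close> in \<open>[0, 1]\<close> and \<open>S n < 1\<close> the
    shifted point stays in \<open>[0, 2]\<close>, so the single error \<open>J k\<close> controls
    the approximation at \<open>x\<close> and at \<open>x + S n\<close>.\<close>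
  define J where "J k = (\<integral>x. indicator {0..2} x * (g k x - y x)\<^sup>2 \<partial>lborel)" for k
  have J: "J \<longlonglongrightarrow> 0"
  proof -
    have "J \<longlonglongrightarrow> (\<integral>x. 0 \<partial>(lborel::real measure))"
      unfolding J_def[abs_def]
    proof (rule integral_dominated_convergence[where w="\<lambda>x. indicator {0..2} x * (2 * c)\<^sup>2"])
      have "AE x in lebesgue. x \<notin> N" using N
        by (simp add: AE_iff_null_sets[symmetric] negligible_iff_null_sets AE_not_in)
      then have "AE x in lborel. x \<notin> N" by (simp add: AE_completion_iff)
      then show "AE x in lborel. (\<lambda>i. indicator {0..2} x * (g i x - y x)\<^sup>2) \<longlonglongrightarrow> 0"
      proof (rule AE_mp, intro AE_I2 impI)
        fix x assume "x \<notin> N"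
        from g_lim[OF this] have "(\<lambda>i. indicator {0..2} x * (g i x - y x)\<^sup>2) \<longlonglongrightarrow> indicator {0..2} x * (y x - y x)\<^sup>2"
          by (intro tendsto_intros)
        then show "(\<lambda>i. indicator {0..2} x * (g i x - y x)\<^sup>2) \<longlonglongrightarrow> 0" by simp
      qed
      show "integrable lborel (\<lambda>x. indicator {0..2::real} x * (2 * c)\<^sup>2)"
        by (intro integrable_mult_left ind)
      show "AE x in lborel. norm (indicator {0..2} x * (g i x - y x)\<^sup>2) \<le> indicator {0..2} x * (2 * c)\<^sup>2" for i
        using sq[OF g_bound bound] by (auto simp: indicator_def)
    qed measurable
    then show ?thesis by simp
  qed
  have b: "(\<lambda>n. \<integral>x. indicator {0..1} x * (g k (x + S n) - g k x)\<^sup>2 \<partial>lborel) \<longlonglongrightarrow> 0" for k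
  proof -
    have "(\<lambda>n. \<integral>x. indicator {0..1} x * (g k (x + S n) - g k x)\<^sup>2 \<partial>lborel) \<longlonglongrightarrow> (\<integral>x. 0 \<partial>(lborel::real measure))"
    proof (rule integral_dominated_convergence[where w="\<lambda>x. indicator {0..1} x * (2 * c)\<^sup>2"])
      show "AE x in lborel. (\<lambda>n. indicator {0..1} x * (g k (x + S n) - g k x)\<^sup>2) \<longlonglongrightarrow> 0"
      proof (intro AE_I2)
        fix x
        have "(\<lambda>n. x + S n) \<longlonglongrightarrow> x + 0" using S by (intro tendsto_intros)
        then have "(\<lambda>n. g k (x + S n)) \<longlonglongrightarrow> g k x"
          using g_cont[of k] by (intro continuous_on_tendsto_compose[of UNIV "g k"]) auto
        then have "(\<lambda>n. indicator {0..1} x * (g k (x + S n) - g k x)\<^sup>2) \<longlonglongrightarrow> indicator {0..1} x * (g k x - g k x)\<^sup>2"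
          by (intro tendsto_intros)
        then show "(\<lambda>n. indicator {0..1} x * (g k (x + S n) - g k x)\<^sup>2) \<longlonglongrightarrow> 0" by simp
      qed
      show "integrable lborel (\<lambda>x. indicator {0..1::real} x * (2 * c)\<^sup>2)"
        by (intro integrable_mult_left ind)
      show "AE x in lborel. norm (indicator {0..1} x * (g k (x + S n) - g k x)\<^sup>2) \<le> indicator {0..1} x * (2 * c)\<^sup>2" for n
        using sq[OF g_bound g_bound] by (auto simp: indicator_def)
    qed measurable
    then show ?thesis by simp
  qed
  have split: "(\<integral>x. indicator {0..1} x * (y (x + S n) - y x)\<^sup>2 \<partial>lborel)
      \<le> 6 * J k + 3 * (\<integral>x. indicator {0..1} x * (g k (x + S n) - g k x)\<^sup>2 \<partial>lborel)" for n k
  proof -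
    let ?I = "\<lambda>F. \<integral>x. indicator {0..1::real} x * (F x)\<^sup>2 \<partial>lborel"
    let ?u = "\<lambda>x. g k (x + S n) - y (x + S n)" and ?v = "\<lambda>x. g k (x + S n) - g k x" and ?w = "\<lambda>x. g k x - y x"
    \<comment> \<open>For three numbers with sum \<open>q - r\<close>, three times the sum of
      squares exceeds the square of the sum by the sum of the squared pairwise differences.\<close>
    have ineq: "(q - r)\<^sup>2 \<le> 3 * (p - q)\<^sup>2 + 3 * (p - s)\<^sup>2 + 3 * (s - r)\<^sup>2" for p q r s :: real
      using sum_squares_ge_zero[of "(q - p) - (p - s)" "(p - s) - (s - r)"] zero_le_power2[of "(q - p) - (s - r)"]
      by (simp add: power2_eq_square algebra_simps)
    have i: "integrable lborel (\<lambda>x. indicator {0..1} x * (?u x)\<^sup>2)" "integrable lborel (\<lambda>x. indicator {0..1} x * (?v x)\<^sup>2)"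
      "integrable lborel (\<lambda>x. indicator {0..1} x * (?w x)\<^sup>2)" "integrable lborel (\<lambda>x. indicator {0..1} x * (y (x + S n) - y x)\<^sup>2)"
      by (intro int sq g_bound bound; measurable)+
    have "?I (\<lambda>x. y (x + S n) - y x)
        \<le> (\<integral>x. 3 * (indicator {0..1} x * (?u x)\<^sup>2) + 3 * (indicator {0..1} x * (?v x)\<^sup>2) + 3 * (indicator {0..1} x * (?w x)\<^sup>2) \<partial>lborel)"
      using i by (intro integral_mono) (auto simp: indicator_def intro: ineq)
    also have "\<dots> = 3 * ?I ?u + 3 * ?I ?v + 3 * ?I ?w"
      using i by simp
    also have "?I ?w \<le> J k"
      unfolding J_def using i sq[OF g_bound bound] by (intro integral_mono int) (auto simp: indicator_def)
    also have "?I ?u \<le> J k"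
    proof -
      have "?I ?u = (\<integral>x. indicator {0..1} (x - S n) * (g k x - y x)\<^sup>2 \<partial>lborel)"
        by (subst (2) lborel_integral_real_affine[where c=1 and t="S n"]) (simp_all add: add.commute)
      also have "\<dots> = (\<integral>x. indicator {S n..1 + S n} x * (g k x - y x)\<^sup>2 \<partial>lborel)"
        by (intro Bochner_Integration.integral_cong) (auto simp: indicator_def)
      also have "\<dots> \<le> J k"
        unfolding J_def using sq[OF g_bound bound] S(2)[of n] S(3)[of n]
        by (intro integral_mono int) (auto simp: indicator_def)
      finally show ?thesis .
    qed
    finally show ?thesis by simp
  qed
  show ?thesis
  proof (rule tendstoI)
    fix e :: real assume e: "0 < e"
    \<comment> \<open>The tolerances are chosen for \<open>split\<close>:
      \<open>6 * (e / 12) + 3 * (e / 6) = e\<close>.\<close>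
    have "eventually (\<lambda>k. J k < e / 12) sequentially"
      using order_tendstoD(2)[OF J, of "e / 12"] e by simp
    then obtain k where k: "J k < e / 12" by (auto simp: eventually_sequentially)
    have "eventually (\<lambda>n. (\<integral>x. indicator {0..1} x * (g k (x + S n) - g k x)\<^sup>2 \<partial>lborel) < e / 6) sequentially"
      using order_tendstoD(2)[OF b[of k], of "e / 6"] e by simp
    then show "eventually (\<lambda>n. dist (\<integral>x. indicator {0..1} x * (y (x + S n) - y x)\<^sup>2 \<partial>lborel) 0 < e) sequentially"
    proof eventually_elim
      case (elim n)
      have "0 \<le> (\<integral>x. indicator {0..1} x * (y (x + S n) - y x)\<^sup>2 \<partial>lborel)"
        by (intro integral_nonneg_AE) auto
      then show ?case using split[of n k] k elim by simp
    qed
  qed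
qed

text \<open>A bound at every point, not just almost everywhere, makes these functions integrable
  against all finite measures at once, in particular against every \<open>K t x\<close>, and is
  preserved by composition and by \<open>semigroup_op\<close>.\<close>

definition bdd_measurable :: "'c measure \<Rightarrow> ('c \<Rightarrow> real) \<Rightarrow> bool" where
  "bdd_measurable N f \<longleftrightarrow> f \<in> borel_measurable N \<and> (\<exists>c. \<forall>x. \<bar>f x\<bar> \<le> c)"

abbreviation bdd_borel :: "('c::topological_space \<Rightarrow> real) \<Rightarrow> bool" where
  "bdd_borel \<equiv> bdd_measurable borel"

lemma bdd_measurableD: "bdd_measurable N f \<Longrightarrow> f \<in> borel_measurable N"
  by (simp add: bdd_measurable_def)

lemma bdd_measurableE:
  assumes "bdd_measurable N f"
  obtains c where "0 \<le> c" "\<And>x. \<bar>f x\<bar> \<le> c"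
proof -
  obtain c where "\<And>x. \<bar>f x\<bar> \<le> c" using assms by (auto simp: bdd_measurable_def)
  moreover from this[of undefined] have "0 \<le> c" by linarith
  ultimately show thesis using that by blast
qed

lemma bdd_measurable_const [intro]: "bdd_measurable N (\<lambda>x. c)"
  by (auto simp: bdd_measurable_def)

lemma
  assumes "bdd_measurable N f" "bdd_measurable N g"
  shows bdd_measurable_add [intro]: "bdd_measurable N (\<lambda>x. f x + g x)"
    and bdd_measurable_diff [intro]: "bdd_measurable N (\<lambda>x. f x - g x)"
    and bdd_measurable_mult [intro]: "bdd_measurable N (\<lambda>x. f x * g x)"
proof -
  obtain c d where 1: "0 \<le> c" "\<And>x. \<bar>f x\<bar> \<le> c" and 2: "0 \<le> d" "\<And>x. \<bar>g x\<bar> \<le> d"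
    using assms by (metis bdd_measurableE)
  have "\<bar>f x + g x\<bar> \<le> c + d" "\<bar>f x - g x\<bar> \<le> c + d" for x using 1(2)[of x] 2(2)[of x] by linarith+
  moreover have "\<bar>f x * g x\<bar> \<le> c * d" for x
    using 1 2 by (auto simp: abs_mult intro!: mult_mono)
  ultimately show "bdd_measurable N (\<lambda>x. f x + g x)" "bdd_measurable N (\<lambda>x. f x - g x)"
    "bdd_measurable N (\<lambda>x. f x * g x)"
    using assms unfolding bdd_measurable_def
    by (blast intro: borel_measurable_add borel_measurable_diff borel_measurable_times)+
qed

lemma bdd_measurable_divide [intro]: "bdd_measurable N f \<Longrightarrow> bdd_measurable N (\<lambda>x. f x / c)"
  using bdd_measurable_mult[OF _ bdd_measurable_const[of N "1 / c"]] by fastforce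

lemma bdd_measurable_power2 [intro]: "bdd_measurable N f \<Longrightarrow> bdd_measurable N (\<lambda>x. (f x)\<^sup>2)"
  unfolding power2_eq_square by blast

lemma bdd_measurable_compose:
  "bdd_measurable N f \<Longrightarrow> g \<in> L \<rightarrow>\<^sub>M N \<Longrightarrow> bdd_measurable L (\<lambda>x. f (g x))"
  by (auto simp: bdd_measurable_def intro: measurable_compose)

lemma bdd_measurable_cong_sets:
  "sets N = sets L \<Longrightarrow> bdd_measurable N f = bdd_measurable L f"
  by (simp add: bdd_measurable_def cong: measurable_cong_sets)

lemma integrable_bdd_measurable:
  assumes "bdd_measurable N f" "finite_measure N"
  shows "integrable N f"
proof -
  obtain c where "\<And>x. \<bar>f x\<bar> \<le> c" using assms(1) by (auto simp: bdd_measurable_def)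
  then show ?thesis
    using bdd_measurableD[OF assms(1)]
    by (intro finite_measure.integrable_const_bound[OF assms(2), where B=c]) auto
qed

section \<open>The Markov property and conditional expectations\<close>

locale stationary_markov = prob_space M for M :: "'b measure" +
  fixes X :: "real \<Rightarrow> 'b \<Rightarrow> 'a::euclidean_space" and K :: "real \<Rightarrow> 'a \<Rightarrow> 'a measure" and \<mu> :: "'a measure"
  assumes markov: "markov_process M X K"
    and initial: "distr M borel (X 0) = \<mu>"
    and invariant: "invariant_measure K \<mu>"
begin

lemma sets_mu [measurable_cong, simp]: "sets \<mu> = sets borel" and space_mu [simp]: "space \<mu> = UNIV"
  using initial by auto

sublocale mu: prob_space \<mu>
  using invariant by (simp add: invariant_measure_def)

text \<open>Negative times are frozen at \<open>0\<close>, so that paths are defined on the whole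
  line and jointly measurable over \<open>borel\<close> instead of the restricted time space of
  \<open>markov_process\<close>.\<close>

definition traj :: "real \<Rightarrow> 'b \<Rightarrow> 'a" where
  "traj t w = X (max 0 t) w"

lemma traj_eq: "0 \<le> t \<Longrightarrow> traj t = X t"
  by (simp add: traj_def fun_eq_iff max_def)

lemma traj_measurable [measurable]: "(\<lambda>z. traj (fst z) (snd z)) \<in> borel \<Otimes>\<^sub>M M \<rightarrow>\<^sub>M borel"
proof -
  have X: "(\<lambda>z. X (fst z) (snd z)) \<in> restrict_space lborel {0..} \<Otimes>\<^sub>M M \<rightarrow>\<^sub>M borel"
    using markov by (simp add: markov_process_def split_beta')
  have "(\<lambda>z. (max 0 (fst z), snd z)) \<in> borel \<Otimes>\<^sub>M M \<rightarrow>\<^sub>M restrict_space lborel {0::real..} \<Otimes>\<^sub>M M"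
    by (intro measurable_Pair measurable_restrict_space2) auto
  from measurable_compose[OF this X] show ?thesis
    by (simp add: traj_def)
qed

lemma traj_measurable_compose [measurable (raw)]:
  assumes "f \<in> borel_measurable N" "g \<in> N \<rightarrow>\<^sub>M M"
  shows "(\<lambda>x. traj (f x) (g x)) \<in> N \<rightarrow>\<^sub>M borel"
  using measurable_compose[OF measurable_Pair[OF assms] traj_measurable] by simp

lemma X_measurable [measurable]: "0 \<le> t \<Longrightarrow> X t \<in> M \<rightarrow>\<^sub>M borel"
  using traj_measurable_compose[of "\<lambda>_. t" M "\<lambda>x. x"] traj_eq[of t] by simp

lemma K_measurable: "0 \<le> t \<Longrightarrow> K t \<in> borel \<rightarrow>\<^sub>M prob_algebra borel"
  using markov by (simp add: markov_process_def)

lemma K_measurable' [measurable]: "0 \<le> t \<Longrightarrow> K t \<in> borel \<rightarrow>\<^sub>M subprob_algebra borel"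
  by (rule measurable_prob_algebraD[OF K_measurable])

lemma K_prob: "0 \<le> t \<Longrightarrow> prob_space (K t x)" and K_sets [measurable_cong]: "0 \<le> t \<Longrightarrow> sets (K t x) = sets borel"
  using measurable_space[OF K_measurable, of t x] by (auto simp: space_prob_algebra)

lemma markov_sets:
  assumes r: "0 \<le> r" "r \<le> s" "0 \<le> t" and [measurable]: "A \<in> sets borel" "B \<in> sets borel"
  shows "(\<integral>\<^sup>+w. indicator A (X r w) * indicator B (X (s + t) w) \<partial>M)
      = (\<integral>\<^sup>+w. indicator A (X r w) * emeasure (K t (X s w)) B \<partial>M)"
proof -
  have [measurable]: "X r \<in> M \<rightarrow>\<^sub>M borel" "X s \<in> M \<rightarrow>\<^sub>M borel" "X (s + t) \<in> M \<rightarrow>\<^sub>M borel"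
    using r by auto
  have [measurable]: "(\<lambda>w. K t (X s w)) \<in> M \<rightarrow>\<^sub>M subprob_algebra borel"
    using K_measurable'[of t] r by measurable
  let ?A = "X r -` A \<inter> space M"
  have "?A \<in> sigma_sets (space M) {X r -` B \<inter> space M | r B. 0 \<le> r \<and> r \<le> s \<and> B \<in> sets borel}"
    using r by (intro sigma_sets.Basic CollectI exI[of _ r] exI[of _ A]) auto
  then have "measure M (?A \<inter> (X (s + t) -` B \<inter> space M)) = (\<integral>w. indicator ?A w * measure (K t (X s w)) B \<partial>M)"
    using markov r assms(4,5) unfolding markov_process_def by auto
  moreover have "(\<integral>\<^sup>+w. indicator A (X r w) * indicator B (X (s + t) w) \<partial>M)
      = (\<integral>\<^sup>+w. indicator (?A \<inter> (X (s + t) -` B \<inter> space M)) w \<partial>M)"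
    by (intro nn_integral_cong) (auto simp: indicator_def)
  moreover have "\<dots> = ennreal (measure M (?A \<inter> (X (s + t) -` B \<inter> space M)))"
    by (simp add: emeasure_eq_measure)
  moreover have "ennreal (\<integral>w. indicator ?A w * measure (K t (X s w)) B \<partial>M)
      = (\<integral>\<^sup>+w. ennreal (indicator ?A w * measure (K t (X s w)) B) \<partial>M)"
  proof (rule nn_integral_eq_integral[symmetric])
    show "integrable M (\<lambda>w. indicator ?A w * measure (K t (X s w)) B)"
      using prob_space.prob_le_1[OF K_prob[OF r(3)]]
      by (intro integrable_const_bound[where B=1] AE_I2) (auto simp: indicator_def)
  qed simp
  moreover have "\<dots> = (\<integral>\<^sup>+w. indicator A (X r w) * emeasure (K t (X s w)) B \<partial>M)"
    using finite_measure.emeasure_eq_measure[OF prob_space.finite_measure[OF K_prob[OF r(3)]]]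
    by (intro nn_integral_cong) (auto simp: indicator_def)
  ultimately show ?thesis by simp
qed

text \<open>Two equalities of measures replace an induction over functions. For fixed
  \<open>B\<close>, two images under \<open>X r\<close> agree on sets, which passes from
  \<open>A\<close> to \<open>\<phi>\<close>. Then, with the density \<open>\<phi> (X r w)\<close>
  fixed, the image under \<open>X (s + t)\<close> and the bind with the kernel agree on sets, which
  passes from \<open>B\<close> to \<open>\<psi>\<close>.\<close>

lemma markov_nn_integral:
  assumes r: "0 \<le> r" "r \<le> s" "0 \<le> t" and [measurable]: "\<phi> \<in> borel_measurable borel" "\<psi> \<in> borel_measurable borel"
  shows "(\<integral>\<^sup>+w. \<phi> (X r w) * \<psi> (X (s + t) w) \<partial>M)
      = (\<integral>\<^sup>+w. \<phi> (X r w) * (\<integral>\<^sup>+y. \<psi> y \<partial>K t (X s w)) \<partial>M)"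
proof -
  have [measurable]: "X r \<in> M \<rightarrow>\<^sub>M borel" "X s \<in> M \<rightarrow>\<^sub>M borel" "X (s + t) \<in> M \<rightarrow>\<^sub>M borel"
    using r by auto
  have [measurable]: "(\<lambda>w. K t (X s w)) \<in> M \<rightarrow>\<^sub>M subprob_algebra borel"
    using K_measurable'[of t] r by measurable
  have 1: "(\<integral>\<^sup>+w. \<phi> (X r w) * indicator B (X (s + t) w) \<partial>M)
      = (\<integral>\<^sup>+w. \<phi> (X r w) * emeasure (K t (X s w)) B \<partial>M)" if [measurable]: "B \<in> sets borel" for B
  proof -
    have "distr (density M (\<lambda>w. indicator B (X (s + t) w))) borel (X r)
        = distr (density M (\<lambda>w. emeasure (K t (X s w)) B)) borel (X r)"
    proof (rule measure_eqI)
      fix A assume "A \<in> sets (distr (density M (\<lambda>w. indicator B (X (s + t) w))) borel (X r))"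
      then have [measurable]: "A \<in> sets borel" by simp
      have *: "emeasure (distr (density M g) borel (X r)) A = (\<integral>\<^sup>+w. indicator A (X r w) * g w \<partial>M)"
        if [measurable]: "g \<in> borel_measurable M" for g
        by (simp add: emeasure_distr emeasure_density)
          (auto intro!: nn_integral_cong simp: indicator_def)
      show "emeasure (distr (density M (\<lambda>w. indicator B (X (s + t) w))) borel (X r)) A
          = emeasure (distr (density M (\<lambda>w. emeasure (K t (X s w)) B)) borel (X r)) A"
        using markov_sets[OF r \<open>A \<in> sets borel\<close> that] by (simp add: *)
    qed simp
    then have "(\<integral>\<^sup>+x. \<phi> x \<partial>distr (density M (\<lambda>w. indicator B (X (s + t) w))) borel (X r))
        = (\<integral>\<^sup>+x. \<phi> x \<partial>distr (density M (\<lambda>w. emeasure (K t (X s w)) B)) borel (X r))" by simp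
    then show ?thesis
      by (simp add: nn_integral_distr nn_integral_density mult.commute)
  qed
  let ?D = "density M (\<lambda>w. \<phi> (X r w))"
  have ne: "space ?D \<noteq> {}" using not_empty by simp
  have [measurable]: "(\<lambda>w. K t (X s w)) \<in> ?D \<rightarrow>\<^sub>M subprob_algebra borel" by simp
  have "distr ?D borel (X (s + t)) = ?D \<bind> (\<lambda>w. K t (X s w))"
  proof (rule measure_eqI)
    show "sets (distr ?D borel (X (s + t))) = sets (?D \<bind> (\<lambda>w. K t (X s w)))"
      using ne K_sets[OF r(3)] by (subst sets_bind[where N=borel]) auto
    fix B assume "B \<in> sets (distr ?D borel (X (s + t)))"
    then have [measurable]: "B \<in> sets borel" by simp
    have "emeasure (distr ?D borel (X (s + t))) B = (\<integral>\<^sup>+w. \<phi> (X r w) * indicator B (X (s + t) w) \<partial>M)"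
      by (simp add: emeasure_distr emeasure_density)
        (auto intro!: nn_integral_cong simp: indicator_def)
    also have "\<dots> = emeasure (?D \<bind> (\<lambda>w. K t (X s w))) B"
      using ne by (subst emeasure_bind[where N=borel]) (auto simp: 1 nn_integral_density)
    finally show "emeasure (distr ?D borel (X (s + t))) B = emeasure (?D \<bind> (\<lambda>w. K t (X s w))) B" .
  qed
  then have "(\<integral>\<^sup>+x. \<psi> x \<partial>distr ?D borel (X (s + t))) = (\<integral>\<^sup>+x. \<psi> x \<partial>(?D \<bind> (\<lambda>w. K t (X s w))))"
    by simp
  then show ?thesis
    by (simp add: nn_integral_distr nn_integral_density nn_integral_bind[where B=borel])
qed

lemma distr_X: 
  assumes "0 \<le> t" shows "distr M borel (X t) = \<mu>"
proof (rule measure_eqI)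
  have [measurable]: "X t \<in> M \<rightarrow>\<^sub>M borel" "X 0 \<in> M \<rightarrow>\<^sub>M borel" using assms by auto
  fix B assume "B \<in> sets (distr M borel (X t))"
  then have B[measurable]: "B \<in> sets borel" by simp
  have "emeasure (distr M borel (X t)) B = (\<integral>\<^sup>+w. indicator B (X t w) \<partial>M)"
    using nn_integral_distr[of "X t" M borel "indicator B"] by simp
  also have "\<dots> = (\<integral>\<^sup>+w. emeasure (K t (X 0 w)) B \<partial>M)"
    using markov_sets[of 0 0 t UNIV B] assms by simp
  also have "\<dots> = (\<integral>\<^sup>+x. emeasure (K t x) B \<partial>distr M borel (X 0))"
    using K_measurable'[OF assms] by (subst nn_integral_distr) auto
  also have "\<dots> = emeasure \<mu> B"
    using invariant assms B unfolding initial invariant_measure_def by auto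
  finally show "emeasure (distr M borel (X t)) B = emeasure \<mu> B" .
qed simp

lemma integral_X:
  fixes g :: "'a \<Rightarrow> real"
  assumes "0 \<le> t" and [measurable]: "g \<in> borel_measurable borel"
  shows "(\<integral>w. g (X t w) \<partial>M) = (\<integral>x. g x \<partial>\<mu>)"
  using assms(1) by (subst distr_X[OF assms(1), symmetric], subst integral_distr) auto

lemma integrable_rv: "bdd_measurable M W \<Longrightarrow> integrable M W"
  by (rule integrable_bdd_measurable[OF _ finite_measure_axioms])

lemma integrable_mu: "bdd_borel f \<Longrightarrow> integrable \<mu> f"
  by (rule integrable_bdd_measurable[OF _ mu.finite_measure_axioms]) (simp cong: bdd_measurable_cong_sets)

lemma bounded_rv_X [intro]: "bdd_borel f \<Longrightarrow> 0 \<le> t \<Longrightarrow> bdd_measurable M (\<lambda>w. f (X t w))"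
  by (rule bdd_measurable_compose[OF _ X_measurable])

lemma bounded_rv_traj [intro]: "bdd_borel f \<Longrightarrow> bdd_measurable M (\<lambda>w. f (traj t w))"
  by (erule bdd_measurable_compose) measurable

lemma integrable_K: "bdd_borel f \<Longrightarrow> 0 \<le> t \<Longrightarrow> integrable (K t x) f"
  using prob_space.finite_measure[OF K_prob]
  by (intro integrable_bdd_measurable) (auto cong: bdd_measurable_cong_sets[OF K_sets])

lemma bdd_borel_semigroup [intro]:
  assumes "bdd_borel f" "0 \<le> t"
  shows "bdd_borel (semigroup_op K t f)"
proof -
  have [measurable]: "f \<in> borel_measurable borel" by (rule bdd_measurableD[OF assms(1)])
  obtain c where c: "\<And>x. \<bar>f x\<bar> \<le> c" using bdd_measurableE[OF assms(1)] by metis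
  have "semigroup_op K t f \<in> borel_measurable borel"
    using K_measurable'[OF assms(2)] unfolding semigroup_op_def[abs_def] by measurable
  moreover have "\<bar>semigroup_op K t f x\<bar> \<le> c" for x
  proof -
    interpret P: prob_space "K t x" by (rule K_prob[OF assms(2)])
    have "\<bar>semigroup_op K t f x\<bar> \<le> (\<integral>y. \<bar>f y\<bar> \<partial>K t x)"
      unfolding semigroup_op_def by (rule integral_abs_bound)
    also have "\<dots> \<le> (\<integral>y. c \<partial>K t x)"
      using c assms by (intro integral_mono integrable_abs integrable_K) auto
    finally show ?thesis by (simp add: P.prob_space)
  qed
  ultimately show ?thesis unfolding bdd_measurable_def by blast
qed

text \<open>Adding constants makes both functions nonnegative. Kernels are probabilities, so
  \<open>semigroup_op K t\<close> commutes with the shift; \<open>expand\<close> removes it again,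
  and the correction terms on the two sides agree by the instance whose first function is the
  constant \<open>1\<close>.\<close>

lemma markov_integral:
  assumes r: "0 \<le> r" "r \<le> s" "0 \<le> t" and b: "bdd_borel \<phi>" "bdd_borel \<psi>"
  shows "(\<integral>w. \<phi> (X r w) * \<psi> (X (s + t) w) \<partial>M) = (\<integral>w. \<phi> (X r w) * semigroup_op K t \<psi> (X s w) \<partial>M)"
proof -
  have s: "0 \<le> s" "0 \<le> s + t" using r by auto
  note [measurable] = X_measurable[OF r(1)] X_measurable[OF s(1)] X_measurable[OF s(2)]
  have pos: "(\<integral>w. \<phi> (X r w) * \<psi> (X (s + t) w) \<partial>M) = (\<integral>w. \<phi> (X r w) * semigroup_op K t \<psi> (X s w) \<partial>M)"
    if b: "bdd_borel \<phi>" "bdd_borel \<psi>" and nn: "\<And>x. 0 \<le> \<phi> x" "\<And>x. 0 \<le> \<psi> x" for \<phi> \<psi>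
  proof -
    note [measurable] = bdd_measurableD[OF b(1)] bdd_measurableD[OF b(2)]
      bdd_measurableD[OF bdd_borel_semigroup[OF b(2) r(3)]]
    have S: "0 \<le> semigroup_op K t \<psi> x" for x
      unfolding semigroup_op_def using nn by (intro integral_nonneg_AE) auto
    have inner: "(\<integral>\<^sup>+y. ennreal (\<psi> y) \<partial>K t x) = ennreal (semigroup_op K t \<psi> x)" for x
      unfolding semigroup_op_def using nn r b(2) by (intro nn_integral_eq_integral integrable_K) auto
    have "(\<integral>w. \<phi> (X r w) * \<psi> (X (s + t) w) \<partial>M) = enn2real (\<integral>\<^sup>+w. ennreal (\<phi> (X r w) * \<psi> (X (s + t) w)) \<partial>M)"
      using nn by (intro integral_eq_nn_integral) auto
    also have "(\<integral>\<^sup>+w. ennreal (\<phi> (X r w) * \<psi> (X (s + t) w)) \<partial>M)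
        = (\<integral>\<^sup>+w. ennreal (\<phi> (X r w) * semigroup_op K t \<psi> (X s w)) \<partial>M)"
      using markov_nn_integral[OF r, of "\<lambda>x. ennreal (\<phi> x)" "\<lambda>x. ennreal (\<psi> x)"]
      by (simp add: inner ennreal_mult nn S)
    also have "enn2real \<dots> = (\<integral>w. \<phi> (X r w) * semigroup_op K t \<psi> (X s w) \<partial>M)"
      using nn S by (intro integral_eq_nn_integral[symmetric]) auto
    finally show ?thesis .
  qed
  obtain c d where c: "0 \<le> c" "\<And>x. \<bar>\<phi> x\<bar> \<le> c" and d: "0 \<le> d" "\<And>x. \<bar>\<psi> x\<bar> \<le> d"
    using b by (metis bdd_measurableE)
  let ?a = "\<lambda>x. \<phi> x + c" and ?b = "\<lambda>x. \<psi> x + d"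
  have B: "bdd_borel ?a" "bdd_borel ?b" "bdd_borel (semigroup_op K t \<psi>)"
    using b r by auto
  have nn: "0 \<le> ?a x" "0 \<le> ?b x" for x
    using c(2)[of x] d(2)[of x] by auto
  have shift: "semigroup_op K t ?b x = semigroup_op K t \<psi> x + d" for x
    using b r prob_space.prob_space[OF K_prob[OF r(3)]]
    by (simp add: semigroup_op_def integrable_K prob_space.finite_measure[OF K_prob] finite_measure.integrable_const)
  have expand: "(\<integral>w. \<phi> (X r w) * h (X u w) \<partial>M) = (\<integral>w. ?a (X r w) * (h (X u w) + d) \<partial>M)
      - d * (\<integral>w. ?a (X r w) \<partial>M) - c * (\<integral>w. h (X u w) + d \<partial>M) + c * d"
    if h: "bdd_borel h" "0 \<le> u" for h u
  proof -
    have i: "integrable M (\<lambda>w. \<phi> (X r w))" "integrable M (\<lambda>w. h (X u w))" "integrable M (\<lambda>w. \<phi> (X r w) * h (X u w))"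
      using b h r by (auto intro!: integrable_rv)
    have 1: "(\<integral>w. ?a (X r w) * (h (X u w) + d) \<partial>M) = (\<integral>w. \<phi> (X r w) * h (X u w) \<partial>M)
        + d * (\<integral>w. \<phi> (X r w) \<partial>M) + c * (\<integral>w. h (X u w) \<partial>M) + c * d"
      using i prob_space by (simp add: algebra_simps)
    have 2: "(\<integral>w. ?a (X r w) \<partial>M) = (\<integral>w. \<phi> (X r w) \<partial>M) + c"
      "(\<integral>w. h (X u w) + d \<partial>M) = (\<integral>w. h (X u w) \<partial>M) + d"
      using i prob_space by simp_all
    show ?thesis unfolding 1 2 by (simp add: algebra_simps)
  qed
  show ?thesis
    using pos[OF B(1,2) nn] pos[OF bdd_measurable_const[of _ 1] B(2) _ nn(2)] shift
    by (simp add: expand[OF b(2) s(2)] expand[OF B(3) s(1)])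
qed

text \<open>\<open>G\<close> is a bounded Borel version of the conditional expectation of
  \<open>W\<close> given \<open>X s\<close>, as a function of the state. It arises from a
  Radon-Nikodym derivative after adding \<open>c\<close>, which puts the density
  \<open>W w + c\<close> between \<open>0\<close> and \<open>2 * c\<close>.\<close>

lemma regression:
  assumes W: "bdd_measurable M W" and s: "0 \<le> s"
  shows "\<exists>G. bdd_borel G \<and> (\<forall>\<psi>. bdd_borel \<psi> \<longrightarrow> (\<integral>w. \<psi> (X s w) * W w \<partial>M) = (\<integral>x. \<psi> x * G x \<partial>\<mu>))"
proof -
  note [measurable] = X_measurable[OF s] bdd_measurableD[OF W]
  obtain c where c: "0 \<le> c" "\<And>w. \<bar>W w\<bar> \<le> c" using bdd_measurableE[OF W] by metis
  have Wc: "0 \<le> W w + c" "W w + c \<le> 2 * c" for w using c(2)[of w] by auto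
  define N where "N = distr (density M (\<lambda>w. ennreal (W w + c))) borel (X s)"
  have [measurable_cong]: "sets N = sets borel" by (simp add: N_def)
  have N_le: "emeasure N A \<le> ennreal (2 * c) * emeasure \<mu> A" if [measurable]: "A \<in> sets borel" for A
  proof -
    have "emeasure N A = (\<integral>\<^sup>+w. ennreal (W w + c) * indicator A (X s w) \<partial>M)"
      unfolding N_def by (simp add: emeasure_distr emeasure_density)
        (auto intro!: nn_integral_cong simp: indicator_def)
    also have "\<dots> \<le> (\<integral>\<^sup>+w. ennreal (2 * c) * indicator A (X s w) \<partial>M)"
      using Wc by (intro nn_integral_mono mult_right_mono ennreal_leI) auto
    also have "\<dots> = ennreal (2 * c) * (\<integral>\<^sup>+x. indicator A x \<partial>\<mu>)"
      by (simp add: nn_integral_cmult distr_X[OF s, symmetric] nn_integral_distr del: nn_integral_indicator)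
    finally show ?thesis by simp
  qed
  have ac: "absolutely_continuous \<mu> N"
    unfolding absolutely_continuous_def
  proof
    fix A assume A: "A \<in> null_sets \<mu>"
    then have "emeasure N A = 0" using N_le[of A] by (auto simp: null_sets_def)
    then show "A \<in> null_sets N" using A by (auto simp: null_sets_def N_def)
  qed
  define H where "H = RN_deriv \<mu> N"
  have [measurable]: "H \<in> borel_measurable borel"
    using borel_measurable_RN_deriv[of \<mu> N] by (simp add: H_def cong: measurable_cong_sets)
  have NH: "density \<mu> H = N"
    unfolding H_def using ac by (intro mu.density_RN_deriv) (simp_all add: N_def)
  \<comment> \<open>On the set \<open>A\<close> the derivative exceeds \<open>2 * c\<close>, while
    \<open>N\<close> gives it at most \<open>2 * c\<close> times its \<open>\<mu>\<close>-mass; so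
    the excess integrates to \<open>0\<close>.\<close>
  have H_le: "AE x in \<mu>. H x \<le> ennreal (2 * c)"
  proof -
    define A where "A = {x. ennreal (2 * c) < H x}"
    have [measurable]: "A \<in> sets borel" unfolding A_def by measurable
    have fin: "(\<integral>\<^sup>+x. ennreal (2 * c) * indicator A x \<partial>\<mu>) \<noteq> \<infinity>"
      by (simp add: nn_integral_cmult_indicator mu.emeasure_eq_measure ennreal_mult_eq_top_iff)
    have "(\<integral>\<^sup>+x. H x * indicator A x - ennreal (2 * c) * indicator A x \<partial>\<mu>)
        = (\<integral>\<^sup>+x. H x * indicator A x \<partial>\<mu>) - (\<integral>\<^sup>+x. ennreal (2 * c) * indicator A x \<partial>\<mu>)"
      using fin by (intro nn_integral_diff) (auto simp: A_def indicator_def)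
    moreover have le: "(\<integral>\<^sup>+x. H x * indicator A x \<partial>\<mu>) \<le> (\<integral>\<^sup>+x. ennreal (2 * c) * indicator A x \<partial>\<mu>)"
      using N_le[of A] by (simp add: NH[symmetric] emeasure_density nn_integral_cmult_indicator)
    have "(\<integral>\<^sup>+x. H x * indicator A x \<partial>\<mu>) - (\<integral>\<^sup>+x. ennreal (2 * c) * indicator A x \<partial>\<mu>) = 0"
      using fin by (intro diff_eq_0_ennreal[OF le_less_trans[OF le] le]) (simp add: less_top)
    ultimately have "AE x in \<mu>. H x * indicator A x - ennreal (2 * c) * indicator A x = 0"
      by (simp add: nn_integral_0_iff_AE)
    then show ?thesis
    proof (rule AE_mp, intro AE_I2 impI)
      fix x assume "H x * indicator A x - ennreal (2 * c) * indicator A x = 0"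
      then show "H x \<le> ennreal (2 * c)"
        by (cases "x \<in> A") (auto simp: A_def ennreal_minus_eq_0 not_less)
    qed
  qed
  \<comment> \<open>The truncation alters the derivative on a null set only, and provides the bound
    at every point that \<open>bdd_borel\<close> demands.\<close>
  define G where "G x = min (2 * c) (enn2real (H x)) - c" for x
  have G: "bdd_borel G"
    unfolding bdd_measurable_def
  proof (intro conjI exI allI)
    show "G \<in> borel_measurable borel" unfolding G_def by measurable
    have "\<bar>min (2 * c) h - c\<bar> \<le> c" if "0 \<le> h" for h using c(1) that by (auto simp: min_def)
    then show "\<bar>G x\<bar> \<le> c" for x by (simp add: G_def)
  qed
  note [measurable] = bdd_measurableD[OF G]
  have Gc: "0 \<le> G x + c" for x using c(1) by (simp add: G_def)
  have NG: "density \<mu> (\<lambda>x. ennreal (G x + c)) = N"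
    unfolding NH[symmetric]
  proof (rule density_cong)
    show "AE x in \<mu>. ennreal (G x + c) = H x"
      using H_le
    proof (rule AE_mp, intro AE_I2 impI)
      fix x assume le: "H x \<le> ennreal (2 * c)"
      then have "H x < \<top>" by (rule le_less_trans) simp
      then obtain h where h: "H x = ennreal h" "0 \<le> h" by (cases "H x") auto
      then have "h \<le> 2 * c" using le c(1) by simp
      then show "ennreal (G x + c) = H x" using h by (simp add: G_def)
    qed
  qed measurable
  have "(\<integral>w. \<psi> (X s w) * W w \<partial>M) = (\<integral>x. \<psi> x * G x \<partial>\<mu>)" if \<psi>: "bdd_borel \<psi>" for \<psi>
  proof -
    note [measurable] = bdd_measurableD[OF \<psi>]
    have "(\<integral>w. (W w + c) * \<psi> (X s w) \<partial>M) = (\<integral>x. \<psi> x \<partial>N)"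
      unfolding N_def using Wc by (simp add: integral_distr integral_density)
    also have "\<dots> = (\<integral>x. (G x + c) * \<psi> x \<partial>\<mu>)"
      unfolding NG[symmetric] using Gc by (simp add: integral_density)
    also have "\<dots> = (\<integral>x. \<psi> x * G x \<partial>\<mu>) + c * (\<integral>x. \<psi> x \<partial>\<mu>)"
    proof -
      have "integrable \<mu> (\<lambda>x. \<psi> x * G x)" "integrable \<mu> \<psi>"
        using \<psi> G by (auto intro!: integrable_mu)
      then show ?thesis by (simp add: algebra_simps)
    qed
    also have "(\<integral>w. (W w + c) * \<psi> (X s w) \<partial>M) = (\<integral>w. \<psi> (X s w) * W w \<partial>M) + c * (\<integral>x. \<psi> x \<partial>\<mu>)"
    proof -
      have "integrable M (\<lambda>w. \<psi> (X s w) * W w)" "integrable M (\<lambda>w. \<psi> (X s w))"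
        using \<psi> W s by (auto intro!: integrable_rv)
      then show ?thesis by (simp add: algebra_simps integral_X[OF s])
    qed
    finally show ?thesis by simp
  qed
  with G show ?thesis by blast
qed

end

section \<open>Integrals over bounded time intervals\<close>

definition clock :: "real \<Rightarrow> real measure" where
  "clock t = density lborel (indicator {0..<t})"

lemma sets_clock [measurable_cong, simp]: "sets (clock t) = sets borel"
  and space_clock [simp]: "space (clock t) = UNIV"
  by (simp_all add: clock_def)

lemma emeasure_clock: "0 \<le> t \<Longrightarrow> emeasure (clock t) UNIV = ennreal t"
  by (simp add: clock_def emeasure_density)

lemma finite_clock: "finite_measure (clock t)"
proof
  show "emeasure (clock t) (space (clock t)) \<noteq> \<infinity>"
    by (cases "0 \<le> t") (auto simp: emeasure_clock, simp add: clock_def emeasure_density)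
qed

lemma measure_clock: "0 \<le> t \<Longrightarrow> measure (clock t) UNIV = t"
  by (simp add: measure_def emeasure_clock)

lemma AE_clock: "AE r in clock t. 0 \<le> r \<and> r < t"
  unfolding clock_def by (subst AE_density) (auto simp: indicator_def)

lemma integral_clock:
  fixes a :: "real \<Rightarrow> real"
  assumes [measurable]: "a \<in> borel_measurable borel"
  shows "(\<integral>r. a r \<partial>clock t) = (\<integral>r. indicator {0..<t} r * a r \<partial>lborel)"
  unfolding clock_def
  using integral_density[of a lborel "indicator {0..<t}"] by (simp add: ennreal_indicator)

lemma integrable_clock: "bdd_borel a \<Longrightarrow> integrable (clock t) a"
  by (rule integrable_bdd_measurable[OF _ finite_clock]) (simp cong: bdd_measurable_cong_sets)

lemma integrable_lborel_clock:
  fixes a :: "real \<Rightarrow> real"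
  assumes "bdd_borel a"
  shows "integrable lborel (\<lambda>r. indicator {0..<t} r * a r)"
  using integrable_clock[OF assms, of t] bdd_measurableD[OF assms] unfolding clock_def
  using integrable_density[of a lborel "indicator {0..<t}"] by (simp add: ennreal_indicator)

lemma bdd_borel_shift: "bdd_borel a \<Longrightarrow> bdd_borel (\<lambda>r::real. a (h + r))"
  by (rule bdd_measurable_compose) auto

text \<open>Moving the window \<open>[0, t)\<close> by \<open>h\<close> gains
  \<open>[t, t + h)\<close> and loses \<open>[0, h)\<close>; as an identity between indicators this
  is independent of the order of \<open>t\<close> and \<open>h\<close>. It turns a difference over
  the long window into integrals over the short one, from which the difference quotient of the
  generator is read off.\<close>

lemma integral_clock_shift:
  fixes a :: "real \<Rightarrow> real"
  assumes a: "bdd_borel a" and "0 \<le> t" "0 \<le> h"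
  shows "(\<integral>r. a (h + r) \<partial>clock t) - (\<integral>r. a r \<partial>clock t) = (\<integral>r. a (t + r) \<partial>clock h) - (\<integral>r. a r \<partial>clock h)"
proof -
  note [measurable] = bdd_measurableD[OF a]
  have shift: "(\<integral>r. a (u + r) \<partial>clock v) = (\<integral>r. indicator {u..<u + v} r * a r \<partial>lborel)" for u v
    by (subst integral_clock, simp, subst (2) lborel_integral_real_affine[where c=1 and t=u])
      (auto intro!: Bochner_Integration.integral_cong simp: indicator_def)
  have int: "integrable lborel (\<lambda>r. indicator {u..<u + v} r * a r)" for u v
  proof -
    have "integrable lborel (\<lambda>r. indicator {0..<v} (-u + 1 * r) * a (u + (-u + 1 * r)))"
      using integrable_lborel_clock[OF bdd_borel_shift[OF a, of u], of v]
      by (rule lborel_integrable_real_affine) simp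
    then show ?thesis
      by (rule Bochner_Integration.integrable_cong[THEN iffD1, rotated -1]) (auto simp: indicator_def)
  qed
  have "(\<integral>r. indicator {h..<h + t} r * a r \<partial>lborel) - (\<integral>r. indicator {0..<0 + t} r * a r \<partial>lborel)
      = (\<integral>r. indicator {h..<h + t} r * a r - indicator {0..<0 + t} r * a r \<partial>lborel)"
    by (intro Bochner_Integration.integral_diff[symmetric] int)
  also have "\<dots> = (\<integral>r. indicator {t..<t + h} r * a r - indicator {0..<0 + h} r * a r \<partial>lborel)"
    using assms(2,3) by (intro Bochner_Integration.integral_cong) (auto simp: indicator_def)
  also have "\<dots> = (\<integral>r. indicator {t..<t + h} r * a r \<partial>lborel) - (\<integral>r. indicator {0..<0 + h} r * a r \<partial>lborel)"
    by (intro Bochner_Integration.integral_diff int)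
  also have "(\<integral>r. indicator {0..<0 + t} r * a r \<partial>lborel) = (\<integral>r. a r \<partial>clock t)"
    using shift[where u=0 and v=t] by simp
  also have "(\<integral>r. indicator {0..<0 + h} r * a r \<partial>lborel) = (\<integral>r. a r \<partial>clock h)"
    using shift[where u=0 and v=h] by simp
  finally show ?thesis unfolding shift .
qed

text \<open>Times after and before \<open>s\<close> are both expressed through the lag. Reflection
  maps \<open>[0, s)\<close> to \<open>(0, s]\<close>, so the endpoints \<open>0\<close> and
  \<open>s\<close> are discarded as null.\<close>

lemma integral_clock_abs:
  fixes a :: "real \<Rightarrow> real"
  assumes a: "bdd_borel a" and s: "0 \<le> s" "s \<le> t"
  shows "(\<integral>r. a \<bar>r - s\<bar> \<partial>clock t) = (\<integral>r. a r \<partial>clock (t - s)) + (\<integral>r. a r \<partial>clock s)"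
proof -
  note [measurable] = bdd_measurableD[OF a]
  have a': "bdd_borel (\<lambda>r. a \<bar>r - s\<bar>)" by (rule bdd_measurable_compose[OF a]) measurable
  have 1: "(\<integral>r. a r \<partial>clock (t - s)) = (\<integral>r. indicator {s..<t} r * a (r - s) \<partial>lborel)"
    by (subst integral_clock, simp, subst (2) lborel_integral_real_affine[where c=1 and t=s])
      (auto intro!: Bochner_Integration.integral_cong simp: indicator_def)
  have 2: "(\<integral>r. a r \<partial>clock s) = (\<integral>r. indicator {0<..s} r * a (s - r) \<partial>lborel)"
    by (subst integral_clock, simp, subst (2) lborel_integral_real_affine[where c="-1" and t=s])
      (auto intro!: Bochner_Integration.integral_cong simp: indicator_def)
  have 3: "(\<integral>r. indicator {0<..s} r * a (s - r) \<partial>lborel) = (\<integral>r. indicator {0..<s} r * a \<bar>r - s\<bar> \<partial>lborel)"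
  proof (intro integral_cong_AE)
    have "AE r in lborel. r \<noteq> 0 \<and> r \<noteq> s" using AE_lborel_singleton[of 0] AE_lborel_singleton[of s] by auto
    then show "AE r in lborel. indicator {0<..s} r * a (s - r) = indicator {0..<s} r * a \<bar>r - s\<bar>"
      by (rule AE_mp) (auto simp: indicator_def abs_minus_commute)
  qed measurable
  have 4: "(\<integral>r. indicator {s..<t} r * a (r - s) \<partial>lborel) = (\<integral>r. indicator {s..<t} r * a \<bar>r - s\<bar> \<partial>lborel)"
    by (intro Bochner_Integration.integral_cong) (auto simp: indicator_def)
  have int: "integrable lborel (\<lambda>r. indicator {u..<v} r * a \<bar>r - s\<bar>)" if "0 \<le> u" "v \<le> t" for u v
  proof (rule Bochner_Integration.integrable_bound)
    show "integrable lborel (\<lambda>r. indicator {0..<t} r * a \<bar>r - s\<bar>)" by (rule integrable_lborel_clock[OF a'])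
    show "AE r in lborel. norm (indicator {u..<v} r * a \<bar>r - s\<bar>) \<le> norm (indicator {0..<t} r * a \<bar>r - s\<bar>)"
      using that by (auto simp: indicator_def)
  qed measurable
  have "(\<integral>r. a \<bar>r - s\<bar> \<partial>clock t) = (\<integral>r. indicator {s..<t} r * a \<bar>r - s\<bar> + indicator {0..<s} r * a \<bar>r - s\<bar> \<partial>lborel)"
    using s by (subst integral_clock) (auto intro!: Bochner_Integration.integral_cong simp: indicator_def)
  also have "\<dots> = (\<integral>r. indicator {s..<t} r * a \<bar>r - s\<bar> \<partial>lborel) + (\<integral>r. indicator {0..<s} r * a \<bar>r - s\<bar> \<partial>lborel)"
    using s by (intro Bochner_Integration.integral_add int) auto
  finally show ?thesis unfolding 1 2 3 4 .
qed

context stationary_markov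
begin

lemma clock_Fubini:
  assumes "bdd_measurable (borel \<Otimes>\<^sub>M M) (\<lambda>z. F (fst z) (snd z))"
  shows "(\<integral>w. (\<integral>r. F r w \<partial>clock t) \<partial>M) = (\<integral>r. (\<integral>w. F r w \<partial>M) \<partial>clock t)"
    and "bdd_measurable M (\<lambda>w. \<integral>r. F r w \<partial>clock t)"
    and "bdd_borel (\<lambda>r. \<integral>w. F r w \<partial>M)"
proof -
  interpret C: finite_measure "clock t" by (rule finite_clock)
  interpret P: pair_sigma_finite "clock t" M ..
  note [measurable] = bdd_measurableD[OF assms]
  obtain c where c: "0 \<le> c" "\<And>z. \<bar>F (fst z) (snd z)\<bar> \<le> c" using bdd_measurableE[OF assms] by metis
  have c': "\<bar>F r w\<bar> \<le> c" for r w using c(2)[of "(r, w)"] by simp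
  have "integrable (clock t \<Otimes>\<^sub>M M) (\<lambda>z. F (fst z) (snd z))"
    using assms finite_measure_pair_measure[OF finite_measure_axioms finite_clock]
    by (intro integrable_bdd_measurable) (auto cong: bdd_measurable_cong_sets sets_pair_measure_cong)
  then show "(\<integral>w. (\<integral>r. F r w \<partial>clock t) \<partial>M) = (\<integral>r. (\<integral>w. F r w \<partial>M) \<partial>clock t)"
    using P.Fubini_integral[of F] by (simp add: case_prod_unfold)
  \<comment> \<open>\<open>bdd_measurable\<close> asks for a bound at all points, including
    \<open>w\<close> outside \<open>space M\<close>, where the section of \<open>F\<close> may fail
    to be measurable. There the integral has the default value \<open>0\<close>, which respects the
    bound as well.\<close>
  have bnd: "\<bar>\<integral>x. g x \<partial>N\<bar> \<le> c * measure N (space N)"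
    if "finite_measure N" and g: "\<And>x. \<bar>g x\<bar> \<le> c" for N :: "'c measure" and g
  proof (cases "integrable N g")
    case True
    interpret N: finite_measure N by fact
    have "\<bar>\<integral>x. g x \<partial>N\<bar> \<le> (\<integral>x. \<bar>g x\<bar> \<partial>N)" by (rule integral_abs_bound)
    also have "\<dots> \<le> (\<integral>x. c \<partial>N)"
      using g True by (intro integral_mono integrable_abs) auto
    finally show ?thesis by (simp add: mult.commute)
  qed (use c(1) in \<open>simp add: not_integrable_integral_eq\<close>)
  have [measurable]: "(\<lambda>(w, r). F r w) \<in> borel_measurable (M \<Otimes>\<^sub>M borel)" "(\<lambda>(r, w). F r w) \<in> borel_measurable (borel \<Otimes>\<^sub>M M)"
    using measurable_pair_swap[of "\<lambda>z. F (fst z) (snd z)" borel M borel] bdd_measurableD[OF assms]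
    by (simp_all add: case_prod_unfold)
  show "bdd_measurable M (\<lambda>w. \<integral>r. F r w \<partial>clock t)"
    unfolding bdd_measurable_def
    using bnd[OF finite_clock c'] by (intro conjI exI allI) measurable
  show "bdd_borel (\<lambda>r. \<integral>w. F r w \<partial>M)"
    unfolding bdd_measurable_def
    using bnd[OF finite_measure_axioms c'] by (intro conjI exI allI) measurable
qed

lemma bounded_traj_pair [intro]:
  "bdd_borel f \<Longrightarrow> bdd_measurable (borel \<Otimes>\<^sub>M M) (\<lambda>z. f (traj (h + fst z) (snd z)))"
  by (erule bdd_measurable_compose) measurable

lemma bounded_traj_pair_0 [intro]:
  "bdd_borel f \<Longrightarrow> bdd_measurable (borel \<Otimes>\<^sub>M M) (\<lambda>z. f (traj (fst z) (snd z)))"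
  by (erule bdd_measurable_compose) measurable

lemma bounded_rv_pair [intro]:
  "bdd_measurable M W \<Longrightarrow> bdd_measurable (borel \<Otimes>\<^sub>M M) (\<lambda>z. W (snd z))"
  by (erule bdd_measurable_compose) measurable

lemma correlation_Fubini:
  assumes "bdd_borel f" "bdd_measurable M W"
  shows "(\<integral>w. W w * (\<integral>r. f (traj (h + r) w) \<partial>clock t) \<partial>M) = (\<integral>r. (\<integral>w. W w * f (traj (h + r) w) \<partial>M) \<partial>clock t)"
    and "bdd_borel (\<lambda>r. \<integral>w. W w * f (traj (h + r) w) \<partial>M)"
proof -
  have "bdd_measurable (borel \<Otimes>\<^sub>M M) (\<lambda>z. W (snd z) * f (traj (h + fst z) (snd z)))"
    using assms by (intro bdd_measurable_mult bounded_rv_pair bounded_traj_pair)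
  from clock_Fubini(1,3)[where F="\<lambda>r w. W w * f (traj (h + r) w)", OF this]
  show "(\<integral>w. W w * (\<integral>r. f (traj (h + r) w) \<partial>clock t) \<partial>M) = (\<integral>r. (\<integral>w. W w * f (traj (h + r) w) \<partial>M) \<partial>clock t)"
    and "bdd_borel (\<lambda>r. \<integral>w. W w * f (traj (h + r) w) \<partial>M)" by simp_all
qed

text \<open>\<open>G\<close> represents \<open>\<integral>\<^sub>0\<^sup>t P\<^sub>r f dr\<close>. It comes from a Radon-Nikodym derivative because \<open>K\<close> need not be
  measurable in time; to move it from time \<open>0\<close> to time \<open>h\<close>, the test function is projected to time \<open>h\<close>.\<close>
lemma occupation_density:
  assumes f: "bdd_borel f" and t: "0 \<le> t"
  shows "\<exists>G. bdd_borel G \<and> (\<forall>\<phi> h. bdd_borel \<phi> \<longrightarrow> 0 \<le> h \<longrightarrow>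
    (\<integral>w. \<phi> (X 0 w) * G (X h w) \<partial>M) = (\<integral>r. (\<integral>w. \<phi> (X 0 w) * f (traj (h + r) w) \<partial>M) \<partial>clock t))"
proof -
  have "bdd_measurable M (\<lambda>w. \<integral>r. f (traj r w) \<partial>clock t)"
    using f by (intro clock_Fubini(2)) auto
  from regression[OF this, of 0] obtain G where G: "bdd_borel G"
    and GI: "\<And>\<psi>. bdd_borel \<psi> \<Longrightarrow> (\<integral>w. \<psi> (X 0 w) * (\<integral>r. f (traj r w) \<partial>clock t) \<partial>M) = (\<integral>x. \<psi> x * G x \<partial>\<mu>)"
    by auto
  have "(\<integral>w. \<phi> (X 0 w) * G (X h w) \<partial>M) = (\<integral>r. (\<integral>w. \<phi> (X 0 w) * f (traj (h + r) w) \<partial>M) \<partial>clock t)"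
    if \<phi>: "bdd_borel \<phi>" and h: "0 \<le> h" for \<phi> h
  proof -
    \<comment> \<open>\<open>\<phi>'\<close> acts as the adjoint of the time-\<open>h\<close>
      operator applied to \<open>\<phi>\<close>: pairing with it under \<open>\<mu>\<close> equals
      pairing at time \<open>h\<close> with \<open>\<phi> (X 0 w)\<close>.\<close>
    from regression[OF bounded_rv_X[OF \<phi> order_refl] h] obtain \<phi>' where \<phi>': "bdd_borel \<phi>'"
      and I: "\<And>\<psi>. bdd_borel \<psi> \<Longrightarrow> (\<integral>w. \<psi> (X h w) * \<phi> (X 0 w) \<partial>M) = (\<integral>x. \<psi> x * \<phi>' x \<partial>\<mu>)" by auto
    have "(\<integral>w. \<phi> (X 0 w) * G (X h w) \<partial>M) = (\<integral>x. \<phi>' x * G x \<partial>\<mu>)"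
      using I[OF G] by (simp add: mult.commute)
    also have "\<dots> = (\<integral>w. \<phi>' (X 0 w) * (\<integral>r. f (traj r w) \<partial>clock t) \<partial>M)"
      using GI[OF \<phi>'] by simp
    also have "\<dots> = (\<integral>r. (\<integral>w. \<phi>' (X 0 w) * f (traj r w) \<partial>M) \<partial>clock t)"
      using correlation_Fubini(1)[OF f bounded_rv_X[OF \<phi>' order_refl], where h=0 and t=t] by simp
    also have "\<dots> = (\<integral>r. (\<integral>w. \<phi> (X 0 w) * f (traj (h + r) w) \<partial>M) \<partial>clock t)"
    proof (intro integral_cong_AE)
      show "AE r in clock t. (\<integral>w. \<phi>' (X 0 w) * f (traj r w) \<partial>M) = (\<integral>w. \<phi> (X 0 w) * f (traj (h + r) w) \<partial>M)"
      proof (rule AE_mp[OF AE_clock], intro AE_I2 impI)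
        fix r assume "0 \<le> r \<and> r < t"
        then have r: "0 \<le> r" by simp
        have "(\<integral>w. \<phi>' (X 0 w) * f (traj r w) \<partial>M) = (\<integral>w. \<phi>' (X 0 w) * semigroup_op K r f (X 0 w) \<partial>M)"
          using markov_integral[of 0 0 r, OF _ _ r \<phi>' f] r by (simp add: traj_eq)
        also have "\<dots> = (\<integral>x. semigroup_op K r f x * \<phi>' x \<partial>\<mu>)"
          using integral_X[of 0 "\<lambda>x. semigroup_op K r f x * \<phi>' x"] \<phi>' f r
          by (auto simp: mult.commute intro!: bdd_measurableD)
        also have "\<dots> = (\<integral>w. semigroup_op K r f (X h w) * \<phi> (X 0 w) \<partial>M)"
          using I[OF bdd_borel_semigroup[OF f r]] by simp
        also have "\<dots> = (\<integral>w. \<phi> (X 0 w) * f (traj (h + r) w) \<partial>M)"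
          using markov_integral[of 0 h r, OF _ h r \<phi> f] h r by (simp add: traj_eq mult.commute)
        finally show "(\<integral>w. \<phi>' (X 0 w) * f (traj r w) \<partial>M) = (\<integral>w. \<phi> (X 0 w) * f (traj (h + r) w) \<partial>M)" .
      qed
      show "(\<lambda>r. \<integral>w. \<phi>' (X 0 w) * f (traj r w) \<partial>M) \<in> borel_measurable (clock t)"
        using bdd_measurableD[OF correlation_Fubini(2)[OF f bounded_rv_X[OF \<phi>' order_refl], of 0]] by simp
      show "(\<lambda>r. \<integral>w. \<phi> (X 0 w) * f (traj (h + r) w) \<partial>M) \<in> borel_measurable (clock t)"
        using bdd_measurableD[OF correlation_Fubini(2)[OF f bounded_rv_X[OF \<phi> order_refl], of h]] by simp
    qed
    finally show ?thesis .
  qed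
  then show ?thesis using G by blast
qed

text \<open>Expanding the square leaves the second moment of \<open>f\<close> and the correlation of
  \<open>f\<close> with \<open>semigroup_op K r f\<close> under \<open>\<mu>\<close>; neither
  involves \<open>s\<close>.\<close>

lemma stationary_increment:
  assumes f: "bdd_borel f" and s: "0 \<le> s" "0 \<le> r"
  shows "(\<integral>w. (f (X (s + r) w) - f (X s w))\<^sup>2 \<partial>M) = (\<integral>w. (f (X r w) - f (X 0 w))\<^sup>2 \<partial>M)"
proof -
  have *: "(\<integral>w. (f (X (s + r) w) - f (X s w))\<^sup>2 \<partial>M) = 2 * (\<integral>x. (f x)\<^sup>2 \<partial>\<mu>) - 2 * (\<integral>x. f x * semigroup_op K r f x \<partial>\<mu>)"
    if s: "0 \<le> s" for s
  proof -
    have i: "integrable M (\<lambda>w. (f (X (s + r) w))\<^sup>2)" "integrable M (\<lambda>w. (f (X s w))\<^sup>2)"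
      "integrable M (\<lambda>w. f (X s w) * f (X (s + r) w))"
      using f s assms(3) by (intro integrable_rv bdd_measurable_mult bdd_measurable_power2 bounded_rv_X; simp)+
    have "(\<integral>w. (f (X (s + r) w) - f (X s w))\<^sup>2 \<partial>M)
        = (\<integral>w. (f (X (s + r) w))\<^sup>2 + (f (X s w))\<^sup>2 - 2 * (f (X s w) * f (X (s + r) w)) \<partial>M)"
      by (intro Bochner_Integration.integral_cong) (simp_all add: power2_diff mult_ac)
    also have "\<dots> = (\<integral>w. (f (X (s + r) w))\<^sup>2 \<partial>M) + (\<integral>w. (f (X s w))\<^sup>2 \<partial>M) - 2 * (\<integral>w. f (X s w) * f (X (s + r) w) \<partial>M)"
      using i by simp
    also have "(\<integral>w. f (X s w) * f (X (s + r) w) \<partial>M) = (\<integral>w. f (X s w) * semigroup_op K r f (X s w) \<partial>M)"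
      using markov_integral[OF s order_refl assms(3) f f] .
    also have "\<dots> = (\<integral>x. f x * semigroup_op K r f x \<partial>\<mu>)"
      using f assms(3) by (intro integral_X[OF s] bdd_measurableD) auto
    also have "(\<integral>w. (f (X (s + r) w))\<^sup>2 \<partial>M) = (\<integral>x. (f x)\<^sup>2 \<partial>\<mu>)"
      using f s assms(3) by (intro integral_X bdd_measurableD) auto
    also have "(\<integral>w. (f (X s w))\<^sup>2 \<partial>M) = (\<integral>x. (f x)\<^sup>2 \<partial>\<mu>)"
      using f s by (intro integral_X bdd_measurableD) auto
    finally show ?thesis by simp
  qed
  show ?thesis using *[OF s(1)] *[of 0] by simp
qed

text \<open>By stationarity the increment may be averaged over the starting time in [0,1], where only
  measurability of the paths is needed.\<close>
lemma increment_tendsto_0: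
  assumes f: "bdd_borel f"
  shows "((\<lambda>r. \<integral>w. (f (X r w) - f (X 0 w))\<^sup>2 \<partial>M) \<longlongrightarrow> 0) (at_right 0)"
proof (rule tendsto_at_right_sequentially[of 0 1])
  fix S :: "nat \<Rightarrow> real" assume S: "\<And>n. 0 < S n" "\<And>n. S n < 1" "S \<longlonglongrightarrow> 0"
  obtain c where c: "0 \<le> c" "\<And>x. \<bar>f x\<bar> \<le> c" using bdd_measurableE[OF f] by metis
  note [measurable] = bdd_measurableD[OF f]
  define D where "D n w = (\<integral>s. (f (traj (s + S n) w) - f (traj s w))\<^sup>2 \<partial>clock 1)" for n w
  have sq: "(f a - f b)\<^sup>2 \<le> (2 * c)\<^sup>2" for a b
    using c(2)[of a] c(2)[of b] c(1) by (intro power2_le_iff_abs_le[THEN iffD2]) linarith+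
  have pair: "bdd_measurable (borel \<Otimes>\<^sub>M M) (\<lambda>z. (f (traj (fst z + S n) (snd z)) - f (traj (fst z) (snd z)))\<^sup>2)" for n
    using bounded_traj_pair[OF f, of "S n"] bounded_traj_pair_0[OF f]
    by (intro bdd_measurable_power2 bdd_measurable_diff) (simp_all add: add.commute)
  have D: "bdd_measurable M (D n)" for n
    unfolding D_def[abs_def] by (rule clock_Fubini(2)) (rule pair)
  have traj_meas: "(\<lambda>s. f (traj s w)) \<in> borel_measurable borel" if "w \<in> space M" for w
    using that by measurable
  have "(\<integral>w. (f (X (S n) w) - f (X 0 w))\<^sup>2 \<partial>M) = (\<integral>w. D n w \<partial>M)" for n
  proof -
    have "(\<integral>w. D n w \<partial>M) = (\<integral>s. (\<integral>w. (f (traj (s + S n) w) - f (traj s w))\<^sup>2 \<partial>M) \<partial>clock 1)"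
      unfolding D_def by (rule clock_Fubini(1)) (rule pair)
    also have "\<dots> = (\<integral>s. (\<integral>w. (f (X (S n) w) - f (X 0 w))\<^sup>2 \<partial>M) \<partial>clock 1)"
    proof (intro integral_cong_AE)
      show "AE s in clock 1. (\<integral>w. (f (traj (s + S n) w) - f (traj s w))\<^sup>2 \<partial>M) = (\<integral>w. (f (X (S n) w) - f (X 0 w))\<^sup>2 \<partial>M)"
        using AE_clock by (rule AE_mp) (use S(1)[of n] stationary_increment[OF f] in \<open>auto simp: traj_eq less_imp_le\<close>)
      show "(\<lambda>s. \<integral>w. (f (traj (s + S n) w) - f (traj s w))\<^sup>2 \<partial>M) \<in> borel_measurable (clock 1)"
        using bdd_measurableD[OF clock_Fubini(3)[where F="\<lambda>s w. (f (traj (s + S n) w) - f (traj s w))\<^sup>2", OF pair]] by simp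
    qed simp
    also have "\<dots> = (\<integral>w. (f (X (S n) w) - f (X 0 w))\<^sup>2 \<partial>M)"
      by (simp add: measure_clock)
    finally show ?thesis ..
  qed
  moreover have "(\<lambda>n. \<integral>w. D n w \<partial>M) \<longlonglongrightarrow> (\<integral>w. 0 \<partial>M)"
  proof (rule integral_dominated_convergence[where w="\<lambda>_. (2 * c)\<^sup>2"])
    show "D n \<in> borel_measurable M" for n by (rule bdd_measurableD[OF D])
    have D_eq: "D n w = (\<integral>s. indicator {0..<1} s * (f (traj (s + S n) w) - f (traj s w))\<^sup>2 \<partial>lborel)"
      if "w \<in> space M" for n w
      unfolding D_def using that by (intro integral_clock) measurable
    show "AE w in M. (\<lambda>n. D n w) \<longlonglongrightarrow> 0"
    proof (intro AE_I2)
      fix w assume w: "w \<in> space M"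
      have "D n w = (\<integral>s. indicator {0..1} s * (f (traj (s + S n) w) - f (traj s w))\<^sup>2 \<partial>lborel)" for n
        unfolding D_eq[OF w]
      proof (intro integral_cong_AE)
        show "AE s in lborel. indicator {0..<1} s * (f (traj (s + S n) w) - f (traj s w))\<^sup>2
            = indicator {0..1} s * (f (traj (s + S n) w) - f (traj s w))\<^sup>2"
          using AE_lborel_singleton[of 1] by (rule AE_mp) (auto simp: indicator_def)
      qed (use w in measurable)
      then show "(\<lambda>n. D n w) \<longlonglongrightarrow> 0"
        using tendsto_L2_translation[OF traj_meas[OF w] c(2) S(3,1,2)] by simp
    qed
    show "AE w in M. norm (D n w) \<le> (2 * c)\<^sup>2" for n
    proof (intro AE_I2)
      fix w assume w: "w \<in> space M"
      interpret C: finite_measure "clock 1" by (rule finite_clock)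
      have "D n w \<le> (\<integral>s. (2 * c)\<^sup>2 \<partial>clock 1)"
        unfolding D_def using w sq
        by (intro integral_mono C.integrable_const_bound[where B="(2 * c)\<^sup>2"]) auto
      moreover have "0 \<le> D n w" unfolding D_def by (intro integral_nonneg_AE) auto
      ultimately show "norm (D n w) \<le> (2 * c)\<^sup>2" by (simp add: measure_clock)
    qed
  qed auto
  ultimately show "(\<lambda>n. \<integral>w. (f (X (S n) w) - f (X 0 w))\<^sup>2 \<partial>M) \<longlonglongrightarrow> 0" by simp
qed simp

end

section \<open>From coercivity to the variance of time averages\<close>

context stationary_markov
begin

text \<open>The error \<open>D\<close> is tested against itself. With \<open>a r\<close> the
  correlation of \<open>D (X 0 w)\<close> and \<open>f (traj r w)\<close>, its squared norm
  \<open>S\<close> is the mean over \<open>r\<close> in \<open>[0, h)\<close> of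
  \<open>(a (t + r) - a t) - (a r - a 0)\<close>. Each increment of \<open>a\<close> pairs
  \<open>D\<close> with an increment of \<open>f\<close>, whose mean square is at most
  \<open>e\<close> by stationarity; this gives \<open>S \<le> S / 2 + 2 e\<close>.\<close>

lemma occupation_resolvent_bound:
  assumes f: "bdd_borel f" and t: "0 \<le> t" and h: "0 < h" and G: "bdd_borel G"
    and occ: "\<And>\<phi> h. bdd_borel \<phi> \<Longrightarrow> 0 \<le> h \<Longrightarrow>
      (\<integral>w. \<phi> (X 0 w) * G (X h w) \<partial>M) = (\<integral>r. (\<integral>w. \<phi> (X 0 w) * f (traj (h + r) w) \<partial>M) \<partial>clock t)"
    and e: "\<And>r. 0 < r \<Longrightarrow> r < h \<Longrightarrow> (\<integral>w. (f (X r w) - f (X 0 w))\<^sup>2 \<partial>M) \<le> e" "0 \<le> e"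
  shows "(\<integral>x. ((semigroup_op K h G x - G x) / h - (semigroup_op K t f x - f x))\<^sup>2 \<partial>\<mu>) \<le> 4 * e"
proof -
  define D where "D x = (semigroup_op K h G x - G x) / h - (semigroup_op K t f x - f x)" for x
  have PG: "bdd_borel (semigroup_op K h G)" and Pf: "bdd_borel (semigroup_op K t f)"
    using G f h t by (simp_all add: bdd_borel_semigroup)
  have D: "bdd_borel D"
    unfolding D_def[abs_def] using PG Pf G f
    by (intro bdd_measurable_diff bdd_measurable_divide)
  define a where "a r = (\<integral>w. D (X 0 w) * f (traj r w) \<partial>M)" for r
  have a: "bdd_borel a"
    using correlation_Fubini(2)[OF f bounded_rv_X[OF D order_refl], of 0] by (simp add: a_def[abs_def])
  interpret C: finite_measure "clock h" by (rule finite_clock)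
  have intM: "integrable M (\<lambda>w. D (X 0 w) * f (X r w))" if "0 \<le> r" for r
    using D f that by (intro integrable_rv bdd_measurable_mult bounded_rv_X) auto
  have mu0: "(\<integral>x. D x * g x \<partial>\<mu>) = (\<integral>w. D (X 0 w) * g (X 0 w) \<partial>M)" if "bdd_borel g" for g
    using integral_X[of 0 "\<lambda>x. D x * g x"] bdd_measurableD[OF bdd_measurable_mult[OF D that]] by simp
  have 1: "(\<integral>x. D x * G x \<partial>\<mu>) = (\<integral>r. a r \<partial>clock t)"
    unfolding mu0[OF G] a_def using occ[OF D, of 0] by simp
  have 2: "(\<integral>x. D x * semigroup_op K h G x \<partial>\<mu>) = (\<integral>r. a (h + r) \<partial>clock t)"
    unfolding mu0[OF PG] a_def using occ[OF D, of h] markov_integral[of 0 0 h, OF _ _ _ D G] h by simp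
  have 3: "(\<integral>x. D x * semigroup_op K t f x \<partial>\<mu>) = a t"
    unfolding mu0[OF Pf] a_def using markov_integral[of 0 0 t, OF _ _ _ D f] t by (simp add: traj_eq)
  have 4: "(\<integral>x. D x * f x \<partial>\<mu>) = a 0"
    unfolding mu0[OF f] a_def by (simp add: traj_eq)
  define S where "S = (\<integral>x. (D x)\<^sup>2 \<partial>\<mu>)"
  have "S = (\<integral>x. (D x * semigroup_op K h G x - D x * G x) / h - (D x * semigroup_op K t f x - D x * f x) \<partial>\<mu>)"
    unfolding S_def
  proof (intro Bochner_Integration.integral_cong refl)
    fix x
    have "d * ((p - g) / h - (q - z)) = (d * p - d * g) / h - (d * q - d * z)" for d p g q z :: real
      by (simp add: algebra_simps diff_divide_distrib)
    from this[of "D x" "semigroup_op K h G x" "G x" "semigroup_op K t f x" "f x"]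
    show "(D x)\<^sup>2 = (D x * semigroup_op K h G x - D x * G x) / h - (D x * semigroup_op K t f x - D x * f x)"
      unfolding D_def[symmetric] power2_eq_square .
  qed
  also have "\<dots> = ((\<integral>r. a (h + r) \<partial>clock t) - (\<integral>r. a r \<partial>clock t)) / h - (a t - a 0)"
    unfolding 1[symmetric] 2[symmetric] 3[symmetric] 4[symmetric]
    using integrable_mu[OF bdd_measurable_mult[OF D PG]] integrable_mu[OF bdd_measurable_mult[OF D G]]
      integrable_mu[OF bdd_measurable_mult[OF D Pf]] integrable_mu[OF bdd_measurable_mult[OF D f]]
    by simp
  also have "\<dots> = ((\<integral>r. a (t + r) \<partial>clock h) - (\<integral>r. a r \<partial>clock h)) / h - (a t - a 0)"
    using integral_clock_shift[OF a t, of h] h by simp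
  also have "\<dots> = (\<integral>r. a (t + r) - a r - (a t - a 0) \<partial>clock h) / h"
    using integrable_clock[OF a, of h] integrable_clock[OF bdd_borel_shift[OF a], of h t] h measure_clock[of h]
    by (simp add: field_simps)
  also have "\<dots> \<le> (\<integral>r. S / 2 + 2 * e \<partial>clock h) / h"
  proof (intro divide_right_mono integral_mono_AE)
    show "integrable (clock h) (\<lambda>r. a (t + r) - a r - (a t - a 0))"
      using integrable_clock[OF a, of h] integrable_clock[OF bdd_borel_shift[OF a], of h t] by simp
    show "AE r in clock h. a (t + r) - a r - (a t - a 0) \<le> S / 2 + 2 * e"
    proof (rule AE_mp[OF AE_clock], intro AE_I2 impI)
      fix r assume r: "0 \<le> r \<and> r < h"
      let ?u = "\<lambda>w. f (X (t + r) w) - f (X t w)" and ?v = "\<lambda>w. f (X r w) - f (X 0 w)"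
      have small: "(\<integral>w. (?v w)\<^sup>2 \<partial>M) \<le> e"
        using e r by (cases "r = 0") auto
      have iu: "integrable M (\<lambda>w. (?u w)\<^sup>2)" and iv: "integrable M (\<lambda>w. (?v w)\<^sup>2)" and iD: "integrable M (\<lambda>w. (D (X 0 w))\<^sup>2)"
        using f D t r
        by (intro integrable_rv bdd_measurable_power2 bdd_measurable_diff bounded_rv_X; simp)+
      have "a (t + r) - a r - (a t - a 0) = (\<integral>w. D (X 0 w) * f (X (t + r) w) - D (X 0 w) * f (X r w)
          - (D (X 0 w) * f (X t w) - D (X 0 w) * f (X 0 w)) \<partial>M)"
        using r t by (simp add: a_def traj_eq intM)
      also have "\<dots> \<le> (\<integral>w. (D (X 0 w))\<^sup>2 / 2 + (?u w)\<^sup>2 + (?v w)\<^sup>2 \<partial>M)"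
      proof (intro integral_mono)
        fix w
        \<comment> \<open>Each of the two Young inequalities spends \<open>d^2 / 4\<close>, together
          \<open>S / 2\<close> after integration, which is absorbed on the left.\<close>
        have "d * x - d * y - (d * z - d * w) \<le> d\<^sup>2 / 2 + (x - z)\<^sup>2 + (y - w)\<^sup>2" for d x y z w :: real
          using zero_le_power2[of "d / 2 - (x - z)"] zero_le_power2[of "d / 2 + (y - w)"]
          by (simp add: power2_eq_square algebra_simps)
        then show "D (X 0 w) * f (X (t + r) w) - D (X 0 w) * f (X r w)
          - (D (X 0 w) * f (X t w) - D (X 0 w) * f (X 0 w)) \<le> (D (X 0 w))\<^sup>2 / 2 + (?u w)\<^sup>2 + (?v w)\<^sup>2" .
      qed (use r t intM iu iv iD in simp_all)
      also have "\<dots> = (\<integral>w. (D (X 0 w))\<^sup>2 \<partial>M) / 2 + (\<integral>w. (?u w)\<^sup>2 \<partial>M) + (\<integral>w. (?v w)\<^sup>2 \<partial>M)"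
        using iu iv iD by simp
      also have "(\<integral>w. (D (X 0 w))\<^sup>2 \<partial>M) = S"
        unfolding S_def using bdd_measurableD[OF bdd_measurable_power2[OF D]] by (intro integral_X) auto
      also have "(\<integral>w. (?u w)\<^sup>2 \<partial>M) = (\<integral>w. (?v w)\<^sup>2 \<partial>M)"
        using stationary_increment[OF f t, of r] r by simp
      finally show "a (t + r) - a r - (a t - a 0) \<le> S / 2 + 2 * e" using small by simp
    qed
  qed (use h in auto)
  also have "\<dots> = S / 2 + 2 * e" using h measure_clock[of h] by simp
  finally show ?thesis unfolding S_def D_def by simp
qed

lemma occupation_generator:
  assumes f: "bdd_borel f" and t: "0 \<le> t" and G: "bdd_borel G"
    and occ: "\<And>\<phi> h. bdd_borel \<phi> \<Longrightarrow> 0 \<le> h \<Longrightarrow>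
      (\<integral>w. \<phi> (X 0 w) * G (X h w) \<partial>M) = (\<integral>r. (\<integral>w. \<phi> (X 0 w) * f (traj (h + r) w) \<partial>M) \<partial>clock t)"
  shows "generator_rel K \<mu> G (\<lambda>x. semigroup_op K t f x - f x)"
proof -
  have L2: "L2_fun \<mu> g" if "bdd_borel g" for g
    using bdd_measurableD[OF that] integrable_mu[OF bdd_measurable_power2[OF that]]
    by (simp add: L2_fun_def cong: measurable_cong_sets)
  define D where "D h x = (semigroup_op K h G x - G x) / h - (semigroup_op K t f x - f x)" for h x
  have D: "bdd_borel (D h)" if "0 < h" for h
    unfolding D_def[abs_def] using f G t that
    by (intro bdd_measurable_diff bdd_measurable_divide bdd_borel_semigroup) auto
  have "((\<lambda>h. \<integral>x. (D h x)\<^sup>2 \<partial>\<mu>) \<longlongrightarrow> 0) (at_right 0)"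
  proof (rule tendstoI)
    fix e :: real assume e: "0 < e"
    \<comment> \<open>\<open>e / 5\<close> instead of \<open>e / 4\<close>, because the bound with
      factor \<open>4\<close> is not strict while the limit needs a strict inequality.\<close>
    have "eventually (\<lambda>r. (\<integral>w. (f (X r w) - f (X 0 w))\<^sup>2 \<partial>M) < e / 5) (at_right 0)"
      using order_tendstoD(2)[OF increment_tendsto_0[OF f], of "e / 5"] e by simp
    then obtain b where b: "0 < b" "\<And>r. 0 < r \<Longrightarrow> r < b \<Longrightarrow> (\<integral>w. (f (X r w) - f (X 0 w))\<^sup>2 \<partial>M) < e / 5"
      by (auto simp: eventually_at_right_field)
    have "eventually (\<lambda>h. h < b \<and> 0 < h) (at_right 0)"
      using b(1) eventually_at_right_less by (auto simp: eventually_at_right_field)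
    then show "eventually (\<lambda>h. dist (\<integral>x. (D h x)\<^sup>2 \<partial>\<mu>) 0 < e) (at_right 0)"
    proof eventually_elim
      case (elim h)
      have "(\<integral>x. (D h x)\<^sup>2 \<partial>\<mu>) \<le> 4 * (e / 5)"
        unfolding D_def using elim b e
        by (intro occupation_resolvent_bound[OF f t _ G occ]) (auto simp: less_imp_le)
      moreover have "0 \<le> (\<integral>x. (D h x)\<^sup>2 \<partial>\<mu>)" by (intro integral_nonneg_AE) auto
      ultimately show ?case using e by simp
    qed
  qed
  then have "((\<lambda>h. ennreal (\<integral>x. (D h x)\<^sup>2 \<partial>\<mu>)) \<longlongrightarrow> ennreal 0) (at_right 0)"
    by (rule tendsto_ennrealI)
  moreover have "eventually (\<lambda>h. ennreal (\<integral>x. (D h x)\<^sup>2 \<partial>\<mu>) = (\<integral>\<^sup>+x. ennreal ((D h x)\<^sup>2) \<partial>\<mu>)) (at_right 0)"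
    using eventually_at_right_less
    by eventually_elim (intro nn_integral_eq_integral[symmetric] integrable_mu bdd_measurable_power2 D; simp)
  ultimately have "((\<lambda>h. \<integral>\<^sup>+x. ennreal ((D h x)\<^sup>2) \<partial>\<mu>) \<longlongrightarrow> ennreal 0) (at_right 0)"
    by (rule Lim_transform_eventually)
  then show ?thesis
    unfolding generator_rel_def D_def using L2[OF G] L2[OF bdd_measurable_diff[OF bdd_borel_semigroup[OF f t] f]] by simp
qed

text \<open>The integral in question is the pairing of \<open>f\<close> with \<open>G\<close>.
  Coercivity bounds \<open>c E\<close> by the pairing of \<open>G\<close> with \<open>f\<close>
  minus its semigroup image, and Young's inequality turns this into \<open>c^2 E \<le> 4 F\<close>.
  A second one bounds the pairing of \<open>f\<close> with \<open>G\<close> by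
  \<open>c / 4 * E + F / c\<close>, hence by \<open>2 / c * F\<close>. Young's inequality avoids a
  division by the norm of \<open>G\<close>, which may be zero.\<close>

lemma covariance_integral_bound:
  assumes f: "bdd_borel f" and mean: "(\<integral>x. f x \<partial>\<mu>) = 0" and t: "0 \<le> t"
    and c: "coercive K \<mu> c" "0 < c"
  shows "\<bar>\<integral>r. (\<integral>w. f (X 0 w) * f (traj r w) \<partial>M) \<partial>clock t\<bar> \<le> 2 / c * (\<integral>x. (f x)\<^sup>2 \<partial>\<mu>)"
proof -
  obtain G where G: "bdd_borel G" and occ: "\<And>\<phi> h. bdd_borel \<phi> \<Longrightarrow> 0 \<le> h \<Longrightarrow>
      (\<integral>w. \<phi> (X 0 w) * G (X h w) \<partial>M) = (\<integral>r. (\<integral>w. \<phi> (X 0 w) * f (traj (h + r) w) \<partial>M) \<partial>clock t)"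
    using occupation_density[OF f t] by blast
  have meas: "g \<in> borel_measurable borel" if "bdd_borel g" for g :: "'a \<Rightarrow> real" using bdd_measurableD[OF that] .
  define F where "F = (\<integral>x. (f x)\<^sup>2 \<partial>\<mu>)"
  define E where "E = (\<integral>x. (G x)\<^sup>2 \<partial>\<mu>)"
  have F_X: "(\<integral>w. (f (X s w))\<^sup>2 \<partial>M) = F" if "0 \<le> s" for s
    unfolding F_def using f that by (intro integral_X meas) auto
  have E_X: "(\<integral>w. (G (X 0 w))\<^sup>2 \<partial>M) = E"
    unfolding E_def using G by (intro integral_X meas) auto
  have i2: "integrable M (\<lambda>w. (G (X 0 w))\<^sup>2)" "integrable M (\<lambda>w. (f (X 0 w))\<^sup>2)" "integrable M (\<lambda>w. (f (X t w))\<^sup>2)"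
    "integrable M (\<lambda>w. (f (X 0 w) - f (X t w))\<^sup>2)"
    using f G t by (intro integrable_rv bdd_measurable_power2 bdd_measurable_diff bounded_rv_X; simp)+
  have i1: "integrable M (\<lambda>w. G (X 0 w) * f (X s w))" if "0 \<le> s" for s
    using f G that by (intro integrable_rv bdd_measurable_mult bounded_rv_X) auto
  \<comment> \<open>Coercivity concerns centred functions. Testing the occupation identity with the
    constant \<open>1\<close> shows that \<open>G\<close> inherits mean zero from
    \<open>f\<close>.\<close>
  have "(\<integral>x. G x \<partial>\<mu>) = (\<integral>w. 1 * G (X 0 w) \<partial>M)"
    using integral_X[of 0 G] meas[OF G] by simp
  also have "\<dots> = (\<integral>r. (\<integral>w. f (traj r w) \<partial>M) \<partial>clock t)"
    using occ[of "\<lambda>_. 1" 0] by (simp add: bdd_measurable_const)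
  also have "\<dots> = (\<integral>r. 0 \<partial>clock t)"
    using mean meas[OF f] by (intro Bochner_Integration.integral_cong) (simp_all add: traj_def integral_X)
  finally have "(\<integral>x. G x \<partial>\<mu>) = 0" by simp
  then have "c * E \<le> - (\<integral>x. (semigroup_op K t f x - f x) * G x \<partial>\<mu>)"
    using c(1) occupation_generator[OF f t G occ] unfolding coercive_def E_def by blast
  also have "\<dots> = (\<integral>x. G x * f x \<partial>\<mu>) - (\<integral>x. G x * semigroup_op K t f x \<partial>\<mu>)"
    using integrable_mu[OF bdd_measurable_mult[OF G f]]
      integrable_mu[OF bdd_measurable_mult[OF G bdd_borel_semigroup[OF f t]]]
    by (simp add: algebra_simps)
  also have "(\<integral>x. G x * f x \<partial>\<mu>) = (\<integral>w. G (X 0 w) * f (X 0 w) \<partial>M)"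
    using integral_X[of 0 "\<lambda>x. G x * f x"] meas[OF bdd_measurable_mult[OF G f]] by simp
  also have "(\<integral>x. G x * semigroup_op K t f x \<partial>\<mu>) = (\<integral>w. G (X 0 w) * semigroup_op K t f (X 0 w) \<partial>M)"
    using integral_X[of 0 "\<lambda>x. G x * semigroup_op K t f x"]
      meas[OF bdd_measurable_mult[OF G bdd_borel_semigroup[OF f t]]] by simp
  \<comment> \<open>On the path space stationarity gives \<open>f (X t w)\<close> the second moment
    \<open>F\<close>; this takes the place of a contraction estimate for the semigroup.\<close>
  also have "\<dots> = (\<integral>w. G (X 0 w) * f (X t w) \<partial>M)"
    using markov_integral[of 0 0 t, OF _ _ t G f] by simp
  also have "(\<integral>w. G (X 0 w) * f (X 0 w) \<partial>M) - (\<integral>w. G (X 0 w) * f (X t w) \<partial>M)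
      = (\<integral>w. G (X 0 w) * f (X 0 w) - G (X 0 w) * f (X t w) \<partial>M)"
    using i1[of 0] i1[OF t] by simp
  also have "\<dots> \<le> (\<integral>w. c / 2 * (G (X 0 w))\<^sup>2 + 1 / c * ((f (X 0 w))\<^sup>2 + (f (X t w))\<^sup>2) \<partial>M)"
  proof (intro integral_mono)
    fix w
    have "u * x - u * y \<le> c / 2 * u\<^sup>2 + 1 / c * (x\<^sup>2 + y\<^sup>2)" for u x y :: real
    proof -
      have "0 \<le> (c * u - (x - y))\<^sup>2 + (x + y)\<^sup>2" by simp
      then have "2 * c * (u * x - u * y) \<le> 2 * c * (c / 2 * u\<^sup>2 + 1 / c * (x\<^sup>2 + y\<^sup>2))"
        using c(2) by (simp add: power2_eq_square algebra_simps)
      then show ?thesis using c(2) by (simp del: times_divide_eq_left times_divide_eq_right)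
    qed
    then show "G (X 0 w) * f (X 0 w) - G (X 0 w) * f (X t w)
      \<le> c / 2 * (G (X 0 w))\<^sup>2 + 1 / c * ((f (X 0 w))\<^sup>2 + (f (X t w))\<^sup>2)" .
  qed (use i1[of 0] i1[OF t] i2 in simp_all)
  also have "\<dots> = c / 2 * E + 1 / c * (F + F)"
    using i2 by (simp add: F_X[OF t] F_X[of 0] E_X)
  finally have EF: "c / 4 * E \<le> 1 / c * F"
    by (simp only: distrib_left)
  have "(\<integral>r. (\<integral>w. f (X 0 w) * f (traj r w) \<partial>M) \<partial>clock t) = (\<integral>w. G (X 0 w) * f (X 0 w) \<partial>M)"
    using occ[OF f, of 0] by (simp add: mult.commute)
  also have "\<bar>\<dots>\<bar> \<le> (\<integral>w. \<bar>G (X 0 w) * f (X 0 w)\<bar> \<partial>M)"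
    by (rule integral_abs_bound)
  also have "\<dots> \<le> (\<integral>w. c / 4 * (G (X 0 w))\<^sup>2 + 1 / c * (f (X 0 w))\<^sup>2 \<partial>M)"
  proof (intro integral_mono)
    fix w
    have "\<bar>u * x\<bar> \<le> c / 4 * u\<^sup>2 + 1 / c * x\<^sup>2" for u x :: real
    proof -
      have "0 \<le> (c * \<bar>u\<bar> - 2 * \<bar>x\<bar>)\<^sup>2" by simp
      then have "4 * c * \<bar>u * x\<bar> \<le> 4 * c * (c / 4 * u\<^sup>2 + 1 / c * x\<^sup>2)"
        using c(2) by (simp add: power2_diff abs_mult algebra_simps power_mult_distrib) (simp add: power2_eq_square)
      then show ?thesis using c(2) by (simp del: times_divide_eq_left times_divide_eq_right)
    qed
    then show "\<bar>G (X 0 w) * f (X 0 w)\<bar> \<le> c / 4 * (G (X 0 w))\<^sup>2 + 1 / c * (f (X 0 w))\<^sup>2" .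
  qed (use i1[of 0] i2 in simp_all)
  also have "\<dots> = c / 4 * E + 1 / c * F"
    using i2 by (simp add: F_X[of 0] E_X)
  also have "\<dots> \<le> 2 / c * F" using EF by simp
  finally show ?thesis unfolding F_def .
qed

text \<open>For fixed \<open>s\<close> the lags into the future fill \<open>[0, T - s)\<close> and
  those into the past \<open>[0, s)\<close>. The bound on integrated covariances applies to both
  parts and gives \<open>4 / c * F\<close>, without any decay of single covariances; integrating
  over \<open>s\<close> contributes the factor \<open>T\<close>.\<close>

lemma time_average_variance:
  assumes f: "bdd_borel f" and mean: "(\<integral>x. f x \<partial>\<mu>) = 0" and T: "0 \<le> T"
    and c: "coercive K \<mu> c" "0 < c"
  shows "(\<integral>w. (\<integral>r. f (traj r w) \<partial>clock T)\<^sup>2 \<partial>M) \<le> T * (4 / c * (\<integral>x. (f x)\<^sup>2 \<partial>\<mu>))"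
proof -
  define F where "F = (\<integral>x. (f x)\<^sup>2 \<partial>\<mu>)"
  define a where "a r = (\<integral>w. f (X 0 w) * f (traj r w) \<partial>M)" for r
  have a: "bdd_borel a"
    using correlation_Fubini(2)[OF f bounded_rv_X[OF f order_refl], where h=0] by (simp add: a_def[abs_def])
  define W where "W w = (\<integral>r. f (traj r w) \<partial>clock T)" for w
  have W: "bdd_measurable M W"
    unfolding W_def[abs_def] using f by (intro clock_Fubini(2) bounded_traj_pair_0)
  interpret C: finite_measure "clock T" by (rule finite_clock)
  have lag: "(\<integral>w. f (traj s w) * f (traj r w) \<partial>M) = a \<bar>r - s\<bar>" if "0 \<le> s" "0 \<le> r" for s r
  proof -
    have *: "(\<integral>w. f (traj s w) * f (traj r w) \<partial>M) = a (r - s)" if "0 \<le> s" "s \<le> r" for s r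
    proof -
      have rs: "0 \<le> r - s" "0 \<le> r" using that by auto
      note m = bdd_measurableD[OF bdd_measurable_mult[OF f bdd_borel_semigroup[OF f rs(1)]]]
      have "(\<integral>w. f (traj s w) * f (traj r w) \<partial>M) = (\<integral>w. f (X s w) * semigroup_op K (r - s) f (X s w) \<partial>M)"
        using markov_integral[OF that(1) order_refl rs(1) f f] rs that by (simp add: traj_eq)
      also have "\<dots> = (\<integral>w. f (X 0 w) * semigroup_op K (r - s) f (X 0 w) \<partial>M)"
        using integral_X[OF that(1) m] integral_X[OF order_refl m] by simp
      also have "\<dots> = a (r - s)"
        using markov_integral[of 0 0 "r - s", OF _ _ rs(1) f f] rs by (simp add: a_def traj_eq)
      finally show ?thesis .
    qed
    show ?thesis
      using *[of s r] *[of r s] that by (cases "s \<le> r") (auto simp: mult.commute)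
  qed
  have "(\<integral>w. (W w)\<^sup>2 \<partial>M) = (\<integral>s. (\<integral>w. W w * f (traj s w) \<partial>M) \<partial>clock T)"
    using correlation_Fubini(1)[OF f W, where h=0 and t=T] by (simp add: power2_eq_square W_def[symmetric])
  also have "\<dots> \<le> (\<integral>s. 4 / c * F \<partial>clock T)"
  proof (intro integral_mono_AE)
    show "integrable (clock T) (\<lambda>s. \<integral>w. W w * f (traj s w) \<partial>M)"
      using integrable_clock[OF correlation_Fubini(2)[OF f W, where h=0]] by simp
    show "AE s in clock T. (\<integral>w. W w * f (traj s w) \<partial>M) \<le> 4 / c * F"
    proof (rule AE_mp[OF AE_clock], intro AE_I2 impI)
      fix s assume s: "0 \<le> s \<and> s < T"
      have "(\<integral>w. W w * f (traj s w) \<partial>M) = (\<integral>w. f (traj s w) * (\<integral>r. f (traj r w) \<partial>clock T) \<partial>M)"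
        by (simp add: W_def mult.commute)
      also have "\<dots> = (\<integral>r. (\<integral>w. f (traj s w) * f (traj r w) \<partial>M) \<partial>clock T)"
        using correlation_Fubini(1)[OF f bounded_rv_traj[OF f, of s], where h=0 and t=T] by simp
      also have "\<dots> = (\<integral>r. a \<bar>r - s\<bar> \<partial>clock T)"
      proof (intro integral_cong_AE)
        show "AE r in clock T. (\<integral>w. f (traj s w) * f (traj r w) \<partial>M) = a \<bar>r - s\<bar>"
          using AE_clock by (rule AE_mp) (use lag s in auto)
        show "(\<lambda>r. \<integral>w. f (traj s w) * f (traj r w) \<partial>M) \<in> borel_measurable (clock T)"
          using bdd_measurableD[OF correlation_Fubini(2)[OF f bounded_rv_traj[OF f, of s], where h=0]] by simp
        show "(\<lambda>r. a \<bar>r - s\<bar>) \<in> borel_measurable (clock T)"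
          using bdd_measurableD[OF a] by measurable
      qed
      also have "\<dots> = (\<integral>r. a r \<partial>clock (T - s)) + (\<integral>r. a r \<partial>clock s)"
        using s by (intro integral_clock_abs[OF a]) auto
      also have "\<dots> \<le> 2 / c * F + 2 / c * F"
        using covariance_integral_bound[OF f mean _ c, of "T - s"] covariance_integral_bound[OF f mean _ c, of s] s
        by (intro add_mono) (auto simp: F_def a_def[symmetric] abs_le_iff)
      finally show "(\<integral>w. W w * f (traj s w) \<partial>M) \<le> 4 / c * F" by simp
    qed
  qed simp
  also have "\<dots> = T * (4 / c * F)" using T by (simp add: measure_clock)
  finally show ?thesis unfolding W_def F_def .
qed

section \<open>Deviations of the empirical measure\<close>

lemma empirical_measure_eq:
  assumes w: "w \<in> space M" and T: "0 < T"
  shows "empirical_measure X T w = scale_measure (ennreal (1 / T)) (distr (clock T) borel (\<lambda>r. traj r w))"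
proof (rule measure_eqI)
  let ?R = "restrict_space lborel {0::real..}"
  have [measurable]: "(\<lambda>r. traj r w) \<in> borel \<rightarrow>\<^sub>M borel" using w by measurable
  have "(\<lambda>r. traj r w) \<in> ?R \<rightarrow>\<^sub>M borel" by (rule measurable_restrict_space1) measurable
  then have X[measurable]: "(\<lambda>r. X r w) \<in> ?R \<rightarrow>\<^sub>M borel"
    by (rule measurable_cong[THEN iffD1, rotated]) (simp add: space_restrict_space traj_eq)
  show "sets (empirical_measure X T w) = sets (scale_measure (ennreal (1 / T)) (distr (clock T) borel (\<lambda>r. traj r w)))"
    by (simp add: empirical_measure_def)
  fix A assume "A \<in> sets (empirical_measure X T w)"
  then have [measurable]: "A \<in> sets borel" by (simp add: empirical_measure_def)
  have sR: "{0..T} \<in> sets ?R" by (auto simp: sets_restrict_space_iff)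
  have B: "(\<lambda>r. X r w) -` A \<inter> space ?R \<in> sets ?R" by measurable
  have eR: "emeasure ?R S = emeasure lborel S" if "S \<in> sets ?R" for S
    using that by (subst emeasure_restrict_space) (auto simp: sets_restrict_space_iff)
  have "emeasure (empirical_measure X T w) A = emeasure (uniform_measure ?R {0..T}) ((\<lambda>r. X r w) -` A \<inter> space ?R)"
    unfolding empirical_measure_def by (subst emeasure_distr) auto
  also have "\<dots> = emeasure ?R ({0..T} \<inter> ((\<lambda>r. X r w) -` A \<inter> space ?R)) / emeasure ?R {0..T}"
    using sR B by (rule emeasure_uniform_measure)
  also have "\<dots> = emeasure lborel ({0..T} \<inter> ((\<lambda>r. X r w) -` A \<inter> space ?R)) / ennreal T"
    using sR B T by (simp add: eR sets.Int)
  also have "{0..T} \<inter> ((\<lambda>r. X r w) -` A \<inter> space ?R) = {0..T} \<inter> (\<lambda>r. traj r w) -` A"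
    by (auto simp: space_restrict_space traj_eq)
  \<comment> \<open>The closed interval of the empirical measure and the half-open one of
    \<open>clock\<close> differ by the null set \<open>{T}\<close>.\<close>
  also have "emeasure lborel \<dots> = emeasure lborel ({0..<T} \<inter> (\<lambda>r. traj r w) -` A)"
  proof (rule emeasure_eq_AE)
    show "AE r in lborel. (r \<in> {0..T} \<inter> (\<lambda>r. traj r w) -` A) = (r \<in> {0..<T} \<inter> (\<lambda>r. traj r w) -` A)"
      using AE_lborel_singleton[of T] by (rule AE_mp) auto
  qed measurable
  also have "\<dots> = emeasure (distr (clock T) borel (\<lambda>r. traj r w)) A"
  proof -
    have [measurable]: "(\<lambda>r. traj r w) -` A \<in> sets borel"
      using measurable_sets[of "\<lambda>r. traj r w" borel borel A] by simp
    show ?thesis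
      by (simp add: emeasure_distr) (simp add: clock_def emeasure_density indicator_inter_arith[symmetric])
  qed
  finally show "emeasure (empirical_measure X T w) A = emeasure (scale_measure (ennreal (1 / T)) (distr (clock T) borel (\<lambda>r. traj r w))) A"
    using T by (simp add: divide_ennreal_def mult.commute inverse_ennreal inverse_eq_divide)
qed

text \<open>Stationarity and Tonelli make \<open>\<mu>\<close> the mean of the random empirical
  measure, so that moments of \<open>\<mu>\<close> serve for both measures in expectation.\<close>

lemma
  assumes T: "0 < T" 
  shows prob_empirical: "w \<in> space M \<Longrightarrow> prob_space (empirical_measure X T w)"
    and sets_empirical: "sets (empirical_measure X T w) = sets borel"
    and measure_empirical: "w \<in> space M \<Longrightarrow> A \<in> sets borel \<Longrightarrow>
      measure (empirical_measure X T w) A = (\<integral>r. indicator A (traj r w) \<partial>clock T) / T"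
    and nn_integral_empirical: "g \<in> borel_measurable borel \<Longrightarrow>
      (\<integral>\<^sup>+w. (\<integral>\<^sup>+x. g x \<partial>empirical_measure X T w) \<partial>M) = (\<integral>\<^sup>+x. g x \<partial>\<mu>)"
proof -
  show "sets (empirical_measure X T w) = sets borel" by (simp add: empirical_measure_def)
  have traj_meas: "(\<lambda>r. traj r w) \<in> borel \<rightarrow>\<^sub>M borel" if "w \<in> space M" for w using that by measurable
  { assume w: "w \<in> space M"
    note [measurable] = traj_meas[OF w]
    show "prob_space (empirical_measure X T w)"
      using T by (intro prob_spaceI)
        (simp add: empirical_measure_eq[OF w] space_scale_measure emeasure_distr emeasure_clock flip: ennreal_mult)
    assume [measurable]: "A \<in> sets borel"
    interpret C: finite_measure "clock T" by (rule finite_clock)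
    have "(\<integral>r. indicator A (traj r w) \<partial>clock T) = measure (clock T) ((\<lambda>r. traj r w) -` A)"
      using integral_distr[of "\<lambda>r. traj r w" "clock T" borel "indicator A :: _ \<Rightarrow> real"]
      by (simp add: measure_distr)
    then show "measure (empirical_measure X T w) A = (\<integral>r. indicator A (traj r w) \<partial>clock T) / T"
      using T by (simp add: empirical_measure_eq[OF w] measure_scale_measure measure_distr) }
  { assume [measurable]: "g \<in> borel_measurable borel"
    interpret C: finite_measure "clock T" by (rule finite_clock)
    interpret P: pair_sigma_finite "clock T" M ..
    have "(\<integral>\<^sup>+w. (\<integral>\<^sup>+x. g x \<partial>empirical_measure X T w) \<partial>M) = (\<integral>\<^sup>+w. ennreal (1 / T) * (\<integral>\<^sup>+r. g (traj r w) \<partial>clock T) \<partial>M)"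
      using traj_meas T by (intro nn_integral_cong)
        (simp add: empirical_measure_eq nn_integral_scale_measure nn_integral_distr)
    also have "\<dots> = ennreal (1 / T) * (\<integral>\<^sup>+w. (\<integral>\<^sup>+r. g (traj r w) \<partial>clock T) \<partial>M)"
      by (intro nn_integral_cmult) measurable
    also have "(\<integral>\<^sup>+w. (\<integral>\<^sup>+r. g (traj r w) \<partial>clock T) \<partial>M) = (\<integral>\<^sup>+r. (\<integral>\<^sup>+w. g (traj r w) \<partial>M) \<partial>clock T)"
      using P.Fubini[of "\<lambda>z. g (traj (fst z) (snd z))"] by simp
    also have "\<dots> = (\<integral>\<^sup>+r. (\<integral>\<^sup>+x. g x \<partial>\<mu>) \<partial>clock T)"
    proof (intro nn_integral_cong)
      fix r
      show "(\<integral>\<^sup>+w. g (traj r w) \<partial>M) = (\<integral>\<^sup>+x. g x \<partial>\<mu>)"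
        using distr_X[of "max 0 r"] nn_integral_distr[of "X (max 0 r)" M borel g] by (simp add: traj_def)
    qed
    also have "ennreal (1 / T) * \<dots> = (\<integral>\<^sup>+x. g x \<partial>\<mu>)"
      using T by (simp add: emeasure_clock mult.left_commute[of "ennreal (1 / T)"] flip: ennreal_mult)
    finally show "(\<integral>\<^sup>+w. (\<integral>\<^sup>+x. g x \<partial>empirical_measure X T w) \<partial>M) = (\<integral>\<^sup>+x. g x \<partial>\<mu>)" . }
qed

lemma measurable_nn_integral_empirical:
  assumes T: "0 < T" and [measurable]: "g \<in> borel_measurable borel"
  shows "(\<lambda>w. \<integral>\<^sup>+x. g x \<partial>empirical_measure X T w) \<in> borel_measurable M"
proof -
  interpret C: finite_measure "clock T" by (rule finite_clock)
  have "(\<lambda>w. ennreal (1 / T) * (\<integral>\<^sup>+r. g (traj r w) \<partial>clock T)) \<in> borel_measurable M"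
    by measurable
  moreover have "(\<integral>\<^sup>+x. g x \<partial>empirical_measure X T w) = ennreal (1 / T) * (\<integral>\<^sup>+r. g (traj r w) \<partial>clock T)"
    if w: "w \<in> space M" for w
  proof -
    have "(\<lambda>r. traj r w) \<in> borel \<rightarrow>\<^sub>M borel" using w by measurable
    then show ?thesis
      using T by (simp add: empirical_measure_eq[OF w] nn_integral_scale_measure nn_integral_distr)
  qed
  ultimately show ?thesis by (simp cong: measurable_cong)
qed

text \<open>The first argument of the minimum is the triangle inequality; the second is the root of
  the variance bound, the centred indicator having second moment \<open>m - m^2 \<le> m\<close>.
  They cross at mass \<open>1 / (c * T)\<close>: lighter cells need the first, heavier ones the
  second.\<close>

lemma empirical_deviation:
  assumes [measurable]: "A \<in> sets borel" and T: "0 < T" and c: "coercive K \<mu> c" "0 < c"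
  shows "(\<lambda>w. measure (empirical_measure X T w) A - measure \<mu> A) \<in> borel_measurable M"
    and "(\<integral>\<^sup>+w. ennreal \<bar>measure (empirical_measure X T w) A - measure \<mu> A\<bar> \<partial>M)
      \<le> ennreal (min (2 * measure \<mu> A) (sqrt (4 * measure \<mu> A / (c * T))))"
proof -
  define m where "m = measure \<mu> A"
  define f where "f x = indicator A x - m" for x
  have ind: "bdd_borel (indicator A :: 'a \<Rightarrow> real)"
    unfolding bdd_measurable_def by (auto simp: indicator_def intro!: exI[of _ 1])
  then have f: "bdd_borel f"
    unfolding f_def[abs_def] by (intro bdd_measurable_diff bdd_measurable_const)
  have iA: "integrable \<mu> (indicator A :: 'a \<Rightarrow> real)" by (rule integrable_mu[OF ind])
  have mean: "(\<integral>x. f x \<partial>\<mu>) = 0"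
    unfolding f_def using iA by (simp add: m_def mu.prob_space[unfolded space_mu])
  have "(\<integral>x. (f x)\<^sup>2 \<partial>\<mu>) = (\<integral>x. (1 - 2 * m) * indicator A x + m\<^sup>2 \<partial>\<mu>)"
    by (intro Bochner_Integration.integral_cong) (auto simp: f_def indicator_def power2_eq_square algebra_simps)
  also have "\<dots> = (1 - 2 * m) * m + m\<^sup>2"
    using iA by (simp add: m_def mu.prob_space[unfolded space_mu])
  also have "\<dots> \<le> m" by (simp add: power2_eq_square algebra_simps)
  finally have f2: "(\<integral>x. (f x)\<^sup>2 \<partial>\<mu>) \<le> m" .
  interpret C: finite_measure "clock T" by (rule finite_clock)
  define V where "V w = (\<integral>r. f (traj r w) \<partial>clock T) / T" for w
  have V: "bdd_measurable M V"
    unfolding V_def[abs_def] using f by (intro bdd_measurable_divide clock_Fubini(2) bounded_traj_pair_0)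
  have V_eq: "measure (empirical_measure X T w) A - measure \<mu> A = V w" if w: "w \<in> space M" for w
  proof -
    have "(\<lambda>r. traj r w) \<in> borel \<rightarrow>\<^sub>M borel" using w by measurable
    then have "integrable (clock T) (\<lambda>r. indicator A (traj r w) :: real)"
      by (intro integrable_clock bdd_measurable_compose[OF ind])
    then show ?thesis
      using T by (simp add: measure_empirical[OF T w] V_def f_def m_def measure_clock field_simps)
  qed
  show "(\<lambda>w. measure (empirical_measure X T w) A - measure \<mu> A) \<in> borel_measurable M"
    using bdd_measurableD[OF V] by (rule measurable_cong[THEN iffD2, rotated]) (rule V_eq)
  have iV: "integrable M V" "integrable M (\<lambda>w. (V w)\<^sup>2)" "integrable M (\<lambda>w. \<bar>V w\<bar>)"
    using V by (auto intro: integrable_rv)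
  have "(\<integral>w. (V w)\<^sup>2 \<partial>M) = (\<integral>w. (\<integral>r. f (traj r w) \<partial>clock T)\<^sup>2 \<partial>M) / T\<^sup>2"
    by (simp add: V_def power_divide)
  also have "\<dots> \<le> T * (4 / c * m) / T\<^sup>2"
    using T c by (intro divide_right_mono order_trans[OF time_average_variance[OF f mean less_imp_le[OF T] c]]
      mult_left_mono f2) auto
  also have "\<dots> = 4 * m / (c * T)"
    using T c by (simp add: power2_eq_square field_simps)
  finally have V2: "(\<integral>w. (V w)\<^sup>2 \<partial>M) \<le> 4 * m / (c * T)" .
  \<comment> \<open>Jensen's inequality for the square, in the form that the variance of the
    absolute value of \<open>V\<close> is nonnegative.\<close>
  have "0 \<le> variance (\<lambda>w. \<bar>V w\<bar>)" by (rule variance_positive)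
  also have "\<dots> = (\<integral>w. (V w)\<^sup>2 \<partial>M) - (\<integral>w. \<bar>V w\<bar> \<partial>M)\<^sup>2"
    using iV by (subst variance_eq) auto
  finally have b1: "(\<integral>w. \<bar>V w\<bar> \<partial>M) \<le> sqrt (4 * m / (c * T))"
    using V2 by (intro real_le_rsqrt) simp
  have nn: "(\<integral>\<^sup>+w. ennreal \<bar>measure (empirical_measure X T w) A - measure \<mu> A\<bar> \<partial>M) = ennreal (\<integral>w. \<bar>V w\<bar> \<partial>M)"
    using iV by (subst nn_integral_eq_integral[symmetric]) (auto intro!: nn_integral_cong simp: V_eq)
  have "(\<integral>\<^sup>+w. ennreal \<bar>measure (empirical_measure X T w) A - measure \<mu> A\<bar> \<partial>M)
      \<le> (\<integral>\<^sup>+w. emeasure (empirical_measure X T w) A + ennreal m \<partial>M)"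
  proof (intro nn_integral_mono)
    fix w assume w: "w \<in> space M"
    interpret E: prob_space "empirical_measure X T w" by (rule prob_empirical[OF T w])
    have "\<bar>measure (empirical_measure X T w) A - measure \<mu> A\<bar> \<le> measure (empirical_measure X T w) A + m"
      using measure_nonneg[of "empirical_measure X T w" A] measure_nonneg[of \<mu> A] unfolding m_def by linarith
    then have "ennreal \<bar>measure (empirical_measure X T w) A - measure \<mu> A\<bar> \<le> ennreal (measure (empirical_measure X T w) A + m)"
      by (rule ennreal_leI)
    then show "ennreal \<bar>measure (empirical_measure X T w) A - measure \<mu> A\<bar> \<le> emeasure (empirical_measure X T w) A + ennreal m"
      by (simp add: E.emeasure_eq_measure m_def)
  qed
  also have "\<dots> = (\<integral>\<^sup>+w. (\<integral>\<^sup>+x. indicator A x \<partial>empirical_measure X T w) + ennreal m \<partial>M)"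
    by (simp add: sets_empirical[OF T])
  also have "\<dots> = (\<integral>\<^sup>+w. (\<integral>\<^sup>+x. indicator A x \<partial>empirical_measure X T w) \<partial>M) + ennreal m"
    by (subst nn_integral_add) (auto intro!: measurable_nn_integral_empirical[OF T] simp: emeasure_space_1)
  also have "\<dots> = ennreal (2 * m)"
    by (subst nn_integral_empirical[OF T]) (simp_all add: m_def mu.emeasure_eq_measure flip: ennreal_plus)
  finally show "(\<integral>\<^sup>+w. ennreal \<bar>measure (empirical_measure X T w) A - measure \<mu> A\<bar> \<partial>M)
      \<le> ennreal (min (2 * measure \<mu> A) (sqrt (4 * measure \<mu> A / (c * T))))"
    using ennreal_leI[OF b1] unfolding nn m_def by (simp add: min_def)
qed

end

section \<open>Summation over scales\<close>

lemma sum_power_inj_le: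
  fixes r :: real
  assumes "finite S" "inj_on g S" "0 \<le> r" "r < 1"
  shows "(\<Sum>n\<in>S. r ^ g n) \<le> 1 / (1 - r)"
proof -
  have "(\<Sum>n\<in>S. r ^ g n) = (\<Sum>m\<in>g ` S. r ^ m)"
    using assms(2) by (simp add: sum.reindex)
  also have "\<dots> \<le> (\<Sum>m. r ^ m)"
    using assms by (intro sum_le_suminf summable_geometric) auto
  also have "\<dots> = 1 / (1 - r)"
    using assms by (intro suminf_geometric) auto
  finally show ?thesis .
qed

lemma two_powr_lt_1: "0 < a \<Longrightarrow> (2::real) powr - a < 1"
  using powr_less_mono[of "- a" 0 2] by simp

text \<open>Both powers equal \<open>1\<close> where \<open>2^n = A\<close>, and the smaller one
  decays geometrically on either side, at least with exponent \<open>c = min a b\<close>. Rounding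
  \<open>log 2 A\<close> down to an integer costs a factor of at most \<open>2^c\<close>. Uniformity
  in \<open>A\<close> is the point, since \<open>A\<close> will be a crossover scale depending on
  \<open>T\<close>.\<close>

lemma two_sided_geometric:
  fixes a b :: real
  assumes "0 < a" "0 < b"
  shows "\<exists>C>0. \<forall>A>0. \<forall>N. (\<Sum>n<N. min ((2 powr real n / A) powr - a) ((2 powr real n / A) powr b)) \<le> C"
proof -
  define c where "c = min a b"
  have c: "0 < c" "c \<le> a" "c \<le> b" using assms by (auto simp: c_def)
  define r where "r = (2::real) powr - c"
  have r: "0 < r" "r < 1" using two_powr_lt_1[OF c(1)] by (auto simp: r_def)
  have "(\<Sum>n<N. min ((2 powr real n / A) powr - a) ((2 powr real n / A) powr b)) \<le> 2 powr c * (2 / (1 - r))"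
    if A: "0 < A" for A N
  proof -
    define k where "k = \<lfloor>log 2 A\<rfloor>"
    have k: "real_of_int k \<le> log 2 A" "log 2 A < real_of_int k + 1" by (auto simp: k_def)
    have u: "2 powr real n / A = 2 powr (real n - log 2 A)" for n
      using A by (simp add: powr_diff)
    have r_pow: "r ^ m = 2 powr (- c * real m)" for m
      using r by (simp add: r_def powr_realpow[symmetric] powr_powr)
    have summand: "min ((2 powr real n / A) powr - a) ((2 powr real n / A) powr b) \<le> 2 powr c * r ^ nat \<bar>int n - k\<bar>" for n
    proof (cases "int n > k")
      case True
      then have n: "real n \<ge> real_of_int k + 1" by linarith
      have "(2 powr real n / A) powr - a = 2 powr (- a * (real n - log 2 A))"
        unfolding u by (simp add: powr_powr mult.commute)
      also have "\<dots> \<le> 2 powr (- c * (real n - log 2 A))"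
        using n k c by (intro powr_mono) (auto intro: mult_right_mono)
      also have "\<dots> \<le> 2 powr (c + - c * (real n - real_of_int k))"
      proof (intro powr_mono)
        have "c * (log 2 A - real_of_int k) \<le> c * 1" using k c by (intro mult_left_mono) auto
        then show "- c * (real n - log 2 A) \<le> c + - c * (real n - real_of_int k)" by (simp add: algebra_simps)
      qed simp
      also have "\<dots> = 2 powr c * r ^ nat \<bar>int n - k\<bar>"
        using True by (simp add: r_pow powr_diff powr_minus divide_inverse)
      finally show ?thesis by simp
    next
      case False
      then have n: "real n \<le> real_of_int k" by linarith
      have "(2 powr real n / A) powr b = 2 powr (b * (real n - log 2 A))"
        unfolding u by (simp add: powr_powr mult.commute)
      also have "\<dots> \<le> 2 powr (c * (real n - log 2 A))"
        using n k c by (intro powr_mono) (auto intro: mult_right_mono_neg)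
      also have "\<dots> \<le> 2 powr (c + - c * (real_of_int k - real n))"
      proof (intro powr_mono)
        have P: "c * real_of_int k \<le> c * log 2 A" using k c by (intro mult_left_mono) auto
        have "c * (x - y) \<le> c + - c * (z - x)" if "c * z \<le> c * y" for x y z
          using that c(1) unfolding right_diff_distrib mult_minus_left by linarith
        from this[OF P] show "c * (real n - log 2 A) \<le> c + - c * (real_of_int k - real n)" .
      qed simp
      also have "\<dots> = 2 powr c * r ^ nat \<bar>int n - k\<bar>"
        using False by (simp add: r_pow powr_diff powr_minus divide_inverse)
      finally show ?thesis by simp
    qed
    have "(\<Sum>n<N. min ((2 powr real n / A) powr - a) ((2 powr real n / A) powr b))
        \<le> (\<Sum>n<N. 2 powr c * r ^ nat \<bar>int n - k\<bar>)"
      by (intro sum_mono summand)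
    also have "\<dots> = 2 powr c * ((\<Sum>n | n < N \<and> k < int n. r ^ nat \<bar>int n - k\<bar>) + (\<Sum>n | n < N \<and> \<not> k < int n. r ^ nat \<bar>int n - k\<bar>))"
      using sum.Int_Diff[of "{..<N}" "\<lambda>n. r ^ nat \<bar>int n - k\<bar>" "{n. k < int n}"]
      by (simp add: sum_distrib_left[symmetric] Int_def set_diff_eq)
    also have "\<dots> \<le> 2 powr c * (1 / (1 - r) + 1 / (1 - r))"
      using r by (intro mult_left_mono add_mono sum_power_inj_le) (auto simp: inj_on_def)
    finally show ?thesis by simp
  qed
  moreover have "0 < 2 powr c * (2 / (1 - r))" using r by simp
  ultimately show ?thesis by blast
qed

lemma sum_two_powr_le:
  assumes "0 < a"
  shows "(\<Sum>n<N. 2 powr (- a * real n)) \<le> 1 / (1 - 2 powr - a)"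
proof -
  have "2 powr (- a * real n) = (2 powr - a) ^ n" for n
    by (simp add: powr_realpow[symmetric] powr_powr)
  then show ?thesis
    using sum_power_inj_le[of "{..<N}" id "2 powr - a"] two_powr_lt_1[OF assms] by simp
qed

text \<open>\<open>y\<close> stands for the ring mass times \<open>T\<close>; \<open>y\<^sup>1\<^sup>/\<^sup>d\<close> is the resolution at which the variance bound becomes trivial.\<close>
lemma level_sum_bound:
  fixes d p :: real
  assumes d: "0 < d" and p: "0 < p"
  defines "\<beta> \<equiv> min (1/2) (p / d)"
  shows "\<exists>C>0. \<forall>y>0. \<forall>L. (\<Sum>i<L. 2 powr (- p * real i) * min 1 (2 powr (d * real i / 2) * y powr (-1/2)))
    \<le> C * (if p = d / 2 then real L + 1 else 1) * min 1 (y powr - \<beta>)"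
proof -
  \<comment> \<open>The growth factor is at least \<open>1\<close> and can be pulled out of the
    minimum. What remains is a geometric series when \<open>p > d / 2\<close>; for
    \<open>p = d / 2\<close> all levels weigh the same, the origin of the factor
    \<open>real L + 1\<close>.\<close>
  have small: "2 powr (- p * real i) * min 1 (2 powr (d * real i / 2) * z) \<le> 2 powr (- (p - d / 2) * real i) * min 1 z"
    if "0 \<le> z" for z i
  proof -
    have k: "1 \<le> 2 powr (d * real i / 2)" using d by (intro ge_one_powr_ge_zero) auto
    then have "min 1 (2 powr (d * real i / 2) * z) \<le> 2 powr (d * real i / 2) * min 1 z"
      using that by (cases "z \<le> 1") (auto simp: min.coboundedI1 min.coboundedI2)
    then have "2 powr (- p * real i) * min 1 (2 powr (d * real i / 2) * z)
        \<le> 2 powr (- p * real i) * (2 powr (d * real i / 2) * min 1 z)"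
      by (intro mult_left_mono) auto
    also have "\<dots> = 2 powr (- (p - d / 2) * real i) * min 1 z"
      by (simp only: mult.assoc[symmetric] powr_add[symmetric]) (simp add: algebra_simps)
    finally show ?thesis .
  qed
  show ?thesis
  proof (cases "d / 2 \<le> p")
    case True
    then have \<beta>: "\<beta> = 1 / 2" using d by (simp add: \<beta>_def min_def field_simps)
    define C where "C = max 1 (1 / (1 - 2 powr - (p - d / 2)))"
    have geometric: "(\<Sum>i<L. 2 powr (- (p - d / 2) * real i)) \<le> C * (if p = d / 2 then real L + 1 else 1)" for L
    proof (cases "p = d / 2")
      case eq: True
      have z: "p - d / 2 = 0" using eq by simp
      have "real L \<le> 1 * (real L + 1)" by simp
      also have "\<dots> \<le> C * (real L + 1)" by (intro mult_right_mono) (auto simp: C_def)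
      finally show ?thesis unfolding z using eq by simp
    next
      case False
      then show ?thesis
        using sum_two_powr_le[of "p - d / 2" L] \<open>d / 2 \<le> p\<close> by (simp add: C_def)
    qed
    have "(\<Sum>i<L. 2 powr (- p * real i) * min 1 (2 powr (d * real i / 2) * y powr (-1/2)))
        \<le> C * (if p = d / 2 then real L + 1 else 1) * min 1 (y powr - \<beta>)" for y L
    proof -
      have "(\<Sum>i<L. 2 powr (- p * real i) * min 1 (2 powr (d * real i / 2) * y powr (-1/2)))
          \<le> (\<Sum>i<L. 2 powr (- (p - d / 2) * real i) * min 1 (y powr (-1/2)))"
        by (intro sum_mono small) simp
      also have "\<dots> \<le> C * (if p = d / 2 then real L + 1 else 1) * min 1 (y powr (-1/2))"
        unfolding sum_distrib_right[symmetric] by (intro mult_right_mono geometric) simp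
      finally show ?thesis by (simp add: \<beta>)
    qed
    moreover have "0 < C" by (simp add: C_def)
    ultimately show ?thesis by blast
  next
    case False
    then have 3: "p < d / 2" by simp
    then have \<beta>: "\<beta> = p / d" using d by (simp add: \<beta>_def min_def field_simps)
    obtain C where C: "0 < C" "\<And>A N. 0 < A \<Longrightarrow>
        (\<Sum>n<N. min ((2 powr real n / A) powr - p) ((2 powr real n / A) powr (d / 2 - p))) \<le> C"
      using two_sided_geometric[of p "d / 2 - p"] p 3 by auto
    define C1 where "C1 = 1 / (1 - 2 powr - p)"
    have C1: "0 < C1" using two_powr_lt_1[of p] p by (simp add: C1_def)
    have "(\<Sum>i<L. 2 powr (- p * real i) * min 1 (2 powr (d * real i / 2) * y powr (-1/2))) \<le> (C1 + C) * min 1 (y powr - \<beta>)"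
      (is "?S \<le> _") if y: "0 < y" for y L
    proof -
      have "?S \<le> (\<Sum>i<L. 2 powr (- p * real i) * 1)" by (intro sum_mono mult_left_mono) auto
      also have "\<dots> \<le> C1" using sum_two_powr_le[OF p] by (simp add: C1_def)
      finally have 1: "?S \<le> C1" .
      \<comment> \<open>The two arguments of the minimum cross where \<open>2^i = A\<close>.
        Measured in units of \<open>A\<close>, the summand is two-sided geometric with exponents
        \<open>p\<close> and \<open>d / 2 - p\<close>, and the prefactor \<open>A^(-p)\<close> is
        \<open>y^(-\<beta>)\<close>.\<close>
      define A where "A = y powr (1 / d)"
      have A: "0 < A" using y by (simp add: A_def)
      have "2 powr (- p * real i) * min 1 (2 powr (d * real i / 2) * y powr (-1/2))
          = A powr - p * min ((2 powr real i / A) powr - p) ((2 powr real i / A) powr (d / 2 - p))" for i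
      proof -
        have e1: "2 powr (- p * real i) = A powr - p * (2 powr real i / A) powr - p"
          using A by (simp add: powr_divide powr_powr powr_minus inverse_eq_divide mult.commute)
        have e2: "2 powr (- p * real i) * (2 powr (d * real i / 2) * y powr (-1/2)) = A powr - p * (2 powr real i / A) powr (d / 2 - p)"
        proof -
          have "A powr (d / 2 - p) = y powr (1/2) * A powr - p"
            using y d by (simp add: A_def powr_diff powr_powr powr_minus_divide)
          then have "A powr - p * (2 powr real i / A) powr (d / 2 - p) = 2 powr (real i * (d / 2 - p)) * y powr (-1/2)"
            using A y by (simp add: powr_divide powr_powr powr_minus field_simps)
          then show ?thesis
            by (simp only: mult.assoc[symmetric] powr_add[symmetric]) (simp add: algebra_simps)
        qed
        have "2 powr (- p * real i) * min 1 (2 powr (d * real i / 2) * y powr (-1/2))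
            = min (2 powr (- p * real i)) (2 powr (- p * real i) * (2 powr (d * real i / 2) * y powr (-1/2)))"
          by (simp add: min_mult_distrib_left)
        also have "\<dots> = min (A powr - p * (2 powr real i / A) powr - p) (A powr - p * (2 powr real i / A) powr (d / 2 - p))"
          by (rule arg_cong2[of _ _ _ _ min, OF e1 e2])
        also have "\<dots> = A powr - p * min ((2 powr real i / A) powr - p) ((2 powr real i / A) powr (d / 2 - p))"
          by (simp add: min_mult_distrib_left)
        finally show ?thesis .
      qed
      then have "?S = A powr - p * (\<Sum>i<L. min ((2 powr real i / A) powr - p) ((2 powr real i / A) powr (d / 2 - p)))"
        by (simp add: sum_distrib_left)
      also have "\<dots> \<le> A powr - p * C" by (intro mult_left_mono C(2) A) simp
      also have "A powr - p = y powr - \<beta>" by (simp add: A_def powr_powr \<beta>)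
      finally have 2: "?S \<le> C * y powr - \<beta>" by (simp add: mult.commute)
      have "0 \<le> C1 * y powr - \<beta>" using C1 by simp
      then have "?S \<le> (C1 + C) * 1" "?S \<le> (C1 + C) * y powr - \<beta>"
        using 1 2 C(1) by (simp_all add: distrib_right)
      moreover have "s \<le> k * min 1 z" if "s \<le> k * 1" "s \<le> k * z" for s k z :: real
        using that by (auto simp: min_def)
      ultimately show ?thesis by blast
    qed
    then show ?thesis using C C1 3 by (intro exI[of _ "C1 + C"]) auto
  qed
qed

text \<open>Ring \<open>n\<close> contributes the minimum of \<open>2^(-(q - p) n)\<close> and
  \<open>2^(-\<delta> n) T^(-\<beta>)\<close>, and the sign of \<open>\<delta>\<close> decides. For
  \<open>\<delta> > 0\<close> the inner rings dominate. For \<open>\<delta> = 0\<close> all rings up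
  to \<open>log 2 T / q\<close> contribute equally, which makes the logarithm. For
  \<open>\<delta> < 0\<close> the rings with \<open>2^n\<close> near \<open>T^(1 / q)\<close>
  dominate, and the tail exponent \<open>p / q\<close> takes over.\<close>

lemma ring_sum_bound:
  fixes p q \<beta> :: real
  assumes p: "0 < p" "p < q" and \<beta>: "0 < \<beta>" "\<beta> < 1"
  shows "\<exists>C>0. \<forall>T\<ge>2. \<forall>N. (\<Sum>n<N. 2 powr (p * real n) * (2 powr (- q * real n) * min 1 ((2 powr (- q * real n) * T) powr - \<beta>)))
    \<le> C * T powr - (1 - max (1 - \<beta>) (p / q)) * (if (1 - \<beta>) * q = p then ln T else 1)"
proof -
  define \<delta> where "\<delta> = (1 - \<beta>) * q - p"
  have q: "0 < q" using p by simp
  let ?m = "\<lambda>T n. min (2 powr (- (q - p) * real (n::nat))) (2 powr (- \<delta> * real n) * T powr - \<beta>)"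
  have summand: "2 powr (p * real n) * (2 powr (- q * real n) * min 1 ((2 powr (- q * real n) * T) powr - \<beta>))
      = ?m T n" if "2 \<le> T" for n T
  proof -
    have "(2 powr (- q * real n) * T) powr - \<beta> = 2 powr (q * \<beta> * real n) * T powr - \<beta>"
      using that by (simp add: powr_mult powr_powr mult_ac)
    then have "2 powr (p * real n) * (2 powr (- q * real n) * min 1 ((2 powr (- q * real n) * T) powr - \<beta>))
        = min (2 powr (p * real n) * 2 powr (- q * real n)) (2 powr (p * real n) * 2 powr (- q * real n) * (2 powr (q * \<beta> * real n) * T powr - \<beta>))"
      by (simp add: min_mult_distrib_left mult.assoc[symmetric])
    also have "2 powr (p * real n) * 2 powr (- q * real n) = 2 powr (- (q - p) * real n)"
      by (simp add: powr_add[symmetric] algebra_simps)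
    also have "2 powr (- (q - p) * real n) * (2 powr (q * \<beta> * real n) * T powr - \<beta>) = 2 powr (- \<delta> * real n) * T powr - \<beta>"
      by (simp only: mult.assoc[symmetric] powr_add[symmetric]) (simp add: \<delta>_def algebra_simps)
    finally show ?thesis .
  qed
  consider "0 < \<delta>" | "\<delta> = 0" | "\<delta> < 0" by linarith
  then show ?thesis
  proof cases
    case 1
    then have m: "max (1 - \<beta>) (p / q) = 1 - \<beta>" "(1 - \<beta>) * q \<noteq> p" using q by (auto simp: \<delta>_def max_def field_simps)
    define C where "C = 1 / (1 - 2 powr - \<delta>)"
    have C: "0 < C" using two_powr_lt_1[OF 1] by (simp add: C_def)
    have "(\<Sum>n<N. ?m T n) \<le> C * T powr - \<beta>" for T N
    proof -
      have "(\<Sum>n<N. ?m T n) \<le> (\<Sum>n<N. 2 powr (- \<delta> * real n) * T powr - \<beta>)"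
        by (intro sum_mono) simp
      also have "\<dots> \<le> C * T powr - \<beta>"
        unfolding sum_distrib_right[symmetric] C_def by (intro mult_right_mono sum_two_powr_le 1) simp
      finally show ?thesis .
    qed
    then show ?thesis using C m summand by (intro exI[of _ C]) simp
  next
    case 2
    then have m: "max (1 - \<beta>) (p / q) = 1 - \<beta>" "(1 - \<beta>) * q = p" using q by (auto simp: \<delta>_def max_def field_simps)
    have qp: "q - p = q * \<beta>" using m(2) by (simp add: algebra_simps)
    have qb: "0 < q * \<beta>" using q \<beta> by simp
    define r where "r = 2 powr - (q * \<beta>)"
    have r: "0 < r" "r < 1" using two_powr_lt_1[OF qb] by (auto simp: r_def)
    \<comment> \<open>The first summand comes from \<open>log 2 T / q\<close>; in the second,
      rounding and the geometric tail are paid for by \<open>ln T / ln 2 \<ge> 1\<close>.\<close>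
    define C where "C = 1 / (q * ln 2) + (1 + 1 / (1 - r)) / ln 2"
    have C: "0 < C" using r q by (auto simp: C_def intro!: add_pos_pos divide_pos_pos mult_pos_pos)
    have "(\<Sum>n<N. ?m T n) \<le> C * T powr - \<beta> * ln T"
      (is "?S \<le> _") if T: "2 \<le> T" for T N
    proof -
      \<comment> \<open>From ring \<open>k\<close> on \<open>2^(-q n) T\<close> is at most
        \<open>1\<close>, and the first argument of the minimum decays geometrically from
        \<open>T^(-\<beta>)\<close>.\<close>
      define k where "k = nat \<lceil>log 2 T / q\<rceil>"
      have "0 \<le> log 2 T / q" using T q by simp
      then have k: "log 2 T / q \<le> real k" "real k \<le> log 2 T / q + 1" unfolding k_def by linarith+
      have tail: "2 powr (- (q * \<beta>) * real n) \<le> T powr - \<beta> * r ^ (n - k)" if "k \<le> n" for n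
      proof -
        have "2 powr (- (q * \<beta>) * real n) = 2 powr (- (q * \<beta>) * real k) * r ^ (n - k)"
          using r that by (simp add: r_def powr_realpow[symmetric] powr_powr powr_add[symmetric] of_nat_diff algebra_simps)
        also have "2 powr (- (q * \<beta>) * real k) \<le> 2 powr (- \<beta> * log 2 T)"
        proof (intro powr_mono)
          have "\<beta> * log 2 T \<le> \<beta> * (q * real k)" using k(1) q \<beta> by (intro mult_left_mono) (auto simp: field_simps)
          then show "- (q * \<beta>) * real k \<le> - \<beta> * log 2 T" by (simp add: mult_ac)
        qed simp
        also have "2 powr (- \<beta> * log 2 T) = (2 powr log 2 T) powr - \<beta>"
          unfolding powr_powr by (simp add: mult.commute)
        also have "\<dots> = T powr - \<beta>" using T by simp
        finally show ?thesis using r by (simp add: mult_right_mono)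
      qed
      have "?S = (\<Sum>n\<in>{..<N} \<inter> {..<k}. ?m T n)
          + (\<Sum>n\<in>{..<N} - {..<k}. ?m T n)"
        by (rule sum.Int_Diff) simp
      also have "\<dots> \<le> (\<Sum>n\<in>{..<N} \<inter> {..<k}. T powr - \<beta>) + (\<Sum>n\<in>{..<N} - {..<k}. T powr - \<beta> * r ^ (n - k))"
        using tail 2 by (intro add_mono sum_mono) (auto simp: qp min.coboundedI1)
      also have "(\<Sum>n\<in>{..<N} \<inter> {..<k}. T powr - \<beta>) \<le> real k * T powr - \<beta>"
        using card_mono[of "{..<k}" "{..<N} \<inter> {..<k}"] by (simp add: mult_right_mono)
      also have "(\<Sum>n\<in>{..<N} - {..<k}. T powr - \<beta> * r ^ (n - k)) \<le> T powr - \<beta> * (1 / (1 - r))"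
        unfolding sum_distrib_left[symmetric] using r
        by (intro mult_left_mono sum_power_inj_le) (auto simp: inj_on_def)
      finally have "?S \<le> T powr - \<beta> * (real k + 1 / (1 - r))" by (simp add: algebra_simps)
      also have "\<dots> \<le> T powr - \<beta> * (C * ln T)"
      proof (intro mult_left_mono)
        have lnT: "ln 2 \<le> ln T" using T by simp
        have "1 + 1 / (1 - r) \<le> (1 + 1 / (1 - r)) * (ln T / ln 2)"
          using lnT r by (intro mult_le_cancel_left1[THEN iffD2]) (auto simp: field_simps)
        then have "real k + 1 / (1 - r) \<le> ln T / (ln 2 * q) + (1 + 1 / (1 - r)) * (ln T / ln 2)"
          using k(2) by (simp add: log_def)
        moreover have "(1 / (q * l) + B / l) * t = t / (l * q) + B * (t / l)" for l B t
          by (subst distrib_right) (simp add: mult_ac)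
        ultimately show "real k + 1 / (1 - r) \<le> C * ln T"
          unfolding C_def by metis
      qed simp
      finally show ?thesis by (simp add: mult_ac)
    qed
    then show ?thesis using C m summand by (intro exI[of _ C]) simp
  next
    case 3
    then have m: "max (1 - \<beta>) (p / q) = p / q" "(1 - \<beta>) * q \<noteq> p" using q by (auto simp: \<delta>_def max_def field_simps)
    obtain C where C: "0 < C" "\<And>A N. 0 < A \<Longrightarrow>
        (\<Sum>n<N. min ((2 powr real n / A) powr - (q - p)) ((2 powr real n / A) powr - \<delta>)) \<le> C"
      using two_sided_geometric[of "q - p" "- \<delta>"] p 3 by auto
    have "(\<Sum>n<N. ?m T n) \<le> C * T powr - (1 - p / q)"
      if T: "2 \<le> T" for T N
    proof -
      \<comment> \<open>The ring scale at which \<open>2^(-q n) T = 1\<close>; both arguments of the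
        minimum equal \<open>A^(-(q - p))\<close> there.\<close>
      define A where "A = T powr (1 / q)"
      have A: "0 < A" using T by (simp add: A_def)
      have scale: "T powr - (1 - p / q) = A powr - (q - p)"
      proof -
        have "- (1 - p / q) = 1 / q * - (q - p)" using q by (simp add: field_simps)
        then show ?thesis by (simp only: A_def powr_powr)
      qed
      have e1: "2 powr (- (q - p) * real n) = A powr - (q - p) * (2 powr real n / A) powr - (q - p)" for n
        using A by (simp add: powr_divide powr_powr mult.commute)
      have e2: "2 powr (- \<delta> * real n) * T powr - \<beta> = A powr - (q - p) * (2 powr real n / A) powr - \<delta>" for n
      proof -
        have "T powr - \<beta> = A powr (- (q - p) + \<delta>)"
        proof -
          have "- \<beta> = 1 / q * (- (q - p) + \<delta>)" using q by (simp add: \<delta>_def field_simps)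
          then show ?thesis by (simp only: A_def powr_powr)
        qed
        moreover have "(2 powr real n / A) powr - \<delta> = 2 powr (- \<delta> * real n) * A powr \<delta>"
          using A by (simp add: powr_divide powr_powr powr_minus field_simps)
        ultimately show ?thesis by (simp only: powr_add mult_ac)
      qed
      have "u * min x v = min (u * x) (u * v)" if "0 \<le> u" for u v x :: real
        using that by (simp add: min_mult_distrib_left)
      then have "(\<Sum>n<N. ?m T n)
          = A powr - (q - p) * (\<Sum>n<N. min ((2 powr real n / A) powr - (q - p)) ((2 powr real n / A) powr - \<delta>))"
        unfolding e1 e2 by (simp add: sum_distrib_left)
      also have "\<dots> \<le> A powr - (q - p) * C" by (intro mult_left_mono C(2) A) simp
      finally show ?thesis unfolding scale by (simp add: mult.commute)
    qed
    then show ?thesis using C m summand by (intro exI[of _ C]) simp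
  qed
qed

text \<open>Up to a constant, the expected total discrepancy of the \<open>2\<^sup>d\<^sup>i\<close> cubes of level \<open>i\<close> in ring \<open>n\<close>.\<close>
abbreviation scale_term :: "real \<Rightarrow> real \<Rightarrow> real \<Rightarrow> nat \<Rightarrow> nat \<Rightarrow> real" where
  "scale_term d q T n i \<equiv> min (2 powr (- q * real n)) (2 powr (d * real i / 2) * sqrt (2 powr (- q * real n) / T))"

text \<open>The depth \<open>L\<close> is the least one with \<open>2^(-p L) \<le> 1 / T\<close>. It
  serves all rings at once: the level sum has a bound that depends on \<open>L\<close> only for
  \<open>p = d / 2\<close>, and otherwise only on the ring mass times \<open>T\<close>.\<close>

lemma multiscale_rate:
  fixes d p q :: real
  assumes d: "0 < d" and p: "0 < p" "p < q"
  defines "\<gamma> \<equiv> max (1/2) (1 - p / d)"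
  shows "\<exists>C>0. \<forall>T\<ge>2. \<exists>L. 2 powr (- p * real L)
        \<le> C * (T powr - (1 - max \<gamma> (p / q)) * (if \<gamma> * q = p then ln T else 1) * (if p = d / 2 then ln T else 1)) \<and>
      (\<forall>N. (\<Sum>n<N. 2 powr (p * real n) * (\<Sum>i<L. 2 powr (- p * real i) * scale_term d q T n i))
        \<le> C * (T powr - (1 - max \<gamma> (p / q)) * (if \<gamma> * q = p then ln T else 1) * (if p = d / 2 then ln T else 1)))"
proof -
  define \<beta> where "\<beta> = min (1/2) (p / d)"
  have \<beta>: "0 < \<beta>" "\<beta> < 1" and \<gamma>: "\<gamma> = 1 - \<beta>"
    using d p by (auto simp: \<beta>_def \<gamma>_def min_def max_def)
  obtain C1 where C1: "0 < C1" and level: "\<forall>y>0. \<forall>L.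
      (\<Sum>i<L. 2 powr (- p * real i) * min 1 (2 powr (d * real i / 2) * y powr (-1/2)))
        \<le> C1 * (if p = d / 2 then real L + 1 else 1) * min 1 (y powr - \<beta>)"
    using level_sum_bound[OF d p(1), folded \<beta>_def] by blast
  obtain C2 where C2: "0 < C2" and ring_index: "\<forall>T\<ge>2. \<forall>N.
      (\<Sum>n<N. 2 powr (p * real n) * (2 powr (- q * real n) * min 1 ((2 powr (- q * real n) * T) powr - \<beta>)))
        \<le> C2 * T powr - (1 - max (1 - \<beta>) (p / q)) * (if (1 - \<beta>) * q = p then ln T else 1)"
    using ring_sum_bound[OF p \<beta>] by blast
  define C3 where "C3 = 1 + 1 / (p * ln 2) + 2 / ln 2"
  have C3: "1 \<le> C3" using p by (simp add: C3_def add_increasing2)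
  define l1 where "l1 T = (if \<gamma> * q = p then ln T else 1)" for T :: real
  define l2 where "l2 T = (if p = d / 2 then ln T else 1)" for T :: real
  define \<kappa> where "\<kappa> = 1 - max \<gamma> (p / q)"
  \<comment> \<open>The second summand is for the cut-off term: at \<open>T = 2\<close> the
    logarithmic factors may be as small as \<open>ln 2 < 1\<close>.\<close>
  define C where "C = C1 * C2 * C3 + 1 / (ln 2 * ln 2)"
  have C: "0 < C" using C1 C2 C3 by (simp add: C_def add_pos_pos)
  have "\<exists>L. 2 powr (- p * real L) \<le> C * (T powr - \<kappa> * l1 T * l2 T) \<and>
      (\<forall>N. (\<Sum>n<N. 2 powr (p * real n) * (\<Sum>i<L. 2 powr (- p * real i) * scale_term d q T n i))
        \<le> C * (T powr - \<kappa> * l1 T * l2 T))" if T: "2 \<le> T" for T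
  proof -
    have lnT: "ln 2 \<le> ln T" "0 < ln T" using T by auto
    have ln2: "ln 2 \<le> (1::real)" using ln_le_minus_one[of 2] by simp
    have l: "ln 2 \<le> l1 T" "ln 2 \<le> l2 T" using lnT ln2 by (auto simp: l1_def l2_def)
    have l0: "0 < l1 T" "0 < l2 T" using lnT by (auto simp: l1_def l2_def)
    define L where "L = nat \<lceil>log 2 T / p\<rceil>"
    have "0 \<le> log 2 T / p" using T p by simp
    then have L: "log 2 T / p \<le> real L" "real L \<le> log 2 T / p + 1" unfolding L_def by linarith+
    have "2 powr (- p * real L) \<le> 2 powr (- log 2 T)"
      using L(1) p by (intro powr_mono) (auto simp: field_simps)
    also have "\<dots> = T powr - 1" using T by (simp add: powr_minus)
    also have "\<dots> \<le> T powr - \<kappa>"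
      using T by (intro powr_mono) (auto simp: \<kappa>_def \<gamma>_def)
    also have "\<dots> = 1 / (ln 2 * ln 2) * (T powr - \<kappa> * ln 2 * ln 2)" by simp
    also have "\<dots> \<le> 1 / (ln 2 * ln 2) * (T powr - \<kappa> * l1 T * l2 T)"
      using l l0 by (intro mult_left_mono mult_mono) auto
    also have "\<dots> \<le> C * (T powr - \<kappa> * l1 T * l2 T)"
      using C1 C2 C3 l0 by (intro mult_right_mono) (auto simp: C_def)
    finally have fine: "2 powr (- p * real L) \<le> C * (T powr - \<kappa> * l1 T * l2 T)" .
    have Lam: "(if p = d / 2 then real L + 1 else 1) \<le> C3 * l2 T"
    proof (cases "p = d / 2")
      case True
      have "2 \<le> 2 / ln 2 * ln T" using lnT by (simp add: field_simps)
      moreover have "log 2 T / p = 1 / (p * ln 2) * ln T" by (simp add: log_def)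
      ultimately have "real L + 1 \<le> (1 / (p * ln 2) + 2 / ln 2) * ln T"
        using L(2) by (simp add: distrib_right)
      also have "\<dots> \<le> C3 * ln T" using lnT by (intro mult_right_mono) (auto simp: C3_def)
      finally show ?thesis using True by (simp add: l2_def)
    qed (use C3 in \<open>simp add: l2_def\<close>)
    have "(\<Sum>n<N. 2 powr (p * real n) * (\<Sum>i<L. 2 powr (- p * real i) * scale_term d q T n i))
        \<le> C * (T powr - \<kappa> * l1 T * l2 T)" for N
    proof -
      have "2 powr (p * real n) * (\<Sum>i<L. 2 powr (- p * real i) * scale_term d q T n i)
        \<le> C1 * (C3 * l2 T) * (2 powr (p * real n) * (2 powr (- q * real n) * min 1 ((2 powr (- q * real n) * T) powr - \<beta>)))" for n
      proof -
        define e where "e = 2 powr (- q * real n)"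
        have e: "0 < e" by (simp add: e_def)
        \<comment> \<open>Factoring out the ring mass \<open>e\<close> leaves the level sum with
          \<open>y = e * T\<close>.\<close>
        have "min e (k * sqrt (e / T)) = e * min 1 (k * (e * T) powr (-1/2))" for k
        proof -
          have "sqrt (e / T) = e * (e * T) powr (-1/2)"
            using e T by (simp add: powr_minus powr_half_sqrt real_sqrt_mult real_sqrt_divide field_simps)
          then show ?thesis using e by (simp add: min_mult_distrib_left mult.left_commute)
        qed
        then have "(\<Sum>i<L. 2 powr (- p * real i) * min e (2 powr (d * real i / 2) * sqrt (e / T)))
            = e * (\<Sum>i<L. 2 powr (- p * real i) * min 1 (2 powr (d * real i / 2) * (e * T) powr (-1/2)))"
          by (simp add: sum_distrib_left mult.left_commute)
        also have "\<dots> \<le> e * (C1 * (if p = d / 2 then real L + 1 else 1) * min 1 ((e * T) powr - \<beta>))"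
          using e T by (intro mult_left_mono level[rule_format]) auto
        also have "\<dots> \<le> e * (C1 * (C3 * l2 T) * min 1 ((e * T) powr - \<beta>))"
          using e C1 Lam by (intro mult_left_mono mult_right_mono) auto
        finally have "2 powr (p * real n) * (\<Sum>i<L. 2 powr (- p * real i) * min e (2 powr (d * real i / 2) * sqrt (e / T)))
            \<le> 2 powr (p * real n) * (e * (C1 * (C3 * l2 T) * min 1 ((e * T) powr - \<beta>)))"
          by (intro mult_left_mono) auto
        then show ?thesis unfolding e_def by (simp add: mult_ac)
      qed
      then have "(\<Sum>n<N. 2 powr (p * real n) * (\<Sum>i<L. 2 powr (- p * real i) * scale_term d q T n i))
        \<le> C1 * (C3 * l2 T) * (\<Sum>n<N. 2 powr (p * real n) * (2 powr (- q * real n) * min 1 ((2 powr (- q * real n) * T) powr - \<beta>)))"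
        unfolding sum_distrib_left by (intro sum_mono)
      also have "\<dots> \<le> C1 * (C3 * l2 T) * (C2 * T powr - \<kappa> * l1 T)"
        using ring_index[rule_format, OF T] C1 C3 l0 by (intro mult_left_mono) (auto simp: \<kappa>_def l1_def \<gamma>)
      also have "\<dots> = C1 * C2 * C3 * (T powr - \<kappa> * l1 T * l2 T)" by simp
      also have "\<dots> \<le> C * (T powr - \<kappa> * l1 T * l2 T)"
        using l0 by (intro mult_right_mono) (auto simp: C_def)
      finally show ?thesis .
    qed
    with fine show ?thesis by blast
  qed
  then show ?thesis using C unfolding \<kappa>_def l1_def l2_def by blast
qed

text \<open>The factor \<open>card I\<close> is the price of Cauchy-Schwarz; with
  \<open>2^(d i)\<close> cubes its root is the growth factor \<open>2^(d i / 2)\<close> of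
  \<open>scale_term\<close>.\<close>

lemma sum_min_sqrt_le:
  fixes a :: "'i \<Rightarrow> real"
  assumes "\<And>x. x \<in> I \<Longrightarrow> 0 \<le> a x" and s: "0 \<le> s"
  shows "(\<Sum>x\<in>I. min (2 * a x) (sqrt (s * a x))) \<le> min (2 * sum a I) (sqrt (s * real (card I) * sum a I))"
proof (rule min.boundedI)
  show "(\<Sum>x\<in>I. min (2 * a x) (sqrt (s * a x))) \<le> 2 * sum a I"
    unfolding sum_distrib_left by (intro sum_mono) simp
  have "(\<Sum>x\<in>I. sqrt (a x))\<^sup>2 \<le> (\<Sum>x\<in>I. (sqrt (a x))\<^sup>2) * real (card I)"
    by (rule sum_squared_le_sum_of_squares)
  also have "(\<Sum>x\<in>I. (sqrt (a x))\<^sup>2) = sum a I" using assms by simp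
  finally have "(\<Sum>x\<in>I. sqrt (a x)) \<le> sqrt (sum a I * real (card I))"
    by (rule real_le_rsqrt)
  then have "sqrt s * (\<Sum>x\<in>I. sqrt (a x)) \<le> sqrt s * sqrt (sum a I * real (card I))"
    using s by (intro mult_left_mono) auto
  then have "(\<Sum>x\<in>I. sqrt (s * a x)) \<le> sqrt (s * real (card I) * sum a I)"
    by (simp add: real_sqrt_mult sum_distrib_left mult_ac)
  moreover have "(\<Sum>x\<in>I. min (2 * a x) (sqrt (s * a x))) \<le> (\<Sum>x\<in>I. sqrt (s * a x))"
    by (intro sum_mono) simp
  ultimately show "(\<Sum>x\<in>I. min (2 * a x) (sqrt (s * a x))) \<le> sqrt (s * real (card I) * sum a I)" by simp
qed

section \<open>The rate\<close>

text \<open>Outside ring \<open>0\<close> the definition of the ring index gives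
  \<open>2^n \<le> 2 |x|\<close>, hence the factor \<open>2^q\<close> in \<open>B\<close>; ring
  \<open>0\<close> is the whole open unit ball and accounts for the summand \<open>1\<close>. The
  integral serves the cut-off term, and the pointwise tail, by Markov's inequality, the
  discrepancies.\<close>

lemma (in stationary_markov) ring_tail:
  assumes q: "0 < q" and fin: "(\<integral>\<^sup>+x. ennreal (norm x powr q) \<partial>\<mu>) < \<infinity>"
  shows "\<exists>B\<ge>1. (\<integral>\<^sup>+x. ennreal (2 powr (q * real (ring_index x))) \<partial>\<mu>) \<le> ennreal B \<and>
    (\<forall>n. measure \<mu> {x. ring_index x = n} \<le> B * 2 powr (- q * real n))"
proof -
  define Q where "Q = enn2real (\<integral>\<^sup>+x. ennreal (norm x powr q) \<partial>\<mu>)"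
  have Q: "(\<integral>\<^sup>+x. ennreal (norm x powr q) \<partial>\<mu>) = ennreal Q" "0 \<le> Q"
    using fin by (simp_all add: Q_def)
  define B where "B = 1 + 2 powr q * Q"
  have B0: "0 \<le> B" using Q(2) by (simp add: B_def)
  have "2 powr (q * real (ring_index x)) \<le> 1 + 2 powr q * norm x powr q" for x :: 'a
  proof (cases "ring_index x = 0")
    case False
    have "2 powr (q * real (ring_index x)) = (2 ^ ring_index x) powr q"
      by (simp add: powr_realpow[symmetric] powr_powr mult.commute)
    also have "\<dots> \<le> (2 * norm x) powr q"
      using q ring_le_norm[OF False] by (intro powr_mono2) auto
    also have "\<dots> = 2 powr q * norm x powr q" by (simp add: powr_mult)
    finally show ?thesis by simp
  qed simp
  then have "(\<integral>\<^sup>+x. ennreal (2 powr (q * real (ring_index x))) \<partial>\<mu>) \<le> (\<integral>\<^sup>+x. 1 + ennreal (2 powr q) * ennreal (norm x powr q) \<partial>\<mu>)"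
    by (intro nn_integral_mono) (simp add: ennreal_1[symmetric] del: ennreal_1 flip: ennreal_mult ennreal_plus)
  also have "\<dots> = ennreal B"
    using Q(2) mu.emeasure_space_1
    by (simp add: nn_integral_add nn_integral_cmult Q B_def ennreal_mult ennreal_plus)
  finally have I: "(\<integral>\<^sup>+x. ennreal (2 powr (q * real (ring_index x))) \<partial>\<mu>) \<le> ennreal B" .
  have "measure \<mu> {x. ring_index x = n} \<le> B * 2 powr (- q * real n)" for n
  proof -
    have [measurable]: "{x. ring_index x = n} \<in> sets borel"
      using measurable_sets[OF ring_measurable, of "{n}"] by (simp add: vimage_def)
    have "ennreal (2 powr (q * real n)) * emeasure \<mu> {x. ring_index x = n}
        = (\<integral>\<^sup>+x. ennreal (2 powr (q * real n)) * indicator {x. ring_index x = n} x \<partial>\<mu>)"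
      by (simp add: nn_integral_cmult_indicator)
    also have "\<dots> \<le> (\<integral>\<^sup>+x. ennreal (2 powr (q * real (ring_index x))) \<partial>\<mu>)"
      by (intro nn_integral_mono) (auto simp: indicator_def)
    also note I
    finally have "2 powr (q * real n) * measure \<mu> {x. ring_index x = n} \<le> B"
      using B0 by (simp add: mu.emeasure_eq_measure flip: ennreal_mult)
    then show ?thesis by (simp add: powr_minus field_simps)
  qed
  then show ?thesis using I Q(2) by (intro exI[of _ B]) (auto simp: B_def)
qed

lemma measure_ring_eq_sum:
  fixes \<mu> :: "'a::euclidean_space measure"
  assumes "finite_measure \<mu>" "sets \<mu> = sets borel"
  shows "(\<Sum>xs\<in>dyadic_indices DIM('a) i. measure \<mu> (dyadic_key (Suc i) -` {(n, xs)})) = measure \<mu> {x. ring_index x = n}"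
proof -
  interpret finite_measure \<mu> by fact
  have key: "dyadic_key (Suc i) -` {j} \<in> sets \<mu>" for j
    using measurable_sets[OF dyadic_key_measurable, of "{j}"] assms(2) by simp
  have "(\<Sum>xs\<in>dyadic_indices DIM('a) i. measure \<mu> (dyadic_key (Suc i) -` {(n, xs)}))
      = measure \<mu> (\<Union>xs\<in>dyadic_indices DIM('a) i. dyadic_key (Suc i) -` {(n, xs)})"
    using key by (intro finite_measure_finite_Union[symmetric] dyadic_indices) (auto simp: disjoint_family_on_def)
  also have "(\<Union>xs\<in>dyadic_indices DIM('a) i. dyadic_key (Suc i) -` {(n, xs)}) = {x :: 'a. ring_index x = n}"
    using dyadic_key_in_indices[of i] by (auto simp: dyadic_key_def)
  finally show ?thesis .
qed

lemma (in stationary_markov) level_deviation: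
  assumes T: "0 < T" and c: "coercive K \<mu> c" "0 < c" and B: "1 \<le> B"
    and tail: "measure \<mu> {x. ring_index x = n} \<le> B * 2 powr (- q * real n)"
  shows "(\<integral>\<^sup>+xs. (\<integral>\<^sup>+w. ennreal \<bar>measure (empirical_measure X T w) (dyadic_key (Suc i) -` {(n, xs)})
        - measure \<mu> (dyadic_key (Suc i) -` {(n, xs)})\<bar> \<partial>M) \<partial>count_space UNIV)
    \<le> ennreal ((2 * B + sqrt (4 * B / c)) * scale_term (real DIM('a)) q T n i)"
proof -
  let ?I = "dyadic_indices DIM('a) i"
  define m where "m xs = measure \<mu> (dyadic_key (Suc i) -` {(n, xs)})" for xs
  define e where "e = 2 powr (- q * real n)"
  define k where "k = 2 powr (real DIM('a) * real i / 2)"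
  have e: "0 < e" and k: "0 < k" by (simp_all add: e_def k_def)
  have key: "dyadic_key (Suc i) -` {j} \<in> sets (borel :: 'a measure)" for j
    using measurable_sets[OF dyadic_key_measurable, of "{j}"] by simp
  have m_out: "m xs = 0" if "xs \<notin> ?I" for xs
  proof -
    have "dyadic_key (Suc i) -` {(n, xs)} = ({} :: 'a set)"
    proof safe
      fix x :: 'a assume "dyadic_key (Suc i) x = (n, xs)"
      then show "x \<in> {}" using dyadic_key_in_indices[of i x] that by auto
    qed
    then show ?thesis by (simp add: m_def)
  qed
  have "(\<integral>\<^sup>+xs. (\<integral>\<^sup>+w. ennreal \<bar>measure (empirical_measure X T w) (dyadic_key (Suc i) -` {(n, xs)})
        - measure \<mu> (dyadic_key (Suc i) -` {(n, xs)})\<bar> \<partial>M) \<partial>count_space UNIV)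
      \<le> (\<integral>\<^sup>+xs. ennreal (min (2 * m xs) (sqrt (4 / (c * T) * m xs))) \<partial>count_space UNIV)"
    using empirical_deviation(2)[OF key T c] by (intro nn_integral_mono) (simp add: m_def)
  \<comment> \<open>Keys outside \<open>?I\<close> belong to empty cells, where the minimum is
    \<open>0\<close>, so the sum over all integer lists is finite.\<close>
  also have "\<dots> = (\<Sum>xs\<in>?I. ennreal (min (2 * m xs) (sqrt (4 / (c * T) * m xs))))"
    using m_out by (intro nn_integral_count_space' dyadic_indices) auto
  also have "\<dots> = ennreal (\<Sum>xs\<in>?I. min (2 * m xs) (sqrt (4 / (c * T) * m xs)))"
    using T c by (intro sum_ennreal) (auto simp: m_def)
  also have "(\<Sum>xs\<in>?I. min (2 * m xs) (sqrt (4 / (c * T) * m xs))) \<le> min (2 * sum m ?I) (sqrt (4 / (c * T) * real (card ?I) * sum m ?I))"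
    using T c by (intro sum_min_sqrt_le) (auto simp: m_def)
  also have "\<dots> \<le> min (2 * (B * e)) (sqrt (4 / (c * T) * real (card ?I) * (B * e)))"
  proof -
    have "sum m ?I \<le> B * e"
      unfolding m_def e_def measure_ring_eq_sum[OF mu.finite_measure_axioms sets_mu] by (rule tail)
    then show ?thesis using T c by (intro min.mono real_sqrt_le_mono mult_left_mono) auto
  qed
  also have "real (card ?I) = k\<^sup>2"
    by (simp add: dyadic_indices k_def powr_realpow[symmetric] power2_eq_square powr_add[symmetric] mult.commute)
  also have "sqrt (4 / (c * T) * k\<^sup>2 * (B * e)) = sqrt (4 * B / c) * (k * sqrt (e / T))"
    using k by (simp add: real_sqrt_mult real_sqrt_divide)
  also have "min (2 * (B * e)) (sqrt (4 * B / c) * (k * sqrt (e / T))) \<le> (2 * B + sqrt (4 * B / c)) * min e (k * sqrt (e / T))"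
  proof -
    have s: "0 \<le> sqrt (4 * B / c)" and z: "0 \<le> k * sqrt (e / T)" using B c k e T by auto
    have "min (u * x) (v * y) \<le> (u + v) * min x y" if "0 \<le> u" "0 \<le> v" "0 \<le> x" "0 \<le> y" for u v x y :: real
    proof (cases "x \<le> y")
      case True
      then show ?thesis using that by (simp add: distrib_right min.coboundedI1)
    next
      case False
      then show ?thesis using that by (simp add: distrib_right min.coboundedI2)
    qed
    from this[of "2 * B" "sqrt (4 * B / c)" e "k * sqrt (e / T)"] show ?thesis
      using B e s z by (simp add: mult.assoc)
  qed
  finally show ?thesis unfolding e_def k_def by (simp add: ennreal_leI)
qed

lemma (in stationary_markov) expected_transport_cost:
  fixes p q :: real
  assumes T: "0 < T" and c: "coercive K \<mu> c" "0 < c" and p: "0 < p" "p < q" and B: "1 \<le> B"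
    and moment: "(\<integral>\<^sup>+x. ennreal (2 powr (q * real (ring_index x))) \<partial>\<mu>) \<le> ennreal B"
    and tail: "\<And>n. measure \<mu> {x. ring_index x = n} \<le> B * 2 powr (- q * real n)"
    and R: "2 powr (- p * real L) \<le> R"
      "\<And>N. (\<Sum>n<N. 2 powr (p * real n) * (\<Sum>i<L. 2 powr (- p * real i) * scale_term (real DIM('a)) q T n i)) \<le> R"
  shows "(\<integral>\<^sup>+w. transport_cost p (empirical_measure X T w) \<mu> \<partial>M)
    \<le> ennreal ((4 * real DIM('a)) powr p * (4 * B + sqrt (4 * B / c)) * R)"
proof -
  let ?d = "DIM('a)"
  define c0 where "c0 = (4 * real ?d) powr p"
  define B1 where "B1 = 2 * B + sqrt (4 * B / c)"
  have c0: "0 \<le> c0" and B1: "0 \<le> B1" using B c by (auto simp: c0_def B1_def)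
  have cost: "dyadic_cost ?d p l n = c0 * (2 powr (p * real n) * 2 powr (- p * real l))" for l n
    by (simp add: dyadic_cost_def c0_def powr_add[symmetric] algebra_simps)
  have key: "dyadic_key (Suc i) -` {j} \<in> sets (borel :: 'a measure)" for i j
    using measurable_sets[OF dyadic_key_measurable, of "{j}"] by simp
  define \<delta> where "\<delta> i j w = ennreal \<bar>measure (empirical_measure X T w) (dyadic_key (Suc i) -` {j})
      - measure \<mu> (dyadic_key (Suc i) -` {j} :: 'a set)\<bar>" for i j w
  have [measurable]: "\<delta> i j \<in> borel_measurable M" for i j
    unfolding \<delta>_def[abs_def] using empirical_deviation(1)[OF key T c] by measurable
  let ?D = "\<lambda>w. \<integral>\<^sup>+j. (\<Sum>i<L. ennreal (dyadic_cost ?d p i (fst j)) * \<delta> i j w) \<partial>count_space UNIV"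
  let ?E = "\<integral>\<^sup>+j. (\<Sum>i<L. ennreal (dyadic_cost ?d p i (fst j)) * (\<integral>\<^sup>+w. \<delta> i j w \<partial>M)) \<partial>count_space UNIV"
  define W where "W x = ennreal (dyadic_cost ?d p L (ring_index x))" for x :: 'a
  have W_meas [measurable]: "W \<in> borel_measurable borel"
    unfolding W_def[abs_def] by (rule measurable_compose[OF ring_measurable]) simp
  have W: "(\<integral>\<^sup>+x. W x \<partial>\<mu>) \<le> ennreal (c0 * B * R)"
  proof -
    have "(\<integral>\<^sup>+x. W x \<partial>\<mu>) \<le> (\<integral>\<^sup>+x. ennreal (c0 * R) * ennreal (2 powr (q * real (ring_index x))) \<partial>\<mu>)"
    proof (intro nn_integral_mono)
      fix x :: 'a
      have "dyadic_cost ?d p L (ring_index x) = c0 * 2 powr (- p * real L) * 2 powr (p * real (ring_index x))"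
        by (simp add: cost)
      \<comment> \<open>The weight \<open>2^(p n)\<close> is dominated by \<open>2^(q n)\<close>,
        whose integral is at most \<open>B\<close>; the smallness \<open>R\<close> comes from the
        depth alone.\<close>
      also have "\<dots> \<le> c0 * R * 2 powr (q * real (ring_index x))"
        using c0 R(1) p order_trans[OF _ R(1), of 0]
        by (intro mult_mono mult_left_mono powr_mono mult_right_mono) auto
      finally show "W x \<le> ennreal (c0 * R) * ennreal (2 powr (q * real (ring_index x)))"
        using c0 order_trans[OF _ R(1), of 0] by (simp add: W_def ennreal_leI flip: ennreal_mult)
    qed
    also have "\<dots> = ennreal (c0 * R) * (\<integral>\<^sup>+x. ennreal (2 powr (q * real (ring_index x))) \<partial>\<mu>)"
    proof (intro nn_integral_cmult)
      have "(\<lambda>x::'a. ennreal (2 powr (q * real (ring_index x)))) \<in> borel_measurable borel"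
        by (rule measurable_compose[OF ring_measurable]) simp
      then show "(\<lambda>x. ennreal (2 powr (q * real (ring_index x)))) \<in> borel_measurable \<mu>"
        by (simp cong: measurable_cong_sets)
    qed
    also have "\<dots> \<le> ennreal (c0 * R) * ennreal B" by (intro mult_left_mono moment) simp
    also have "\<dots> = ennreal (c0 * B * R)"
      using c0 B order_trans[OF _ R(1), of 0] by (simp add: mult_ac flip: ennreal_mult)
    finally show ?thesis .
  qed
  have lev: "(\<integral>\<^sup>+j. ennreal (dyadic_cost ?d p i (fst j)) * (\<integral>\<^sup>+w. \<delta> i j w \<partial>M) \<partial>count_space UNIV)
      \<le> (\<integral>\<^sup>+n. ennreal (dyadic_cost ?d p i n) * ennreal (B1 * scale_term (real ?d) q T n i) \<partial>count_space UNIV)" for i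
  proof -
    have "(\<integral>\<^sup>+j. ennreal (dyadic_cost ?d p i (fst j)) * (\<integral>\<^sup>+w. \<delta> i j w \<partial>M) \<partial>count_space UNIV)
        = (\<integral>\<^sup>+n. (\<integral>\<^sup>+xs. ennreal (dyadic_cost ?d p i n) * (\<integral>\<^sup>+w. \<delta> i (n, xs) w \<partial>M) \<partial>count_space UNIV) \<partial>count_space UNIV)"
      by (subst nn_integral_fst_count_space[symmetric]) simp
    also have "\<dots> = (\<integral>\<^sup>+n. ennreal (dyadic_cost ?d p i n) * (\<integral>\<^sup>+xs. (\<integral>\<^sup>+w. \<delta> i (n, xs) w \<partial>M) \<partial>count_space UNIV) \<partial>count_space UNIV)"
      by (intro nn_integral_cong nn_integral_cmult) simp
    also have "\<dots> \<le> (\<integral>\<^sup>+n. ennreal (dyadic_cost ?d p i n) * ennreal (B1 * scale_term (real ?d) q T n i) \<partial>count_space UNIV)"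
      unfolding \<delta>_def B1_def by (intro nn_integral_mono mult_left_mono level_deviation T c B tail) simp
    finally show ?thesis .
  qed
  have levels: "?E
      \<le> ennreal (c0 * B1 * R)"
  proof -
    define a where "a n = 2 powr (p * real n) * (\<Sum>i<L. 2 powr (- p * real i) * scale_term (real ?d) q T n i)" for n :: nat
    have a: "0 \<le> a n" for n unfolding a_def using T by (intro mult_nonneg_nonneg sum_nonneg) auto
    have "?E
        \<le> (\<Sum>i<L. \<integral>\<^sup>+n. ennreal (dyadic_cost ?d p i n) * ennreal (B1 * scale_term (real ?d) q T n i) \<partial>count_space UNIV)"
      by (subst nn_integral_sum) (simp, intro sum_mono lev)
    also have "\<dots> = (\<integral>\<^sup>+n. (\<Sum>i<L. ennreal (dyadic_cost ?d p i n) * ennreal (B1 * scale_term (real ?d) q T n i)) \<partial>count_space UNIV)"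
      by (subst nn_integral_sum) auto
    also have "\<dots> = (\<integral>\<^sup>+n. ennreal (c0 * B1 * a n) \<partial>count_space UNIV)"
    proof (intro nn_integral_cong)
      fix n :: nat
      have "(\<Sum>i<L. ennreal (dyadic_cost ?d p i n) * ennreal (B1 * scale_term (real ?d) q T n i))
        = (\<Sum>i<L. ennreal (c0 * B1 * (2 powr (p * real n) * (2 powr (- p * real i) * scale_term (real ?d) q T n i))))"
        using c0 B1 T by (intro sum.cong refl) (simp add: cost mult_ac flip: ennreal_mult)
      also have "\<dots> = ennreal (\<Sum>i<L. c0 * B1 * (2 powr (p * real n) * (2 powr (- p * real i) * scale_term (real ?d) q T n i)))"
        using c0 B1 T by (intro sum_ennreal) auto
      also have "\<dots> = ennreal (c0 * B1 * a n)"
        by (simp only: a_def sum_distrib_left)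
      finally show "(\<Sum>i<L. ennreal (dyadic_cost ?d p i n) * ennreal (B1 * scale_term (real ?d) q T n i)) = ennreal (c0 * B1 * a n)" .
    qed
    also have "\<dots> = (\<Sum>n. ennreal (c0 * B1 * a n))" by (rule nn_integral_count_space_nat)
    also have "\<dots> \<le> ennreal (c0 * B1 * R)"
    proof (rule suminf_le_const[OF summableI])
      fix N
      have "(\<Sum>n<N. ennreal (c0 * B1 * a n)) = ennreal (c0 * B1 * (\<Sum>n<N. a n))"
        using c0 B1 a by (subst sum_ennreal) (auto simp: sum_distrib_left)
      also have "\<dots> \<le> ennreal (c0 * B1 * R)"
        using c0 B1 R(2)[of N] by (intro ennreal_leI mult_left_mono) (auto simp: a_def)
      finally show "(\<Sum>n<N. ennreal (c0 * B1 * a n)) \<le> ennreal (c0 * B1 * R)" .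
    qed
    finally show ?thesis .
  qed
  \<comment> \<open>Measurability of the transport cost in \<open>w\<close> is not established.
    Monotonicity of \<open>nn_integral\<close> holds for arbitrary functions, and additivity is
    applied only to the measurable majorant.\<close>
  have "(\<integral>\<^sup>+w. transport_cost p (empirical_measure X T w) \<mu> \<partial>M)
      \<le> (\<integral>\<^sup>+w. (\<integral>\<^sup>+x. W x \<partial>empirical_measure X T w) + (\<integral>\<^sup>+x. W x \<partial>\<mu>)
          + ?D w \<partial>M)"
  proof (intro nn_integral_mono)
    fix w assume w: "w \<in> space M"
    show "transport_cost p (empirical_measure X T w) \<mu> \<le> (\<integral>\<^sup>+x. W x \<partial>empirical_measure X T w) + (\<integral>\<^sup>+x. W x \<partial>\<mu>)
          + ?D w"
      using transport_cost_dyadic[OF p(1) prob_empirical[OF T w] mu.prob_space_axioms sets_empirical[OF T] sets_mu, of L]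
      by (simp add: W_def \<delta>_def nn_integral_sum)
  qed
  also have "\<dots> = (\<integral>\<^sup>+w. (\<integral>\<^sup>+x. W x \<partial>empirical_measure X T w) \<partial>M) + (\<integral>\<^sup>+x. W x \<partial>\<mu>)
      + ?E"
  proof -
    have m1: "(\<lambda>w. \<integral>\<^sup>+x. W x \<partial>empirical_measure X T w) \<in> borel_measurable M"
      by (rule measurable_nn_integral_empirical[OF T W_meas])
    have m2: "(\<lambda>w. ?D w) \<in> borel_measurable M"
    proof -
      interpret S: sigma_finite_measure "count_space UNIV :: (nat \<times> int list) measure"
        by (rule sigma_finite_measure_count_space)
      have "(\<lambda>z. \<Sum>i<L. ennreal (dyadic_cost ?d p i (fst (snd z))) * \<delta> i (snd z) (fst z))
          \<in> borel_measurable (M \<Otimes>\<^sub>M count_space (UNIV :: (nat \<times> int list) set))"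
        by (rule measurable_compose_countable[where g=snd and
            f="\<lambda>j z. \<Sum>i<L. ennreal (dyadic_cost ?d p i (fst j)) * \<delta> i j (fst z)"]) measurable
      then show ?thesis
        by (intro S.borel_measurable_nn_integral) (simp add: case_prod_unfold)
    qed
    have "(\<integral>\<^sup>+w. (\<integral>\<^sup>+x. W x \<partial>empirical_measure X T w) + (\<integral>\<^sup>+x. W x \<partial>\<mu>)
          + ?D w \<partial>M)
        = (\<integral>\<^sup>+w. (\<integral>\<^sup>+x. W x \<partial>empirical_measure X T w) \<partial>M) + (\<integral>\<^sup>+x. W x \<partial>\<mu>)
          + (\<integral>\<^sup>+w. ?D w \<partial>M)"
      using m1 m2 by (simp add: nn_integral_add emeasure_space_1)
    also have "(\<integral>\<^sup>+w. ?D w \<partial>M)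
        = (\<integral>\<^sup>+j. (\<integral>\<^sup>+w. (\<Sum>i<L. ennreal (dyadic_cost ?d p i (fst j)) * \<delta> i j w) \<partial>M) \<partial>count_space UNIV)"
      by (intro nn_integral_count_space_nn_integral) auto
    also have "\<dots> = ?E"
      by (intro nn_integral_cong) (simp add: nn_integral_sum nn_integral_cmult)
    finally show ?thesis .
  qed
  also have "(\<integral>\<^sup>+w. (\<integral>\<^sup>+x. W x \<partial>empirical_measure X T w) \<partial>M) = (\<integral>\<^sup>+x. W x \<partial>\<mu>)"
    by (rule nn_integral_empirical[OF T W_meas])
  \<comment> \<open>The cut-off costs \<open>B\<close> once for the empirical measure and once for
    \<open>\<mu>\<close>; with the \<open>2 * B\<close> inside \<open>B1\<close> this makes
    \<open>4 * B\<close>.\<close>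
  also have "(\<integral>\<^sup>+x. W x \<partial>\<mu>) + (\<integral>\<^sup>+x. W x \<partial>\<mu>)
      + ?E
      \<le> ennreal (c0 * B * R) + ennreal (c0 * B * R) + ennreal (c0 * B1 * R)"
    by (intro add_mono W levels)
  also have "\<dots> = ennreal (c0 * B * R + c0 * B * R + c0 * B1 * R)"
    using c0 B B1 order_trans[OF _ R(1), of 0] by (simp flip: ennreal_plus)
  also have "c0 * B * R + c0 * B * R + c0 * B1 * R = (4 * real ?d) powr p * (4 * B + sqrt (4 * B / c)) * R"
    by (simp add: c0_def B1_def algebra_simps)
  finally show ?thesis .
qed

theorem theorem1p3:
  fixes M :: "'b measure" and X :: "real \<Rightarrow> 'b \<Rightarrow> 'a::euclidean_space"
    and K :: "real \<Rightarrow> 'a \<Rightarrow> 'a measure" and \<mu> :: "'a measure"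
    and p q lamC :: real
  assumes "prob_space M"
    and "markov_process M X K"
    and "distr M borel (X 0) = \<mu>"
    and "invariant_measure K \<mu>"
    and "ergodic K \<mu>"
    and "lamC > 0" and "coercive K \<mu> lamC"
    and "p > 0" and "q > p"
    and "(\<integral>\<^sup>+ x. ennreal (norm x powr q) \<partial>\<mu>) < \<infinity>"
  defines "d \<equiv> real DIM('a)"
  defines "\<gamma>2 \<equiv> max (1/2) (1 - p / d)"
  shows "\<exists>C>0.
    (\<forall>T\<ge>2. (\<integral>\<^sup>+ \<omega>. transport_cost p (empirical_measure X T \<omega>) \<mu> \<partial>M)
        \<le> ennreal (C * T powr (- (1 - max \<gamma>2 (p / q)))
                   * (if \<gamma>2 * q = p then ln T else 1)
                   * (if p = d / 2 then ln T else 1))) \<and>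
    (q > 2 * p \<longrightarrow> (\<forall>T\<ge>2. (\<integral>\<^sup>+ \<omega>. transport_cost p (empirical_measure X T \<omega>) \<mu> \<partial>M)
        \<le> ennreal (if p > d / 2 then C * T powr (-1/2)
                   else if p = d / 2 then C * T powr (-1/2) * ln T
                   else C * T powr (- p / d))))"
proof -
  interpret stationary_markov M X K \<mu>
    using assms(1-4) by (simp add: stationary_markov_def stationary_markov_axioms_def)
  have d: "0 < d" by (simp add: d_def)
  have q: "0 < q" using assms by simp
  obtain B where B: "1 \<le> B" and moment: "(\<integral>\<^sup>+x. ennreal (2 powr (q * real (ring_index x))) \<partial>\<mu>) \<le> ennreal B"
    and tail: "\<And>n. measure \<mu> {x. ring_index x = n} \<le> B * 2 powr (- q * real n)"
    using ring_tail[OF q assms(10)] by blast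
  define rate where "rate T = T powr - (1 - max \<gamma>2 (p / q)) * (if \<gamma>2 * q = p then ln T else 1) * (if p = d / 2 then ln T else 1)" for T :: real
  obtain C0 where C0: "0 < C0" and levels: "\<forall>T\<ge>2. \<exists>L. 2 powr (- p * real L) \<le> C0 * rate T \<and>
      (\<forall>N. (\<Sum>n<N. 2 powr (p * real n) * (\<Sum>i<L. 2 powr (- p * real i) * scale_term d q T n i)) \<le> C0 * rate T)"
    using multiscale_rate[OF d assms(8,9)] unfolding rate_def \<gamma>2_def by blast
  define C where "C = (4 * d) powr p * (4 * B + sqrt (4 * B / lamC)) * C0"
  have C: "0 < C" using C0 B d assms(6) by (auto simp: C_def intro!: mult_pos_pos add_pos_nonneg)
  have main: "(\<integral>\<^sup>+w. transport_cost p (empirical_measure X T w) \<mu> \<partial>M) \<le> ennreal (C * rate T)" if T: "2 \<le> T" for T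
  proof -
    obtain L where L: "2 powr (- p * real L) \<le> C0 * rate T"
      "\<And>N. (\<Sum>n<N. 2 powr (p * real n) * (\<Sum>i<L. 2 powr (- p * real i) * scale_term (real DIM('a)) q T n i)) \<le> C0 * rate T"
      using levels T unfolding d_def by blast
    from T have "0 < T" by simp
    from expected_transport_cost[OF this assms(7,6,8,9) B moment tail L] show ?thesis
      by (simp add: C_def d_def mult.assoc)
  qed
  have "(\<integral>\<^sup>+w. transport_cost p (empirical_measure X T w) \<mu> \<partial>M)
      \<le> ennreal (if p > d / 2 then C * T powr (-1/2) else if p = d / 2 then C * T powr (-1/2) * ln T else C * T powr (- p / d))"
    if q2: "q > 2 * p" and T: "2 \<le> T" for T
  proof -
    \<comment> \<open>Both effects of \<open>q\<close> disappear in this regime: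
      \<open>\<gamma>2\<close> is at least \<open>1 / 2\<close> and wins the maximum, and
      \<open>\<gamma>2 * q \<ge> q / 2 > p\<close> excludes the first logarithm.\<close>
    have "p / q < 1 / 2" using q2 assms(8) by (simp add: field_simps)
    moreover have "1 / 2 \<le> \<gamma>2" by (simp add: \<gamma>2_def)
    ultimately have m: "max \<gamma>2 (p / q) = \<gamma>2" by (intro max_absorb1) linarith
    have "1 / 2 * q \<le> \<gamma>2 * q" using \<open>1 / 2 \<le> \<gamma>2\<close> q by (intro mult_right_mono) auto
    then have ne: "\<gamma>2 * q \<noteq> p" using q2 by simp
    have "1 - \<gamma>2 = (if p < d / 2 then p / d else 1 / 2)"
      using d by (auto simp: \<gamma>2_def max_def field_simps)
    then have "C * rate T = (if p > d / 2 then C * T powr (-1/2) else if p = d / 2 then C * T powr (-1/2) * ln T else C * T powr (- p / d))"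
      unfolding rate_def m using ne by auto
    then show ?thesis using main[OF T] by simp
  qed
  then show ?thesis
    using C main unfolding rate_def by (intro exI[of _ C]) (auto simp: mult.assoc)
qed

end
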